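(* Let $\sigma>0$ and $\varpi\in\mathbb{R}$, and set $\nu=2\sigma^{-2}\varpi-1$. Let $a>0$. Then the integral $$F_{GY,a}(z)=\int_0^\infty e^{-zx}\,E^Q\big[(A_x^{(\nu)}-a)^+\big]\,dx$$ is finite for any complex number $z$ with $\operatorname{Re}(z)>\max\{0,2(\nu+1)\}$. Moreover, let $z$ be any complex number with positive real part $z_0$ such that $z_0>2(\nu+1)$ if $\nu\ge 0$ and $z_0>4$ if $\nu<0$. Then $$F_{GY,a}(z)=\frac{D_\nu(a,z)}{z\,(z-2(\nu+1))},$$ where $$D_\nu(a,z)=\frac{e^{-\frac{1}{2a}}}{a}\int_0^\infty e^{-\frac{x^2}{2a}}\,x^{\nu+3}\,I_{\sqrt{2z+\nu^2}}\Big(\frac{x}{a}\Big)\,dx .$$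
   Context: $B$ is a standard Brownian motion (started at $0$) under the probability measure $Q$, and $E^Q$ denotes expectation under $Q$. For $\nu\in\mathbb{R}$ and $x\ge 0$, Yor's accumulation process is $A_x^{(\nu)}=\int_0^x e^{2(B_w+\nu w)}\,dw$. For real $y$, $y^+=\max\{0,y\}$. The square root is the one associated with the principal branch of the logarithm on $\mathbb{C}\setminus\mathbb{R}_{\le 0}$ (arguments in $(-\pi,\pi)$, so that the square root has positive real part). $I_\mu$ is the modified Bessel function of the first kind of complex order $\mu$, $I_\mu(\xi)=\sum_{n=0}^\infty \frac{(\xi/2)^{\mu+2n}}{n!\,\Gamma(\mu+n+1)}$ for $\xi>0$. *)

theory Defs
  imports "HOL-Probability.Probability"
begin

text \<open>
  Time is \<open>[0,\<infinity>)\<close>, so \<open>B t\<close> is unconstrained for \<open>t < 0\<close>. Every path is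
  required to be continuous, while \<open>B 0 = 0\<close> is only required almost surely. Requiring
  continuity of every path makes path functionals such as \<open>yor_A\<close> below random variables
  without a completeness assumption on the probability space.
\<close>

locale std_brownian_motion = prob_space Q for Q :: "'a measure" +
  fixes B :: "real \<Rightarrow> 'a \<Rightarrow> real"
  assumes random_variable_B: "\<And>t. 0 \<le> t \<Longrightarrow> B t \<in> borel_measurable Q"
    and start_0: "AE \<omega> in Q. B 0 \<omega> = 0"
    and indep_increments:
      "\<And>(\<tau> :: nat \<Rightarrow> real) n. 0 \<le> \<tau> 0 \<Longrightarrow> (\<And>i. i < n \<Longrightarrow> \<tau> i < \<tau> (Suc i)) \<Longrightarrow>
         indep_vars (\<lambda>_. borel) (\<lambda>i \<omega>. B (\<tau> (Suc i)) \<omega> - B (\<tau> i) \<omega>) {..<n}"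
    and normal_increments:
      "\<And>s t. 0 \<le> s \<Longrightarrow> s < t \<Longrightarrow>
         distributed Q lborel (\<lambda>\<omega>. B t \<omega> - B s \<omega>) (normal_density 0 (sqrt (t - s)))"
    and continuous_paths: "\<And>\<omega>. \<omega> \<in> space Q \<Longrightarrow> continuous_on {0..} (\<lambda>t. B t \<omega>)"

definition yor_A :: "(real \<Rightarrow> 'a \<Rightarrow> real) \<Rightarrow> real \<Rightarrow> real \<Rightarrow> 'a \<Rightarrow> real" where
  "yor_A B \<nu> x \<omega> = (LBINT w:{0..x}. exp (2 * (B w \<omega> + \<nu> * w)))"

definition yor_call :: "(real \<Rightarrow> 'a \<Rightarrow> real) \<Rightarrow> real \<Rightarrow> real \<Rightarrow> real \<Rightarrow> 'a \<Rightarrow> real" where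
  "yor_call B \<nu> a x \<omega> = max 0 (yor_A B \<nu> x \<omega> - a)"

definition GY_integrand ::
    "'a measure \<Rightarrow> (real \<Rightarrow> 'a \<Rightarrow> real) \<Rightarrow> real \<Rightarrow> real \<Rightarrow> complex \<Rightarrow> real \<Rightarrow> complex" where
  "GY_integrand Q B \<nu> a z x =
     exp (- z * complex_of_real x) * complex_of_real (\<integral>\<omega>. yor_call B \<nu> a x \<omega> \<partial>Q)"

definition F_GY :: "'a measure \<Rightarrow> (real \<Rightarrow> 'a \<Rightarrow> real) \<Rightarrow> real \<Rightarrow> real \<Rightarrow> complex \<Rightarrow> complex" where
  "F_GY Q B \<nu> a z = (LBINT x:{0..}. GY_integrand Q B \<nu> a z x)"

text \<open>
  At the poles of \<open>Gamma\<close> the convention \<open>Gamma = 0\<close> together with \<open>c / 0 = 0\<close> gives the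
  usual value \<open>0\<close> of \<open>1 / Gamma\<close>. Only arguments \<open>\<xi> > 0\<close> are meaningful.
\<close>

definition bessel_I :: "complex \<Rightarrow> real \<Rightarrow> complex" where
  "bessel_I \<mu> \<xi> =
     (\<Sum>n. complex_of_real (\<xi> / 2) powr (\<mu> + 2 * of_nat n)
            / (fact n * Gamma (\<mu> + of_nat n + 1)))"

definition D_integrand :: "real \<Rightarrow> real \<Rightarrow> complex \<Rightarrow> real \<Rightarrow> complex" where
  "D_integrand \<nu> a z x =
     complex_of_real (exp (- (x\<^sup>2 / (2 * a))) * x powr (\<nu> + 3))
       * bessel_I (csqrt (2 * z + complex_of_real (\<nu>\<^sup>2))) (x / a)"

definition D_GY :: "real \<Rightarrow> real \<Rightarrow> complex \<Rightarrow> complex" where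
  "D_GY \<nu> a z =
     complex_of_real (exp (- (1 / (2 * a))) / a) * (LBINT x:{0<..}. D_integrand \<nu> a z x)"

end

theory Submission
  imports Defs "HOL-Complex_Analysis.Complex_Analysis" "HOL-Real_Asymp.Real_Asymp"
begin

text \<open>
  For real \<open>z\<close>, differentiating \<open>(A X - A r - a)\<^sup>+\<close> in \<open>r\<close> and using the Markov property at
  time \<open>r\<close> expresses the Laplace transform \<open>f a\<close> of the call price through
  the transform \<open>H = - f'\<close> of the tail probabilities:
  \<open>f a = \<integral> k y * e\<^bsup>2 y\<^esup> * H (a * e\<^bsup>- 2 y\<^esup>) dy\<close>, where \<open>k y = e\<^bsup>\<nu> y - m \<bar>y\<bar>\<^esup> / m\<close>,
  \<open>m = sqrt (2 z + \<nu>\<^sup>2)\<close>, is the Laplace transform of the heat kernel with drift. In the variable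
  \<open>u = - ln (2 a)\<close> this is a convolution with an exponential kernel, hence a second order linear
  differential equation for \<open>f\<close>. Integrating the Bessel series term by term turns \<open>D_GY\<close> into a
  Kummer function, which solves the same equation; the limits at \<open>a \<rightarrow> 0\<close> and \<open>a \<rightarrow> \<infinity>\<close> agree
  after division by \<open>z (z - 2 (\<nu> + 1))\<close>, and the maximum principle gives equality.
  Both sides are holomorphic in \<open>z\<close>, which extends the identity to complex \<open>z\<close>.
\<close>

section \<open>Limits of independent random variables\<close>

text \<open>Differentiating at the left end \<open>r\<close> pays off because
  \<open>A X - A r\<close> depends only on \<open>B r\<close> and on the increments after
  \<open>r\<close>. The Markov property is thus needed only for one pair: \<open>B r\<close> and the
  accumulation of the restarted path, which are independent, the latter distributed like
  \<open>A (X - r)\<close>. Independence and equality in law both survive limits of Riemann sums, so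
  no law on path space enters. The restarted path meets the strike scaled by
  \<open>exp (- 2 * y)\<close>, so the logarithm of the strike turns scaling into translation; the 2
  in \<open>u = - ln (2 * a)\<close> makes the Kummer argument \<open>1 / (2 * a)\<close> equal to
  \<open>exp u\<close>. No density of \<open>A\<close> is used: continuity of \<open>H\<close>
  suffices, since the exponential kernel supplies the second derivative. The equation closes because
  \<open>H\<close> is itself \<open>- f'\<close>. The condition \<open>z > 2 * (\<nu> + 1)\<close>
  acts three times: the transform at strike 0 is finite, both kernel exponents are positive, and the
  zeroth order coefficient \<open>z / 2 - \<nu> - 1\<close> has the sign that the maximum principle
  needs. That principle selects one solution from the two-dimensional space by limits of values
  alone, with no asymptotics of derivatives.\<close>

lemma measurable_caratheodory:
  fixes f :: "real \<Rightarrow> 'a \<Rightarrow> real"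
  assumes meas: "\<And>t. f t \<in> borel_measurable M"
    and cont: "\<And>\<omega>. \<omega> \<in> space M \<Longrightarrow> continuous_on UNIV (\<lambda>t. f t \<omega>)"
  shows "(\<lambda>(t, \<omega>). f t \<omega>) \<in> borel_measurable (borel \<Otimes>\<^sub>M M)"
proof (rule borel_measurable_LIMSEQ_metric)
  let ?u = "\<lambda>n p. f (of_int \<lfloor>real (Suc n) * fst p\<rfloor> / real (Suc n)) (snd p)"
  fix n
  \<comment> \<open>Time is rounded down to the grid of mesh \<open>1 / Suc n\<close>. Only
    countably many grid times occur, so measurability at each fixed time is enough; path continuity
    then carries it to the limit.\<close>
  have "(\<lambda>p. f (of_int i / real (Suc n)) (snd p)) \<in> borel_measurable (borel \<Otimes>\<^sub>M M)" for i :: int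
    using meas by measurable
  moreover have "(\<lambda>p :: real \<times> 'a. \<lfloor>real (Suc n) * fst p\<rfloor>) \<in> measurable (borel \<Otimes>\<^sub>M M) (count_space UNIV)"
    by measurable
  ultimately show "?u n \<in> borel_measurable (borel \<Otimes>\<^sub>M M)"
    by (rule measurable_compose_countable)
next
  fix p assume p: "p \<in> space (borel \<Otimes>\<^sub>M M :: (real \<times> 'a) measure)"
  then have c: "continuous_on UNIV (\<lambda>t. f t (snd p))"
    by (intro cont) (auto simp: space_pair_measure)
  have "(\<lambda>n. of_int \<lfloor>real (Suc n) * fst p\<rfloor> / real (Suc n)) \<longlonglongrightarrow> fst p"
  proof (rule tendsto_sandwich)
    show "\<forall>\<^sub>F n in sequentially. fst p - 1 / real (Suc n) \<le> of_int \<lfloor>real (Suc n) * fst p\<rfloor> / real (Suc n)"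
    proof (intro always_eventually allI)
      fix n
      have "real (Suc n) * fst p - 1 \<le> of_int \<lfloor>real (Suc n) * fst p\<rfloor>" by linarith
      then have "(real (Suc n) * fst p - 1) / real (Suc n) \<le> of_int \<lfloor>real (Suc n) * fst p\<rfloor> / real (Suc n)"
        by (rule divide_right_mono) simp
      then show "fst p - 1 / real (Suc n) \<le> of_int \<lfloor>real (Suc n) * fst p\<rfloor> / real (Suc n)"
        by (simp add: diff_divide_distrib del: of_nat_Suc)
    qed
    show "\<forall>\<^sub>F n in sequentially. of_int \<lfloor>real (Suc n) * fst p\<rfloor> / real (Suc n) \<le> fst p"
    proof (intro always_eventually allI)
      fix n
      have "of_int \<lfloor>real (Suc n) * fst p\<rfloor> \<le> real (Suc n) * fst p" by linarith
      then show "of_int \<lfloor>real (Suc n) * fst p\<rfloor> / real (Suc n) \<le> fst p"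
        by (simp add: divide_le_eq mult.commute del: of_nat_Suc)
    qed
    show "(\<lambda>n. fst p - 1 / real (Suc n)) \<longlonglongrightarrow> fst p"
      using tendsto_diff[OF tendsto_const LIMSEQ_inverse_real_of_nat, of "fst p"]
      by (simp add: inverse_eq_divide)
  qed auto
  from continuous_on_tendsto_compose[OF c this]
  show "(\<lambda>n. f (of_int \<lfloor>real (Suc n) * fst p\<rfloor> / real (Suc n)) (snd p)) \<longlonglongrightarrow> (case p of (t, \<omega>) \<Rightarrow> f t \<omega>)"
    by (simp add: case_prod_beta del: of_nat_Suc)
qed

lemma riemann_sums_tendsto:
  fixes \<phi> :: "real \<Rightarrow> real"
  assumes x: "0 < x" and c: "continuous_on {0..x} \<phi>"
  shows "(\<lambda>n. \<Sum>j<Suc n. x / Suc n * \<phi> (real j * (x / Suc n))) \<longlonglongrightarrow> (LBINT w:{0..x}. \<phi> w)"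
proof -
  have "(LBINT w:{0..x}. \<phi> w) = integral {0..x} \<phi>"
    using c borel_integrable_atLeastAtMost'[OF c] by (intro set_borel_integral_eq_integral)
  moreover have "(\<lambda>n. \<Sum>j<Suc n. x / Suc n * \<phi> (real j * (x / Suc n))) \<longlonglongrightarrow> integral {0..x} \<phi>"
  proof (rule LIMSEQ_I)
    fix \<epsilon> :: real assume e: "0 < \<epsilon>"
    \<comment> \<open>An oscillation of at most \<open>\<delta>\<close> on every cell gives a total
      error of at most \<open>x * \<delta> = \<epsilon> / 2\<close>.\<close>
    define \<delta> where "\<delta> = \<epsilon> / (2 * x)"
    have dpos: "0 < \<delta>" using e x by (simp add: \<delta>_def)
    from compact_uniformly_continuous[OF c] have "uniformly_continuous_on {0..x} \<phi>" by simp
    then obtain d where d: "0 < d" and D: "\<And>s t. s \<in> {0..x} \<Longrightarrow> t \<in> {0..x} \<Longrightarrow> dist t s < d \<Longrightarrow> dist (\<phi> t) (\<phi> s) < \<delta>"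
      unfolding uniformly_continuous_on_def using dpos by metis
    obtain N where N: "x / d < real N" using reals_Archimedean2 by blast
    have "norm ((\<Sum>j<Suc n. x / Suc n * \<phi> (real j * (x / Suc n))) - integral {0..x} \<phi>) < \<epsilon>" if n: "n \<ge> N" for n
    proof -
      define h where "h = x / Suc n"
      have h0: "0 < h" using x by (simp add: h_def)
      have hn: "h * Suc n = x" by (simp add: h_def)
      have hd: "h < d"
      proof -
        have "x / d < Suc n" using N n by linarith
        then show ?thesis using d by (simp add: h_def field_simps)
      qed
      \<comment> \<open>Partial sums are compared with the integral up to \<open>k * h\<close>, so
        that each induction step adds the error of one cell.\<close>
      have step: "\<bar>(\<Sum>j<k. h * \<phi> (real j * h)) - integral {0..k * h} \<phi>\<bar> \<le> k * h * \<delta>" if "k \<le> Suc n" for k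
        using that
      proof (induction k)
        case 0
        show ?case by simp
      next
        case (Suc k)
        have le: "real (Suc k) * h \<le> x"
        proof -
          have "real (Suc k) * h \<le> real (Suc n) * h" using Suc.prems h0 by (intro mult_right_mono) auto
          then show ?thesis using hn by (simp add: mult.commute)
        qed
        have c1: "continuous_on {0..Suc k * h} \<phi>" using le by (intro continuous_on_subset[OF c]) auto
        have klek: "k * h \<le> Suc k * h" using h0 by simp
        have k0: "0 \<le> k * h" using h0 by simp
        have c2: "continuous_on {k * h..Suc k * h} \<phi>" using k0 by (intro continuous_on_subset[OF c1]) auto
        have split: "integral {0..Suc k * h} \<phi> = integral {0..k * h} \<phi> + integral {k * h..Suc k * h} \<phi>"
          using Henstock_Kurzweil_Integration.integral_combine[of 0 "k * h" "Suc k * h" \<phi>] integrable_continuous_real[OF c1] klek k0 by simp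
        have c3: "continuous_on {k * h..Suc k * h} (\<lambda>t. \<phi> t - \<phi> (k * h))"
          by (intro continuous_intros c2)
        have "norm (integral {k * h..Suc k * h} (\<lambda>t. \<phi> t - \<phi> (k * h))) \<le> \<delta> * (Suc k * h - k * h)"
        proof (rule integral_bound[OF klek c3])
          fix t assume t: "t \<in> {k * h..Suc k * h}"
          have "dist t (k * h) < d" using t hd by (auto simp: dist_real_def algebra_simps)
          then have "dist (\<phi> t) (\<phi> (k * h)) < \<delta>" using t k0 le klek by (intro D) auto
          then show "norm (\<phi> t - \<phi> (k * h)) \<le> \<delta>" by (simp add: dist_real_def)
        qed
        moreover have "integral {k * h..Suc k * h} (\<lambda>t. \<phi> t - \<phi> (k * h)) = integral {k * h..Suc k * h} \<phi> - h * \<phi> (k * h)"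
          using integrable_continuous_real[OF c2] klek
          by (subst Henstock_Kurzweil_Integration.integral_diff) (auto simp: algebra_simps)
        moreover have "\<bar>(\<Sum>j<k. h * \<phi> (real j * h)) - integral {0..k * h} \<phi>\<bar> \<le> k * h * \<delta>"
          using Suc by simp
        ultimately show ?case
          unfolding split by (simp add: algebra_simps)
      qed
      have "x * \<delta> < \<epsilon>" using e x by (simp add: \<delta>_def)
      moreover have "\<bar>(\<Sum>j<Suc n. h * \<phi> (real j * h)) - integral {0..x} \<phi>\<bar> \<le> x * \<delta>"
        using step[of "Suc n"] hn by (simp add: mult.commute)
      ultimately show ?thesis by (simp add: h_def)
    qed
    then show "\<exists>no. \<forall>n\<ge>no. norm ((\<Sum>j<Suc n. x / Suc n * \<phi> (real j * (x / Suc n))) - integral {0..x} \<phi>) < \<epsilon>"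
      by blast
  qed
  ultimately show ?thesis by simp
qed

text \<open>Products of an indicator of \<open>X\<close> and a bounded continuous function of
  \<open>Sn n\<close> factorise, and both sides converge by dominated convergence. The second
  sequence \<open>Sn'\<close>, equal in law to \<open>Sn\<close>, lets the limit law be named by
  \<open>S'\<close> instead of \<open>S\<close>; this is how stationarity of the increments will
  enter.\<close>

lemma (in prob_space) limit_independent_law:
  fixes X S S' :: "'a \<Rightarrow> real"
  assumes X[measurable]: "random_variable borel X"
    and S[measurable]: "random_variable borel S" and S'[measurable]: "random_variable borel S'"
    and lim: "\<And>\<omega>. \<omega> \<in> space M \<Longrightarrow> (\<lambda>n. Sn n \<omega>) \<longlonglongrightarrow> S \<omega>"
    and lim': "\<And>\<omega>. \<omega> \<in> space M \<Longrightarrow> (\<lambda>n. Sn' n \<omega>) \<longlonglongrightarrow> S' \<omega>"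
    and ind: "\<And>n :: nat. indep_var borel X borel (Sn n)"
    and Sn'[measurable]: "\<And>n. random_variable borel (Sn' n)"
    and law: "\<And>n. distr M borel (Sn n) = distr M borel (Sn' n)"
  shows "distr M (borel \<Otimes>\<^sub>M borel) (\<lambda>\<omega>. (X \<omega>, S \<omega>)) = distr M borel X \<Otimes>\<^sub>M distr M borel S'"
proof -
  have Sn[measurable]: "random_variable borel (Sn n)" for n using ind indep_var_rv2 by blast
  have prod: "expectation (\<lambda>\<omega>. indicator U (X \<omega>) * \<phi> (S \<omega>)) = prob (X -` U \<inter> space M) * expectation (\<lambda>\<omega>. \<phi> (S' \<omega>))"
    if U[measurable]: "U \<in> sets borel" and c: "continuous_on UNIV \<phi>" and b: "\<And>v. \<bar>\<phi> v\<bar> \<le> 1" for U and \<phi> :: "real \<Rightarrow> real"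
  proof -
    have \<phi>[measurable]: "\<phi> \<in> borel_measurable borel" using c by (rule borel_measurable_continuous_onI)
    have step: "expectation (\<lambda>\<omega>. indicator U (X \<omega>) * \<phi> (Sn n \<omega>)) = prob (X -` U \<inter> space M) * expectation (\<lambda>\<omega>. \<phi> (Sn' n \<omega>))" for n
    proof -
      have "indep_var borel (indicator U \<circ> X) borel (\<phi> \<circ> Sn n)"
        by (rule indep_var_compose[OF ind]) measurable
      then have "expectation (\<lambda>\<omega>. (indicator U \<circ> X) \<omega> * (\<phi> \<circ> Sn n) \<omega>) = expectation (indicator U \<circ> X) * expectation (\<phi> \<circ> Sn n)"
        by (rule indep_var_lebesgue_integral)
           (use b in \<open>auto intro!: integrable_const_bound[where B=1]\<close>)
      moreover have "expectation (indicator U \<circ> X) = prob (X -` U \<inter> space M)"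
      proof -
        have "expectation (indicator U \<circ> X) = (\<integral>\<omega>. indicator (X -` U \<inter> space M) \<omega> \<partial>M)"
          by (intro Bochner_Integration.integral_cong) (auto simp: indicator_def)
        also have "\<dots> = prob (X -` U \<inter> space M)" by simp
        finally show ?thesis .
      qed
      moreover have "expectation (\<phi> \<circ> Sn n) = integral\<^sup>L (distr M borel (Sn n)) \<phi>"
        by (subst integral_distr) (auto simp: comp_def)
      moreover have "integral\<^sup>L (distr M borel (Sn' n)) \<phi> = expectation (\<lambda>\<omega>. \<phi> (Sn' n \<omega>))"
        by (subst integral_distr) auto
      ultimately show ?thesis by (simp add: law comp_def)
    qed
    have "(\<lambda>n. expectation (\<lambda>\<omega>. indicator U (X \<omega>) * \<phi> (Sn n \<omega>))) \<longlonglongrightarrow> expectation (\<lambda>\<omega>. indicator U (X \<omega>) * \<phi> (S \<omega>))"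
    proof (rule integral_dominated_convergence[where w="\<lambda>_. 1"])
      show "AE \<omega> in M. (\<lambda>n. indicator U (X \<omega>) * \<phi> (Sn n \<omega>)) \<longlonglongrightarrow> indicator U (X \<omega>) * \<phi> (S \<omega>)"
        by (intro AE_I2 tendsto_mult_left continuous_on_tendsto_compose[OF c lim]) auto
      show "AE \<omega> in M. norm (indicator U (X \<omega>) * \<phi> (Sn n \<omega>)) \<le> 1" for n
        using b by (intro AE_I2) (auto simp: indicator_def)
    qed auto
    moreover have "(\<lambda>n. expectation (\<lambda>\<omega>. \<phi> (Sn' n \<omega>))) \<longlonglongrightarrow> expectation (\<lambda>\<omega>. \<phi> (S' \<omega>))"
    proof (rule integral_dominated_convergence[where w="\<lambda>_. 1"])
      show "AE \<omega> in M. (\<lambda>n. \<phi> (Sn' n \<omega>)) \<longlonglongrightarrow> \<phi> (S' \<omega>)"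
        by (intro AE_I2 continuous_on_tendsto_compose[OF c lim']) auto
    qed (use b in auto)
    ultimately show ?thesis
      unfolding step by (rule LIMSEQ_unique[OF _ tendsto_mult_left])
  qed
  have le: "prob {\<omega> \<in> space M. X \<omega> \<in> U \<and> S \<omega> \<le> c} = prob (X -` U \<inter> space M) * prob {\<omega> \<in> space M. S' \<omega> \<le> c}"
    if U[measurable]: "U \<in> sets borel" for U c
  proof -
    \<comment> \<open>Continuous ramps that fall from 1 to 0 on \<open>[c, c + 1/k]\<close> and
      converge pointwise to the indicator of \<open>{..c}\<close>.\<close>
    define \<phi> where "\<phi> k v = max 0 (1 - real k * max 0 (v - c))" for k :: nat and v
    have c: "continuous_on UNIV (\<phi> k)" for k unfolding \<phi>_def by (intro continuous_intros)
    have b: "\<bar>\<phi> k v\<bar> \<le> 1" for k v by (auto simp: \<phi>_def)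
    have \<phi>[measurable]: "\<phi> k \<in> borel_measurable borel" for k using c by (rule borel_measurable_continuous_onI)
    have l: "(\<lambda>k. \<phi> k v) \<longlonglongrightarrow> indicator {..c} v" for v
    proof (cases "v \<le> c")
      case True
      then show ?thesis by (simp add: \<phi>_def)
    next
      case False
      obtain K where K: "1 / (v - c) < real K" using reals_Archimedean2 by blast
      have "\<forall>\<^sub>F k in sequentially. \<phi> k v = 0"
        unfolding eventually_sequentially
      proof (intro exI[of _ K] allI impI)
        fix k assume "K \<le> k"
        then have "1 / (v - c) < real k" using K by linarith
        then have "1 < real k * (v - c)" using False by (simp add: field_simps)
        then show "\<phi> k v = 0" using False by (simp add: \<phi>_def)
      qed
      then show ?thesis using False by (simp add: tendsto_eventually)
    qed
    have "(\<lambda>k. expectation (\<lambda>\<omega>. indicator U (X \<omega>) * \<phi> k (S \<omega>))) \<longlonglongrightarrow> expectation (\<lambda>\<omega>. indicator U (X \<omega>) * indicator {..c} (S \<omega>))"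
    proof (rule integral_dominated_convergence[where w="\<lambda>_. 1"])
      show "AE \<omega> in M. (\<lambda>k. indicator U (X \<omega>) * \<phi> k (S \<omega>)) \<longlonglongrightarrow> indicator U (X \<omega>) * indicator {..c} (S \<omega>)"
        by (intro AE_I2 tendsto_mult_left l)
      show "AE \<omega> in M. norm (indicator U (X \<omega>) * \<phi> k (S \<omega>)) \<le> 1" for k
        using b by (intro AE_I2) (auto simp: indicator_def)
    qed auto
    moreover have "(\<lambda>k. expectation (\<lambda>\<omega>. \<phi> k (S' \<omega>))) \<longlonglongrightarrow> expectation (\<lambda>\<omega>. indicator {..c} (S' \<omega>))"
      by (rule integral_dominated_convergence[where w="\<lambda>_. 1"]) (use b l in auto)
    ultimately have eq: "expectation (\<lambda>\<omega>. indicator U (X \<omega>) * indicator {..c} (S \<omega>)) =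
        prob (X -` U \<inter> space M) * expectation (\<lambda>\<omega>. indicator {..c} (S' \<omega>))"
      unfolding prod[OF U c b] by (rule LIMSEQ_unique[OF _ tendsto_mult_left])
    have "expectation (\<lambda>\<omega>. indicat_real U (X \<omega>) * indicator {..c} (S \<omega>)) = expectation (indicator {\<omega> \<in> space M. X \<omega> \<in> U \<and> S \<omega> \<le> c})"
      by (intro Bochner_Integration.integral_cong) (auto simp: indicator_def)
    moreover have "expectation (\<lambda>\<omega>. indicat_real {..c} (S' \<omega>)) = expectation (indicator {\<omega> \<in> space M. S' \<omega> \<le> c})"
      by (intro Bochner_Integration.integral_cong) (auto simp: indicator_def)
    ultimately show ?thesis using eq by (simp add: Int_absorb2 subset_eq)
  qed
  interpret X: prob_space "distr M borel X" by (rule prob_space_distr) simp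
  interpret S': prob_space "distr M borel S'" by (rule prob_space_distr) simp
  have "distr M borel X \<Otimes>\<^sub>M distr M borel S' = distr M (borel \<Otimes>\<^sub>M borel) (\<lambda>\<omega>. (X \<omega>, S \<omega>))"
  proof (rule pair_measure_eqI)
    fix U V assume "U \<in> sets (distr M borel X)" "V \<in> sets (distr M borel S')"
    then have U[measurable]: "U \<in> sets borel" and V[measurable]: "V \<in> sets borel" by auto
    \<comment> \<open>With \<open>U\<close> fixed, \<open>\<mu>1 V\<close> is the probability of
      \<open>X\<close> in \<open>U\<close> and \<open>S\<close> in \<open>V\<close>, and
      \<open>\<mu>2 V\<close> is the product of the probabilities of \<open>X\<close> in
      \<open>U\<close> and \<open>S'\<close> in \<open>V\<close>. They are finite measures rather
      than probabilities, and agreement on half-lines makes them equal.\<close>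
    define \<mu>1 where "\<mu>1 = distr (density M (\<lambda>\<omega>. indicator U (X \<omega>))) borel S"
    define \<mu>2 where "\<mu>2 = density (distr M borel S') (\<lambda>_. ennreal (prob (X -` U \<inter> space M)))"
    have m1: "emeasure \<mu>1 W = emeasure M {\<omega> \<in> space M. X \<omega> \<in> U \<and> S \<omega> \<in> W}" if [measurable]: "W \<in> sets borel" for W
    proof -
      have "emeasure \<mu>1 W = (\<integral>\<^sup>+\<omega>. indicator U (X \<omega>) * indicator (S -` W \<inter> space M) \<omega> \<partial>M)"
        unfolding \<mu>1_def by (subst emeasure_distr) (auto simp: emeasure_density)
      also have "\<dots> = (\<integral>\<^sup>+\<omega>. indicator {\<omega> \<in> space M. X \<omega> \<in> U \<and> S \<omega> \<in> W} \<omega> \<partial>M)"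
        by (intro nn_integral_cong) (auto simp: indicator_def)
      finally show ?thesis by simp
    qed
    have m2: "emeasure \<mu>2 W = prob (X -` U \<inter> space M) * emeasure M {\<omega> \<in> space M. S' \<omega> \<in> W}" if [measurable]: "W \<in> sets borel" for W
    proof -
      have "S' -` W \<inter> space M = {\<omega> \<in> space M. S' \<omega> \<in> W}" by auto
      then show ?thesis
        unfolding \<mu>2_def by (subst emeasure_density_const) (auto simp: emeasure_distr)
    qed
    have "\<mu>1 = \<mu>2"
    proof (rule cdf_unique')
      have "space \<mu>1 = UNIV" "space \<mu>2 = UNIV" "sets \<mu>1 = sets borel" "sets \<mu>2 = sets borel"
        by (simp_all add: \<mu>1_def \<mu>2_def)
      moreover have "emeasure \<mu>1 UNIV \<noteq> \<infinity>" "emeasure \<mu>2 UNIV \<noteq> \<infinity>"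
        using m1[of UNIV] m2[of UNIV] by (simp_all add: ennreal_mult_eq_top_iff emeasure_eq_measure)
      ultimately show "finite_borel_measure \<mu>1" "finite_borel_measure \<mu>2"
        by (auto simp: finite_borel_measure_def finite_borel_measure_axioms_def intro!: finite_measureI)
      show "cdf \<mu>1 = cdf \<mu>2"
      proof
        fix c
        have "emeasure \<mu>1 {..c} = emeasure \<mu>2 {..c}"
          using le[OF U, of c] m1[of "{..c}"] m2[of "{..c}"]
          by (simp add: emeasure_eq_measure ennreal_mult)
        then show "cdf \<mu>1 c = cdf \<mu>2 c" by (simp add: cdf_def measure_def)
      qed
    qed
    then have "emeasure \<mu>1 V = emeasure \<mu>2 V" by simp
    then have "emeasure M {\<omega> \<in> space M. X \<omega> \<in> U \<and> S \<omega> \<in> V} = prob (X -` U \<inter> space M) * emeasure M {\<omega> \<in> space M. S' \<omega> \<in> V}"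
      by (simp add: m1 m2)
    moreover have "(\<lambda>\<omega>. (X \<omega>, S \<omega>)) -` (U \<times> V) \<inter> space M = {\<omega> \<in> space M. X \<omega> \<in> U \<and> S \<omega> \<in> V}"
      "S' -` V \<inter> space M = {\<omega> \<in> space M. S' \<omega> \<in> V}" by auto
    ultimately show "emeasure (distr M borel X) U * emeasure (distr M borel S') V =
       emeasure (distr M (borel \<Otimes>\<^sub>M borel) (\<lambda>\<omega>. (X \<omega>, S \<omega>))) (U \<times> V)"
      by (simp add: emeasure_distr emeasure_eq_measure)
  qed (auto intro: X.sigma_finite_measure_axioms S'.sigma_finite_measure_axioms sets_pair_measure_cong)
  then show ?thesis by simp
qed

section \<open>The Markov property of the accumulation process\<close>

text \<open>Time is clamped at \<open>0\<close>, so that the paths are continuous on the whole real line.\<close>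

definition post_incr :: "(real \<Rightarrow> 'a \<Rightarrow> real) \<Rightarrow> real \<Rightarrow> real \<Rightarrow> 'a \<Rightarrow> real" where
  "post_incr B r t \<omega> = B (r + max 0 t) \<omega> - B r \<omega>"

text \<open>Riemann sum of mesh \<open>h\<close> for \<open>yor_A\<close>, as a function of the increments \<open>v\<close> over the mesh.\<close>

definition yor_riemann :: "real \<Rightarrow> real \<Rightarrow> nat \<Rightarrow> (nat \<Rightarrow> real) \<Rightarrow> real" where
  "yor_riemann \<nu> h n v = (\<Sum>j<n. h * exp (2 * ((\<Sum>i<j. v i) + \<nu> * (real j * h))))"

text \<open>The offset \<open>k\<close> allows for a leading coordinate: \<open>k = 0\<close> when
  all increments enter the sum, \<open>k = 1\<close> when coordinate 0 carries the increment up to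
  time \<open>r\<close>.\<close>

lemma measurable_yor_riemann:
  "(\<lambda>v. yor_riemann \<nu> h n (\<lambda>i. v (i + k))) \<in> borel_measurable (PiM {k..<n + k} (\<lambda>_. borel))"
  unfolding yor_riemann_def
  by (intro borel_measurable_sum borel_measurable_times borel_measurable_const borel_measurable_exp
      measurable_compose[OF _ borel_measurable_exp] borel_measurable_add measurable_component_singleton) auto

lemma yor_A_eq_integral:
  assumes "continuous_on {0..} (\<lambda>t. C t \<omega>)"
  shows "yor_A C \<nu> x \<omega> = integral {0..x} (\<lambda>w. exp (2 * (C w \<omega> + \<nu> * w)))"
proof -
  have "continuous_on {0..x} (\<lambda>w. exp (2 * (C w \<omega> + \<nu> * w)))"
    by (intro continuous_intros continuous_on_subset[OF assms]) auto
  then show ?thesis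
    unfolding yor_A_def using borel_integrable_atLeastAtMost' set_borel_integral_eq_integral(2) by blast
qed

context std_brownian_motion
begin

lemma measurable_post_incr: "0 \<le> r \<Longrightarrow> post_incr B r t \<in> borel_measurable Q"
  unfolding post_incr_def[abs_def] by (intro borel_measurable_diff random_variable_B) auto

lemma continuous_post_incr:
  assumes "0 \<le> r" "\<omega> \<in> space Q"
  shows "continuous_on S (\<lambda>t. post_incr B r t \<omega>)"
proof -
  have "continuous_on S ((\<lambda>t. B t \<omega>) \<circ> (\<lambda>t. r + max 0 t))"
    using assms by (intro continuous_on_compose continuous_intros continuous_on_subset[OF continuous_paths]) auto
  then show ?thesis by (auto simp: post_incr_def comp_def intro!: continuous_intros)
qed

lemma measurable_post_incr_pair:
  "0 \<le> r \<Longrightarrow> (\<lambda>(t, \<omega>). post_incr B r t \<omega>) \<in> borel_measurable (borel \<Otimes>\<^sub>M Q)"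
  by (intro measurable_caratheodory measurable_post_incr continuous_post_incr)

lemma measurable_yor_pair:
  assumes r: "0 \<le> r"
  shows "(\<lambda>p. yor_A (post_incr B r) \<nu> (fst p) (snd p)) \<in> borel_measurable (borel \<Otimes>\<^sub>M Q)"
proof -
  have [measurable]: "(\<lambda>q. post_incr B r (snd q) (snd (fst q))) \<in> borel_measurable ((borel \<Otimes>\<^sub>M Q) \<Otimes>\<^sub>M lborel)"
  proof -
    have "(\<lambda>q. (snd q, snd (fst q))) \<in> measurable ((borel \<Otimes>\<^sub>M Q) \<Otimes>\<^sub>M lborel) (borel \<Otimes>\<^sub>M Q)"
      by measurable
    from measurable_compose[OF this measurable_post_incr_pair[OF r]] show ?thesis by simp
  qed
  have "(\<lambda>(p, w). (if 0 \<le> w \<and> w \<le> fst p then exp (2 * (post_incr B r w (snd p) + \<nu> * w)) else 0))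
      \<in> borel_measurable ((borel \<Otimes>\<^sub>M Q) \<Otimes>\<^sub>M lborel)"
    unfolding case_prod_beta by measurable
  then have "(\<lambda>p. \<integral>w. (if 0 \<le> w \<and> w \<le> fst p then exp (2 * (post_incr B r w (snd p) + \<nu> * w)) else 0) \<partial>lborel)
      \<in> borel_measurable (borel \<Otimes>\<^sub>M Q)"
    by (rule lborel.borel_measurable_lebesgue_integral)
  moreover have "yor_A (post_incr B r) \<nu> (fst p) (snd p) = (\<integral>w. (if 0 \<le> w \<and> w \<le> fst p then exp (2 * (post_incr B r w (snd p) + \<nu> * w)) else 0) \<partial>lborel)" for p
    unfolding yor_A_def set_lebesgue_integral_def by (intro Bochner_Integration.integral_cong) (auto simp: indicator_def)
  ultimately show ?thesis by simp
qed

lemma measurable_yor: "0 \<le> r \<Longrightarrow> yor_A (post_incr B r) \<nu> x \<in> borel_measurable Q"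
  using measurable_compose[OF measurable_Pair1' measurable_yor_pair, of x] by simp

text \<open>All pathwise work is done with \<open>post_incr B 0\<close>, which starts at 0 on every
  path; this identity carries the results back to \<open>B\<close>, with one null set for all
  \<open>x\<close>.\<close>

lemma AE_yor_A: "AE \<omega> in Q. \<forall>x. yor_A B \<nu> x \<omega> = yor_A (post_incr B 0) \<nu> x \<omega>"
  using start_0
proof eventually_elim
  case (elim \<omega>)
  then show ?case
    unfolding yor_A_def post_incr_def by (intro allI set_lebesgue_integral_cong) auto
qed

lemma sum_increments:
  assumes h: "0 \<le> h"
  shows "(\<Sum>i<j. B (r + real (Suc i) * h) \<omega> - B (r + real i * h) \<omega>) = post_incr B r (real j * h) \<omega>"
  using h by (induction j) (auto simp: post_incr_def max_def algebra_simps)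

lemma yor_riemann_increments:
  assumes h: "0 \<le> h"
  shows "yor_riemann \<nu> h n (\<lambda>i. B (r + real (Suc i) * h) \<omega> - B (r + real i * h) \<omega>) =
    (\<Sum>j<n. h * exp (2 * (post_incr B r (real j * h) \<omega> + \<nu> * (real j * h))))"
  unfolding yor_riemann_def sum_increments[OF h] ..

lemma distr_increment:
  assumes "0 \<le> s" "s < t"
  shows "distr Q borel (\<lambda>\<omega>. B t \<omega> - B s \<omega>) = density lborel (normal_density 0 (sqrt (t - s)))"
proof -
  have "distr Q borel (\<lambda>\<omega>. B t \<omega> - B s \<omega>) = distr Q lborel (\<lambda>\<omega>. B t \<omega> - B s \<omega>)"
    by (intro distr_cong) auto
  then show ?thesis using normal_increments[OF assms] by (simp add: distributed_def)
qed

text \<open>The increments over the mesh are independent and Gaussian with variance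
  \<open>h\<close>. The right-hand side does not mention \<open>r\<close>, so the Riemann sums
  started at \<open>r\<close> and at 0 have the same law.\<close>

lemma distr_yor_riemann:
  assumes r: "0 \<le> r" and h: "0 < h"
  shows "distr Q borel (\<lambda>\<omega>. yor_riemann \<nu> h (Suc n) (\<lambda>i. B (r + real (Suc i) * h) \<omega> - B (r + real i * h) \<omega>)) =
    distr (PiM {..<Suc n} (\<lambda>_. density lborel (normal_density 0 (sqrt h)))) borel (yor_riemann \<nu> h (Suc n))"
proof -
  let ?X = "\<lambda>i \<omega>. B (r + real (Suc i) * h) \<omega> - B (r + real i * h) \<omega>"
  have pos: "0 \<le> r + real i * h" for i using r h by simp
  have lt: "r + real i * h < r + real (Suc i) * h" for i using h by (simp add: algebra_simps)
  have X[measurable]: "?X i \<in> borel_measurable Q" for i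
    by (intro borel_measurable_diff random_variable_B pos)
  have "indep_vars (\<lambda>_. borel) ?X {..<Suc n}"
    using indep_increments[of "\<lambda>i. r + real i * h" "Suc n"] r lt by simp
  then have "distr Q (PiM {..<Suc n} (\<lambda>_. borel)) (\<lambda>\<omega>. \<lambda>i\<in>{..<Suc n}. ?X i \<omega>) = PiM {..<Suc n} (\<lambda>i. distr Q borel (?X i))"
    by (subst (asm) indep_vars_iff_distr_eq_PiM') (use X in \<open>auto simp del: of_nat_Suc\<close>)
  also have "\<dots> = PiM {..<Suc n} (\<lambda>_. density lborel (normal_density 0 (sqrt h)))"
    by (intro PiM_cong refl, subst distr_increment[OF pos lt]) (simp add: algebra_simps)
  finally have eq: "distr Q (PiM {..<Suc n} (\<lambda>_. borel)) (\<lambda>\<omega>. \<lambda>i\<in>{..<Suc n}. ?X i \<omega>) = \<dots>" .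
  have m: "yor_riemann \<nu> h (Suc n) \<in> borel_measurable (PiM {..<Suc n} (\<lambda>_. borel))"
    using measurable_yor_riemann[of \<nu> h "Suc n" 0] by (simp add: atLeast0LessThan)
  have "distr Q borel (\<lambda>\<omega>. yor_riemann \<nu> h (Suc n) (\<lambda>i. ?X i \<omega>)) =
      distr Q borel (yor_riemann \<nu> h (Suc n) \<circ> (\<lambda>\<omega>. \<lambda>i\<in>{..<Suc n}. ?X i \<omega>))"
    by (intro distr_cong refl) (auto simp: yor_riemann_def intro!: sum.cong)
  also have "\<dots> = distr (distr Q (PiM {..<Suc n} (\<lambda>_. borel)) (\<lambda>\<omega>. \<lambda>i\<in>{..<Suc n}. ?X i \<omega>)) borel (yor_riemann \<nu> h (Suc n))"
    by (rule distr_distr[symmetric, OF m]) (intro measurable_restrict X)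
  finally show ?thesis unfolding eq .
qed

lemma indep_yor_riemann:
  assumes r: "0 < r" and h: "0 < h"
  shows "indep_var borel (post_incr B 0 r) borel
    (\<lambda>\<omega>. yor_riemann \<nu> h (Suc n) (\<lambda>i. B (r + real (Suc i) * h) \<omega> - B (r + real i * h) \<omega>))"
proof -
  \<comment> \<open>One increasing grid \<open>0, r, r + h, r + 2 * h, ...\<close>: increment 0 is
    \<open>B r - B 0\<close>, and the increments from index 1 on are those of the Riemann sum after
    \<open>r\<close>. Splitting the index set there separates the two independent blocks.\<close>
  define \<tau> where "\<tau> i = (if i = 0 then 0 else r + real (i - 1) * h)" for i :: nat
  have "indep_vars (\<lambda>_. borel) (\<lambda>i \<omega>. B (\<tau> (Suc i)) \<omega> - B (\<tau> i) \<omega>) {..<Suc (Suc n)}"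
    using r h by (intro indep_increments) (auto simp: \<tau>_def of_nat_diff algebra_simps)
  then have "indep_var (PiM {0} (\<lambda>_. borel)) (\<lambda>\<omega>. \<lambda>i\<in>{0}. B (\<tau> (Suc i)) \<omega> - B (\<tau> i) \<omega>)
     (PiM {1..<Suc n + 1} (\<lambda>_. borel)) (\<lambda>\<omega>. \<lambda>i\<in>{1..<Suc n + 1}. B (\<tau> (Suc i)) \<omega> - B (\<tau> i) \<omega>)"
    by (rule indep_var_restrict) auto
  then have "indep_var borel ((\<lambda>v. v 0) \<circ> (\<lambda>\<omega>. \<lambda>i\<in>{0}. B (\<tau> (Suc i)) \<omega> - B (\<tau> i) \<omega>))
     borel ((\<lambda>v. yor_riemann \<nu> h (Suc n) (\<lambda>i. v (i + 1))) \<circ> (\<lambda>\<omega>. \<lambda>i\<in>{1..<Suc n + 1}. B (\<tau> (Suc i)) \<omega> - B (\<tau> i) \<omega>))"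
    using measurable_yor_riemann[of \<nu> h "Suc n" 1]
    by (intro indep_var_compose) (auto intro!: measurable_component_singleton)
  moreover have "(\<lambda>v. v 0) \<circ> (\<lambda>\<omega>. \<lambda>i\<in>{0}. B (\<tau> (Suc i)) \<omega> - B (\<tau> i) \<omega>) = post_incr B 0 r"
    using r by (auto simp: fun_eq_iff \<tau>_def post_incr_def)
  moreover have "(\<lambda>v. yor_riemann \<nu> h (Suc n) (\<lambda>i. v (i + 1))) \<circ> (\<lambda>\<omega>. \<lambda>i\<in>{1..<Suc n + 1}. B (\<tau> (Suc i)) \<omega> - B (\<tau> i) \<omega>) =
     (\<lambda>\<omega>. yor_riemann \<nu> h (Suc n) (\<lambda>i. B (r + real (Suc i) * h) \<omega> - B (r + real i * h) \<omega>))"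
    by (auto simp: fun_eq_iff \<tau>_def yor_riemann_def intro!: sum.cong)
  ultimately show ?thesis by simp
qed

text \<open>Riemann sums of the path after \<open>r\<close> are independent of
  \<open>B r - B 0\<close> and distributed like the Riemann sums from time 0;
  \<open>limit_independent_law\<close> passes both facts to the accumulation itself. Positive
  \<open>r\<close> gives the Gaussian density, positive \<open>x\<close> a positive mesh.\<close>

theorem markov_yor:
  assumes r: "0 < r" and x: "0 < x"
  shows "distr Q (borel \<Otimes>\<^sub>M borel) (\<lambda>\<omega>. (post_incr B 0 r \<omega>, yor_A (post_incr B r) \<nu> x \<omega>)) =
    density lborel (normal_density 0 (sqrt r)) \<Otimes>\<^sub>M distr Q borel (yor_A (post_incr B 0) \<nu> x)"
proof -
  define h where "h n = x / real (Suc n)" for n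
  have h: "0 < h n" for n using x by (simp add: h_def)
  have lim: "(\<lambda>n. yor_riemann \<nu> (h n) (Suc n) (\<lambda>i. B (s + real (Suc i) * h n) \<omega> - B (s + real i * h n) \<omega>)) \<longlonglongrightarrow> yor_A (post_incr B s) \<nu> x \<omega>"
    if "0 \<le> s" "\<omega> \<in> space Q" for s \<omega>
    unfolding yor_riemann_increments[OF less_imp_le[OF h]] unfolding yor_A_def h_def
    using that x by (intro riemann_sums_tendsto continuous_intros continuous_post_incr) auto
  have "distr Q (borel \<Otimes>\<^sub>M borel) (\<lambda>\<omega>. (post_incr B 0 r \<omega>, yor_A (post_incr B r) \<nu> x \<omega>)) =
    distr Q borel (post_incr B 0 r) \<Otimes>\<^sub>M distr Q borel (yor_A (post_incr B 0) \<nu> x)"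
  proof (rule limit_independent_law)
    show "(\<lambda>n. yor_riemann \<nu> (h n) (Suc n) (\<lambda>i. B (r + real (Suc i) * h n) \<omega> - B (r + real i * h n) \<omega>)) \<longlonglongrightarrow> yor_A (post_incr B r) \<nu> x \<omega>"
      if "\<omega> \<in> space Q" for \<omega> using that r by (intro lim) auto
    show "(\<lambda>n. yor_riemann \<nu> (h n) (Suc n) (\<lambda>i. B (0 + real (Suc i) * h n) \<omega> - B (0 + real i * h n) \<omega>)) \<longlonglongrightarrow> yor_A (post_incr B 0) \<nu> x \<omega>"
      if "\<omega> \<in> space Q" for \<omega> using that by (intro lim) auto
    show "random_variable borel (\<lambda>\<omega>. yor_riemann \<nu> (h n) (Suc n) (\<lambda>i. B (0 + real (Suc i) * h n) \<omega> - B (0 + real i * h n) \<omega>))" for n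
      unfolding yor_riemann_increments[OF less_imp_le[OF h]]
      by (intro borel_measurable_sum borel_measurable_times borel_measurable_const borel_measurable_add
          measurable_compose[OF _ borel_measurable_exp] measurable_post_incr) auto
    show "indep_var borel (post_incr B 0 r) borel
        (\<lambda>\<omega>. yor_riemann \<nu> (h n) (Suc n) (\<lambda>i. B (r + real (Suc i) * h n) \<omega> - B (r + real i * h n) \<omega>))" for n
      by (intro indep_yor_riemann r h)
    show "distr Q borel (\<lambda>\<omega>. yor_riemann \<nu> (h n) (Suc n) (\<lambda>i. B (r + real (Suc i) * h n) \<omega> - B (r + real i * h n) \<omega>)) =
        distr Q borel (\<lambda>\<omega>. yor_riemann \<nu> (h n) (Suc n) (\<lambda>i. B (0 + real (Suc i) * h n) \<omega> - B (0 + real i * h n) \<omega>))" for n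
      unfolding distr_yor_riemann[OF less_imp_le[OF r] h] distr_yor_riemann[OF order_refl h] ..
  qed (use r in \<open>auto intro!: measurable_post_incr measurable_yor\<close>)
  moreover have "post_incr B 0 r = (\<lambda>\<omega>. B r \<omega> - B 0 \<omega>)" using r by (auto simp: post_incr_def)
  ultimately show ?thesis using distr_increment[of 0 r] r by simp
qed

section \<open>Pathwise calculus of the accumulation process\<close>

lemma yor_A_add:
  assumes r: "0 \<le> r" and x: "0 \<le> x" and \<omega>: "\<omega> \<in> space Q"
  shows "yor_A (post_incr B 0) \<nu> (r + x) \<omega> =
    yor_A (post_incr B 0) \<nu> r \<omega> + exp (2 * (post_incr B 0 r \<omega> + \<nu> * r)) * yor_A (post_incr B r) \<nu> x \<omega>"
proof -
  let ?f = "\<lambda>w. exp (2 * (post_incr B 0 w \<omega> + \<nu> * w))"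
  have c: "continuous_on S ?f" for S by (intro continuous_intros continuous_post_incr \<omega>) auto
  have eq: "yor_A (post_incr B s) \<nu> y \<omega> = integral {0..y} (\<lambda>w. exp (2 * (post_incr B s w \<omega> + \<nu> * w)))" if "0 \<le> s" for s y
    using that \<omega> by (intro yor_A_eq_integral continuous_post_incr)
  have "integral {0..r + x} ?f = integral {0..r} ?f + integral {r..r + x} ?f"
    using r x by (intro Henstock_Kurzweil_Integration.integral_combine[symmetric] integrable_continuous_real c) auto
  also have "integral {r..r + x} ?f = integral {0..x} (?f \<circ> (\<lambda>w. w + r))"
    using integral_shift[of 0 r x ?f] c by (simp add: add.commute)
  also have "\<dots> = integral {0..x} (\<lambda>w. exp (2 * (post_incr B 0 r \<omega> + \<nu> * r)) * exp (2 * (post_incr B r w \<omega> + \<nu> * w)))"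
    using r by (intro Henstock_Kurzweil_Integration.integral_cong) (auto simp: post_incr_def exp_add[symmetric] algebra_simps)
  also have "\<dots> = exp (2 * (post_incr B 0 r \<omega> + \<nu> * r)) * integral {0..x} (\<lambda>w. exp (2 * (post_incr B r w \<omega> + \<nu> * w)))"
    by (rule Henstock_Kurzweil_Integration.integral_mult_right)
  finally show ?thesis using r by (simp add: eq)
qed

lemma yor_A_pos:
  assumes r: "0 \<le> r" and x: "0 < x" and \<omega>: "\<omega> \<in> space Q"
  shows "0 < yor_A (post_incr B r) \<nu> x \<omega>"
proof -
  let ?f = "\<lambda>w. exp (2 * (post_incr B r w \<omega> + \<nu> * w))"
  have c: "continuous_on {0..x} ?f" by (intro continuous_intros continuous_post_incr \<omega> r)
  obtain w0 where w0: "w0 \<in> {0..x}" and le: "\<And>w. w \<in> {0..x} \<Longrightarrow> ?f w0 \<le> ?f w"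
    using continuous_attains_inf[OF _ _ c] x by (metis atLeastatMost_empty_iff2 compact_Icc less_imp_le not_le)
  have "0 < ?f w0 * x" using x by simp
  also have "\<dots> \<le> integral {0..x} ?f"
  proof (rule has_integral_le)
    show "((\<lambda>_. ?f w0) has_integral ?f w0 * x) {0..x}"
      using has_integral_const_real[of "?f w0" 0 x] x by (simp add: mult.commute)
    show "(?f has_integral integral {0..x} ?f) {0..x}"
      using c by (intro integrable_integral integrable_continuous_real)
  qed (rule le)
  also have "\<dots> = yor_A (post_incr B r) \<nu> x \<omega>"
    by (intro yor_A_eq_integral[symmetric] continuous_post_incr \<omega> r)
  finally show ?thesis .
qed

lemma yor_A_0: "\<omega> \<in> space Q \<Longrightarrow> 0 \<le> r \<Longrightarrow> yor_A (post_incr B r) \<nu> 0 \<omega> = 0"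
  by (subst yor_A_eq_integral) (auto intro: continuous_post_incr)

lemma yor_A_nonneg: "\<omega> \<in> space Q \<Longrightarrow> 0 \<le> r \<Longrightarrow> 0 \<le> yor_A (post_incr B r) \<nu> x \<omega>"
  using yor_A_pos[of r x] yor_A_0[of \<omega> r]
  by (cases "x > 0"; cases "x = 0") (auto simp: yor_A_def set_lebesgue_integral_def less_imp_le)

lemma yor_A_strict_mono:
  assumes "0 \<le> r" "r < s" and \<omega>: "\<omega> \<in> space Q"
  shows "yor_A (post_incr B 0) \<nu> r \<omega> < yor_A (post_incr B 0) \<nu> s \<omega>"
  using yor_A_add[of r "s - r" \<omega> \<nu>] yor_A_pos[of r "s - r" \<omega> \<nu>] assms by simp

lemma yor_A_derivative:
  assumes \<omega>: "\<omega> \<in> space Q" and x: "x \<in> {0..b}"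
  shows "((\<lambda>x. yor_A (post_incr B 0) \<nu> x \<omega>) has_vector_derivative exp (2 * (post_incr B 0 x \<omega> + \<nu> * x))) (at x within {0..b})"
proof -
  have "yor_A (post_incr B 0) \<nu> x \<omega> = integral {0..x} (\<lambda>w. exp (2 * (post_incr B 0 w \<omega> + \<nu> * w)))" for x
    by (intro yor_A_eq_integral continuous_post_incr \<omega>) auto
  moreover have "continuous_on {0..b} (\<lambda>w. exp (2 * (post_incr B 0 w \<omega> + \<nu> * w)))"
    by (intro continuous_intros continuous_post_incr \<omega>) auto
  ultimately show ?thesis using integral_has_vector_derivative[OF _ x] by simp
qed

text \<open>Fundamental theorem of calculus for \<open>r \<mapsto> (A X - A r - a)\<^sup>+\<close>, which decreases to \<open>0\<close>.\<close>

lemma yor_payoff_path: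
  assumes X: "0 < X" and a: "0 < a" and \<omega>: "\<omega> \<in> space Q"
  shows "ennreal (max 0 (yor_A (post_incr B 0) \<nu> X \<omega> - a)) =
    (\<integral>\<^sup>+r. ennreal (exp (2 * (post_incr B 0 r \<omega> + \<nu> * r))) *
       (indicator {0<..<X} r * indicator {a<..} (yor_A (post_incr B 0) \<nu> X \<omega> - yor_A (post_incr B 0) \<nu> r \<omega>)) \<partial>lborel)"
proof -
  define F where "F x = yor_A (post_incr B 0) \<nu> x \<omega>" for x
  define f where "f r = exp (2 * (post_incr B 0 r \<omega> + \<nu> * r))" for r
  have F0: "F 0 = 0" using \<omega> by (simp add: F_def yor_A_0)
  have Fnn: "0 \<le> F x" for x using \<omega> by (simp add: F_def yor_A_nonneg)
  have mono: "F r < F s" if "0 \<le> r" "r < s" for r s using that \<omega> by (simp add: F_def yor_A_strict_mono)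
  have der: "(F has_vector_derivative f x) (at x within {0..b})" if "x \<in> {0..b}" for x b
    using yor_A_derivative[OF \<omega> that] by (simp add: F_def[abs_def] f_def)
  show ?thesis
  proof (cases "F X \<le> a")
    case True
    then have 0: "ennreal (f r) * (indicator {0<..<X} r * indicator {a<..} (F X - F r)) = 0" for r
      using Fnn[of r] by (auto simp: indicator_def)
    show ?thesis
      unfolding F_def[symmetric] f_def[symmetric] 0 using True by simp
  next
    case False
    have "continuous_on {0..X} F"
      unfolding continuous_on_eq_continuous_within using has_vector_derivative_continuous[OF der] by blast
    \<comment> \<open>\<open>\<rho>\<close> is the time at which exactly \<open>a\<close> remains to
      be accumulated. The indicator is 1 before \<open>\<rho>\<close> and 0 after it, so the
      integral is \<open>F \<rho> = F X - a\<close>; the endpoints 0 and \<open>\<rho>\<close> form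
      a null set.\<close>
    then obtain \<rho> where \<rho>: "0 \<le> \<rho>" "\<rho> \<le> X" "F \<rho> = F X - a"
      using IVT'[of F 0 "F X - a" X] False a F0 X by auto
    have "\<rho> < X" using \<rho> a by (cases "\<rho> = X") auto
    have iff: "r < \<rho> \<longleftrightarrow> a < F X - F r" if "0 \<le> r" for r
      using mono[of r \<rho>] mono[of \<rho> r] that \<rho> by (cases r \<rho> rule: linorder_cases) auto
    have "(\<integral>\<^sup>+r. ennreal (f r) * (indicator {0<..<X} r * indicator {a<..} (F X - F r)) \<partial>lborel) =
        (\<integral>\<^sup>+r. ennreal (f r) * indicator {0..\<rho>} r \<partial>lborel)"
    proof (rule nn_integral_cong_AE)
      have "AE r in lborel. r \<noteq> 0 \<and> r \<noteq> \<rho>"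
        by (intro AE_conjI AE_lborel_singleton)
      then show "AE r in lborel. ennreal (f r) * (indicator {0<..<X} r * indicator {a<..} (F X - F r)) = ennreal (f r) * indicator {0..\<rho>} r"
      proof eventually_elim
        case (elim r)
        show ?case
        proof (cases "0 < r \<and> r < X")
          case True
          then have "indicator {a<..} (F X - F r) = (indicator {0..\<rho>} r :: ennreal)"
            using iff[of r] elim by (auto simp: indicator_def)
          with True show ?thesis by simp
        next
          case False
          then have "indicator {0<..<X} r = (0 :: ennreal)" "indicator {0..\<rho>} r = (0 :: ennreal)"
            using elim \<open>\<rho> < X\<close> by (auto simp: indicator_def)
          then show ?thesis by simp
        qed
      qed
    qed
    also have "\<dots> = (\<integral>\<^sup>+r. ennreal (indicator {0..\<rho>} r *\<^sub>R f r) \<partial>lborel)"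
      by (intro nn_integral_cong) (auto simp: indicator_def)
    also have "\<dots> = ennreal (\<integral>r. indicator {0..\<rho>} r *\<^sub>R f r \<partial>lborel)"
    proof (rule nn_integral_eq_integral)
      have "continuous_on {0..\<rho>} f"
        unfolding f_def[abs_def] by (intro continuous_intros continuous_post_incr \<omega>) auto
      then show "integrable lborel (\<lambda>r. indicator {0..\<rho>} r *\<^sub>R f r)"
        using borel_integrable_atLeastAtMost' unfolding set_integrable_def by blast
    qed (simp add: f_def)
    also have "\<dots> = ennreal (F \<rho>)"
      unfolding F_def f_def yor_A_def set_lebesgue_integral_def ..
    finally show ?thesis
      using \<rho> F0 False unfolding F_def[symmetric] f_def[symmetric] by simp
  qed
qed

text \<open>Measurability has to be joint in time and threshold, because both are integrated and the
  integrals are exchanged later.\<close>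

lemma measurable_yor_tail:
  "(\<lambda>p. emeasure Q {\<omega> \<in> space Q. snd p < yor_A (post_incr B 0) \<nu> (fst p) \<omega>}) \<in> borel_measurable (borel \<Otimes>\<^sub>M borel)"
proof -
  have [measurable]: "(\<lambda>q. yor_A (post_incr B 0) \<nu> (fst (fst q)) (snd q)) \<in> borel_measurable ((borel \<Otimes>\<^sub>M borel) \<Otimes>\<^sub>M Q)"
  proof -
    have "(\<lambda>q. (fst (fst q), snd q)) \<in> measurable ((borel \<Otimes>\<^sub>M borel) \<Otimes>\<^sub>M Q) (borel \<Otimes>\<^sub>M Q)" by measurable
    from measurable_compose[OF this measurable_yor_pair[OF order_refl]] show ?thesis by simp
  qed
  have "(\<lambda>(p :: real \<times> real, \<omega>). indicator {p. snd (fst p) < yor_A (post_incr B 0) \<nu> (fst (fst p)) (snd p)} (p, \<omega>) :: ennreal) \<in> borel_measurable ((borel \<Otimes>\<^sub>M borel) \<Otimes>\<^sub>M Q)"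
    unfolding case_prod_beta by measurable
  then have "(\<lambda>p. \<integral>\<^sup>+\<omega>. indicator {p. snd (fst p) < yor_A (post_incr B 0) \<nu> (fst (fst p)) (snd p)} (p, \<omega>) \<partial>Q) \<in> borel_measurable (borel \<Otimes>\<^sub>M borel)"
    by (rule borel_measurable_nn_integral)
  moreover have "(\<integral>\<^sup>+\<omega>. indicator {p. snd (fst p) < yor_A (post_incr B 0) \<nu> (fst (fst p)) (snd p)} (p, \<omega>) \<partial>Q) =
      emeasure Q {\<omega> \<in> space Q. snd p < yor_A (post_incr B 0) \<nu> (fst p) \<omega>}" for p :: "real \<times> real"
  proof -
    have [measurable]: "yor_A (post_incr B 0) \<nu> (fst p) \<in> borel_measurable Q" by (rule measurable_yor) simp
    have "(\<integral>\<^sup>+\<omega>. indicator {p. snd (fst p) < yor_A (post_incr B 0) \<nu> (fst (fst p)) (snd p)} (p, \<omega>) \<partial>Q) =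
        (\<integral>\<^sup>+\<omega>. indicator {\<omega> \<in> space Q. snd p < yor_A (post_incr B 0) \<nu> (fst p) \<omega>} \<omega> \<partial>Q)"
      by (intro nn_integral_cong) (auto simp: indicator_def)
    then show ?thesis by simp
  qed
  ultimately show ?thesis by simp
qed

text \<open>By \<open>yor_A_add\<close> the increment is \<open>exp (2 * y)\<close> times the
  accumulation of the restarted path, where \<open>y = post_incr B 0 r + \<nu> * r\<close>.
  Exceeding \<open>a\<close> thus means that the restarted accumulation exceeds
  \<open>a * exp (- 2 * y)\<close>; the last substitution makes \<open>y\<close> the integration
  variable and shifts the Gaussian density by \<open>\<nu> * r\<close>.\<close>

lemma markov_yor_tail:
  assumes r: "0 < r" and x: "0 < x"
  shows "(\<integral>\<^sup>+\<omega>. ennreal (exp (2 * (post_incr B 0 r \<omega> + \<nu> * r))) *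
       indicator {a<..} (yor_A (post_incr B 0) \<nu> (r + x) \<omega> - yor_A (post_incr B 0) \<nu> r \<omega>) \<partial>Q) =
    (\<integral>\<^sup>+y. ennreal (normal_density 0 (sqrt r) (y - \<nu> * r)) * (ennreal (exp (2 * y)) *
       emeasure Q {\<omega> \<in> space Q. a * exp (- 2 * y) < yor_A (post_incr B 0) \<nu> x \<omega>}) \<partial>lborel)"
proof -
  let ?A = "yor_A (post_incr B 0) \<nu> x"
  have A[measurable]: "?A \<in> borel_measurable Q" by (rule measurable_yor) simp
  have W[measurable]: "post_incr B 0 r \<in> borel_measurable Q" by (rule measurable_post_incr) simp
  have Ar[measurable]: "yor_A (post_incr B r) \<nu> x \<in> borel_measurable Q" using r by (intro measurable_yor) simp
  interpret D: prob_space "distr Q borel ?A" by (rule prob_space_distr) simp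
  have tail[measurable]: "(\<lambda>q. emeasure Q {\<omega> \<in> space Q. q < ?A \<omega>}) \<in> borel_measurable borel"
    using measurable_compose[OF measurable_Pair1' measurable_yor_tail[of \<nu>], of x] by simp
  define \<Phi> where "\<Phi> p = ennreal (exp (2 * (fst p + \<nu> * r))) * indicator {a<..} (exp (2 * (fst p + \<nu> * r)) * snd p)" for p
  have \<Phi>[measurable]: "\<Phi> \<in> borel_measurable (borel \<Otimes>\<^sub>M borel)" unfolding \<Phi>_def[abs_def] by measurable
  have "(\<integral>\<^sup>+\<omega>. ennreal (exp (2 * (post_incr B 0 r \<omega> + \<nu> * r))) *
       indicator {a<..} (yor_A (post_incr B 0) \<nu> (r + x) \<omega> - yor_A (post_incr B 0) \<nu> r \<omega>) \<partial>Q) =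
       (\<integral>\<^sup>+\<omega>. \<Phi> (post_incr B 0 r \<omega>, yor_A (post_incr B r) \<nu> x \<omega>) \<partial>Q)"
    using r x by (intro nn_integral_cong) (simp add: \<Phi>_def yor_A_add)
  also have "\<dots> = (\<integral>\<^sup>+p. \<Phi> p \<partial>distr Q (borel \<Otimes>\<^sub>M borel) (\<lambda>\<omega>. (post_incr B 0 r \<omega>, yor_A (post_incr B r) \<nu> x \<omega>)))"
    by (subst nn_integral_distr) auto
  also have "\<dots> = (\<integral>\<^sup>+y. (\<integral>\<^sup>+v. \<Phi> (y, v) \<partial>distr Q borel ?A) \<partial>density lborel (normal_density 0 (sqrt r)))"
    unfolding markov_yor[OF r x] by (subst D.nn_integral_fst[symmetric]) (auto cong: measurable_cong_sets)
  also have "\<dots> = (\<integral>\<^sup>+y. ennreal (exp (2 * (y + \<nu> * r))) * emeasure Q {\<omega> \<in> space Q. a * exp (- 2 * (y + \<nu> * r)) < ?A \<omega>} \<partial>density lborel (normal_density 0 (sqrt r)))"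
  proof (intro nn_integral_cong)
    have "(\<integral>\<^sup>+v. ennreal (exp (2 * s)) * indicator {a<..} (exp (2 * s) * v) \<partial>distr Q borel ?A) =
        ennreal (exp (2 * s)) * emeasure Q {\<omega> \<in> space Q. a * exp (- 2 * s) < ?A \<omega>}" for s
    proof -
      have iff: "a * exp (- 2 * s) < v \<longleftrightarrow> a < exp (2 * s) * v" for v
        by (simp add: exp_minus field_simps)
      have "(\<integral>\<^sup>+v. ennreal (exp (2 * s)) * indicator {a<..} (exp (2 * s) * v) \<partial>distr Q borel ?A) =
          (\<integral>\<^sup>+\<omega>. ennreal (exp (2 * s)) * indicator {\<omega> \<in> space Q. a < exp (2 * s) * ?A \<omega>} \<omega> \<partial>Q)"
        by (subst nn_integral_distr) (auto simp: indicator_def intro!: nn_integral_cong)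
      then show ?thesis unfolding iff by (simp add: nn_integral_cmult_indicator)
    qed
    then show "(\<integral>\<^sup>+v. \<Phi> (y, v) \<partial>distr Q borel ?A) = ennreal (exp (2 * (y + \<nu> * r))) * emeasure Q {\<omega> \<in> space Q. a * exp (- 2 * (y + \<nu> * r)) < ?A \<omega>}" for y
      by (simp only: \<Phi>_def fst_conv snd_conv)
  qed
  also have "\<dots> = (\<integral>\<^sup>+y. ennreal (normal_density 0 (sqrt r) y) * (ennreal (exp (2 * (y + \<nu> * r))) * emeasure Q {\<omega> \<in> space Q. a * exp (- 2 * (y + \<nu> * r)) < ?A \<omega>}) \<partial>lborel)"
    by (subst nn_integral_density) auto
  also have "\<dots> = (\<integral>\<^sup>+y. ennreal (normal_density 0 (sqrt r) (y - \<nu> * r)) * (ennreal (exp (2 * y)) *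
       emeasure Q {\<omega> \<in> space Q. a * exp (- 2 * y) < ?A \<omega>}) \<partial>lborel)"
    by (subst (2) nn_integral_real_affine[where c=1 and t="\<nu> * r"]) (auto simp: add.commute)
  finally show ?thesis .
qed

end

section \<open>Laplace transform of the call price\<close>

context std_brownian_motion
begin

text \<open>This quantity and its transforms take values in \<open>ennreal\<close>, so that
  integrals can be exchanged before any finiteness is known. Finiteness comes later, from the
  explicit value at strike 0.\<close>

definition yor_tail :: "real \<Rightarrow> real \<times> real \<Rightarrow> ennreal" where
  "yor_tail \<nu> p = emeasure Q {\<omega> \<in> space Q. snd p < yor_A (post_incr B 0) \<nu> (fst p) \<omega>}"

definition yor_call_mean :: "real \<Rightarrow> real \<Rightarrow> real \<Rightarrow> ennreal" where
  "yor_call_mean \<nu> a x = (\<integral>\<^sup>+\<omega>. ennreal (max 0 (yor_A (post_incr B 0) \<nu> x \<omega> - a)) \<partial>Q)"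

definition yor_tail_laplace :: "real \<Rightarrow> real \<Rightarrow> real \<Rightarrow> ennreal" where
  "yor_tail_laplace \<nu> z q = (\<integral>\<^sup>+x. indicator {0<..} x * ennreal (exp (- z * x)) * yor_tail \<nu> (x, q) \<partial>lborel)"

definition yor_call_laplace :: "real \<Rightarrow> real \<Rightarrow> real \<Rightarrow> ennreal" where
  "yor_call_laplace \<nu> z a = (\<integral>\<^sup>+x. indicator {0<..} x * ennreal (exp (- z * x)) * yor_call_mean \<nu> a x \<partial>lborel)"

lemma measurable_tail[measurable]: "yor_tail \<nu> \<in> borel_measurable (borel \<Otimes>\<^sub>M borel)"
  using measurable_yor_tail[of \<nu>] unfolding yor_tail_def[abs_def] .

lemma measurable_swap: "(\<lambda>p. (snd p, fst p)) \<in> measurable (Q \<Otimes>\<^sub>M lborel) (borel \<Otimes>\<^sub>M Q)"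
  by measurable

lemma measurable_post_incr_swap[measurable]:
  "(\<lambda>p. post_incr B 0 (snd p) (fst p)) \<in> borel_measurable (Q \<Otimes>\<^sub>M lborel)"
  using measurable_compose[OF measurable_swap measurable_post_incr_pair[of 0]] by simp

text \<open>The mean of \<open>yor_payoff_path\<close> combined with the Markov property. The two
  indicators display the right-hand side as a convolution in time, with \<open>r\<close> the elapsed
  and \<open>X - r\<close> the remaining time.\<close>

lemma yor_call_time_domain:
  assumes X: "0 < X" and a: "0 < a"
  shows "yor_call_mean \<nu> a X = (\<integral>\<^sup>+r. indicator {0<..} r * indicator {0<..} (X - r) *
    (\<integral>\<^sup>+y. ennreal (normal_density 0 (sqrt r) (y - \<nu> * r)) * (ennreal (exp (2 * y)) * yor_tail \<nu> (X - r, a * exp (- 2 * y))) \<partial>lborel) \<partial>lborel)"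
proof -
  interpret P: pair_sigma_finite Q lborel ..
  have [measurable]: "(\<lambda>p. yor_A (post_incr B 0) \<nu> (snd p) (fst p)) \<in> borel_measurable (Q \<Otimes>\<^sub>M lborel)"
    using measurable_compose[OF measurable_swap measurable_yor_pair[of 0]] by simp
  have [measurable]: "(\<lambda>p. yor_A (post_incr B 0) \<nu> X (fst p)) \<in> borel_measurable (Q \<Otimes>\<^sub>M lborel)"
    using measurable_compose[OF measurable_fst measurable_yor[of 0 \<nu> X]] by simp
  let ?g = "\<lambda>\<omega> r. ennreal (exp (2 * (post_incr B 0 r \<omega> + \<nu> * r))) *
       (indicator {0<..<X} r * indicator {a<..} (yor_A (post_incr B 0) \<nu> X \<omega> - yor_A (post_incr B 0) \<nu> r \<omega>))"
  have "yor_call_mean \<nu> a X = (\<integral>\<^sup>+\<omega>. (\<integral>\<^sup>+r. ?g \<omega> r \<partial>lborel) \<partial>Q)"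
    unfolding yor_call_mean_def using X a by (intro nn_integral_cong yor_payoff_path)
  also have "\<dots> = (\<integral>\<^sup>+r. (\<integral>\<^sup>+\<omega>. ?g \<omega> r \<partial>Q) \<partial>lborel)"
    by (rule P.Fubini'[symmetric]) (unfold case_prod_beta, measurable)
  also have "\<dots> = (\<integral>\<^sup>+r. indicator {0<..} r * indicator {0<..} (X - r) *
    (\<integral>\<^sup>+y. ennreal (normal_density 0 (sqrt r) (y - \<nu> * r)) * (ennreal (exp (2 * y)) * yor_tail \<nu> (X - r, a * exp (- 2 * y))) \<partial>lborel) \<partial>lborel)"
  proof (intro nn_integral_cong)
    fix r :: real
    show "(\<integral>\<^sup>+\<omega>. ?g \<omega> r \<partial>Q) = indicator {0<..} r * indicator {0<..} (X - r) *
      (\<integral>\<^sup>+y. ennreal (normal_density 0 (sqrt r) (y - \<nu> * r)) * (ennreal (exp (2 * y)) * yor_tail \<nu> (X - r, a * exp (- 2 * y))) \<partial>lborel)"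
    proof (cases "0 < r \<and> r < X")
      case True
      then show ?thesis using markov_yor_tail[of r "X - r" \<nu> a] by (simp add: yor_tail_def)
    next
      case False
      then show ?thesis by (auto simp: indicator_def)
    qed
  qed
  finally show ?thesis .
qed

text \<open>The convolution theorem: with \<open>X = r + x\<close> the Laplace factor splits into
  one for \<open>r\<close> and one for \<open>x\<close>. The first meets only the Gaussian kernel
  and the second only the tail, so for each \<open>y\<close> the two time integrals
  decouple.\<close>

theorem yor_call_laplace_eq:
  assumes a: "0 < a"
  shows "yor_call_laplace \<nu> z a = (\<integral>\<^sup>+y.
    (\<integral>\<^sup>+r. indicator {0<..} r * (ennreal (exp (- z * r)) * ennreal (normal_density 0 (sqrt r) (y - \<nu> * r))) \<partial>lborel) *
    (ennreal (exp (2 * y)) * yor_tail_laplace \<nu> z (a * exp (- 2 * y))) \<partial>lborel)"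
proof -
  have [measurable]: "(\<lambda>p. normal_density 0 (sqrt (fst p)) (snd p - \<nu> * fst p)) \<in> borel_measurable (borel \<Otimes>\<^sub>M borel)"
    unfolding normal_density_def by measurable
  define N where "N p = ennreal (normal_density 0 (sqrt (fst p)) (snd p - \<nu> * fst p))" for p
  have N[measurable]: "N \<in> borel_measurable (borel \<Otimes>\<^sub>M borel)" unfolding N_def[abs_def] by measurable
  define M where "M p = (\<integral>\<^sup>+y. N (fst p, y) * (ennreal (exp (2 * y)) * yor_tail \<nu> (snd p, a * exp (- 2 * y))) \<partial>lborel)" for p
  have M[measurable]: "M \<in> borel_measurable (borel \<Otimes>\<^sub>M borel)" unfolding M_def[abs_def] by measurable
  define e where "e x = ennreal (exp (- z * x))" for x
  have e[measurable]: "e \<in> borel_measurable borel" unfolding e_def[abs_def] by measurable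
  have e_add: "e (r + x) = e r * e x" for r x by (simp add: e_def ennreal_mult[symmetric] exp_add[symmetric] algebra_simps)
  let ?I = "\<lambda>x. indicator {0<..} x :: ennreal"
  have "yor_call_laplace \<nu> z a = (\<integral>\<^sup>+X. (\<integral>\<^sup>+r. ?I r * ?I (X - r) * e X * M (r, X - r) \<partial>lborel) \<partial>lborel)"
    unfolding yor_call_laplace_def
  proof (intro nn_integral_cong)
    fix X :: real
    show "?I X * ennreal (exp (- z * X)) * yor_call_mean \<nu> a X = (\<integral>\<^sup>+r. ?I r * ?I (X - r) * e X * M (r, X - r) \<partial>lborel)"
    proof (cases "0 < X")
      case True
      have "yor_call_mean \<nu> a X = (\<integral>\<^sup>+r. ?I r * ?I (X - r) * M (r, X - r) \<partial>lborel)"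
        by (simp add: yor_call_time_domain[OF True a] M_def N_def)
      then have "e X * yor_call_mean \<nu> a X = (\<integral>\<^sup>+r. e X * (?I r * ?I (X - r) * M (r, X - r)) \<partial>lborel)"
        by (simp add: nn_integral_cmult)
      then show ?thesis using True by (simp add: e_def mult_ac)
    next
      case False
      then have 0: "?I r * ?I (X - r) * e X * M (r, X - r) = 0" for r by (auto simp: indicator_def)
      show ?thesis unfolding 0 using False by simp
    qed
  qed
  also have "\<dots> = (\<integral>\<^sup>+r. (\<integral>\<^sup>+X. ?I r * ?I (X - r) * e X * M (r, X - r) \<partial>lborel) \<partial>lborel)"
    by (rule lborel_pair.Fubini'[symmetric]) (unfold case_prod_beta, measurable)
  also have "\<dots> = (\<integral>\<^sup>+r. (\<integral>\<^sup>+x. ?I r * ?I x * e (r + x) * M (r, x) \<partial>lborel) \<partial>lborel)"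
  proof (rule nn_integral_cong)
    fix r
    show "(\<integral>\<^sup>+X. ?I r * ?I (X - r) * e X * M (r, X - r) \<partial>lborel) = (\<integral>\<^sup>+x. ?I r * ?I x * e (r + x) * M (r, x) \<partial>lborel)"
      by (subst nn_integral_real_affine[where c=1 and t=r]) auto
  qed
  also have "\<dots> = (\<integral>\<^sup>+r. (\<integral>\<^sup>+x. (\<integral>\<^sup>+y. (?I r * (e r * N (r, y))) * (ennreal (exp (2 * y)) * (?I x * e x * yor_tail \<nu> (x, a * exp (- 2 * y)))) \<partial>lborel) \<partial>lborel) \<partial>lborel)"
  proof (intro nn_integral_cong)
    fix r x
    have "?I r * ?I x * e (r + x) * M (r, x) = (?I r * e r * ?I x * e x) * (\<integral>\<^sup>+y. N (r, y) * (ennreal (exp (2 * y)) * yor_tail \<nu> (x, a * exp (- 2 * y))) \<partial>lborel)"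
      by (simp add: M_def e_add mult_ac)
    also have "\<dots> = (\<integral>\<^sup>+y. (?I r * e r * ?I x * e x) * (N (r, y) * (ennreal (exp (2 * y)) * yor_tail \<nu> (x, a * exp (- 2 * y)))) \<partial>lborel)"
      by (rule nn_integral_cmult[symmetric]) measurable
    finally show "?I r * ?I x * e (r + x) * M (r, x) = (\<integral>\<^sup>+y. (?I r * (e r * N (r, y))) * (ennreal (exp (2 * y)) * (?I x * e x * yor_tail \<nu> (x, a * exp (- 2 * y)))) \<partial>lborel)"
      by (simp add: mult_ac)
  qed
  also have "\<dots> = (\<integral>\<^sup>+r. (\<integral>\<^sup>+y. (\<integral>\<^sup>+x. (?I r * (e r * N (r, y))) * (ennreal (exp (2 * y)) * (?I x * e x * yor_tail \<nu> (x, a * exp (- 2 * y)))) \<partial>lborel) \<partial>lborel) \<partial>lborel)"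
    by (intro nn_integral_cong lborel_pair.Fubini') (unfold case_prod_beta, measurable)
  also have "\<dots> = (\<integral>\<^sup>+r. (\<integral>\<^sup>+y. (?I r * (e r * N (r, y))) * (ennreal (exp (2 * y)) * yor_tail_laplace \<nu> z (a * exp (- 2 * y))) \<partial>lborel) \<partial>lborel)"
    unfolding yor_tail_laplace_def e_def[symmetric] by (intro nn_integral_cong) (simp add: nn_integral_cmult)
  also have "\<dots> = (\<integral>\<^sup>+y. (\<integral>\<^sup>+r. (?I r * (e r * N (r, y))) * (ennreal (exp (2 * y)) * yor_tail_laplace \<nu> z (a * exp (- 2 * y))) \<partial>lborel) \<partial>lborel)"
    unfolding yor_tail_laplace_def by (rule lborel_pair.Fubini') (unfold case_prod_beta, measurable)
  also have "\<dots> = (\<integral>\<^sup>+y. (\<integral>\<^sup>+r. ?I r * (e r * N (r, y)) \<partial>lborel) * (ennreal (exp (2 * y)) * yor_tail_laplace \<nu> z (a * exp (- 2 * y))) \<partial>lborel)"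
    by (intro nn_integral_cong nn_integral_multc) measurable
  finally show ?thesis by (simp add: N_def e_def)
qed

end

lemma nn_integral_exp_atLeast:
  assumes "0 < (z :: real)"
  shows "(\<integral>\<^sup>+x. ennreal (exp (- z * x)) * indicator {w..} x \<partial>lborel) = ennreal (exp (- z * w) / z)"
proof -
  have "((\<lambda>x. - exp (- z * x) / z) \<longlongrightarrow> 0) at_top" using assms by real_asymp
  then have "(\<integral>\<^sup>+x. ennreal (exp (- z * x)) * indicator {w..} x \<partial>lborel) = ennreal (0 - (- exp (- z * w) / z))"
    using assms by (intro nn_integral_FTC_atLeast) (auto intro!: derivative_eq_intros)
  then show ?thesis by simp
qed

context std_brownian_motion
begin

text \<open>Completing the square: tilting the centred Gaussian of variance \<open>w\<close> by
  \<open>exp (2 * y)\<close> gives \<open>exp (2 * w)\<close> times the Gaussian with mean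
  \<open>2 * w\<close>, which explains the \<open>+ 1\<close> next to \<open>\<nu>\<close>.\<close>

lemma nn_integral_exp_increment:
  assumes w: "0 \<le> w"
  shows "(\<integral>\<^sup>+\<omega>. ennreal (exp (2 * (post_incr B 0 w \<omega> + \<nu> * w))) \<partial>Q) = ennreal (exp (2 * (\<nu> + 1) * w))"
proof (cases "w = 0")
  case True
  then show ?thesis by (simp add: post_incr_def emeasure_space_1)
next
  case False
  then have w: "0 < w" using assms by simp
  have eq: "normal_density 0 (sqrt w) y * exp (2 * (y + \<nu> * w)) = exp (2 * (\<nu> + 1) * w) * normal_density (2 * w) (sqrt w) y" for y
  proof -
    have "- (y\<^sup>2) / (2 * w) + 2 * (y + \<nu> * w) = 2 * (\<nu> + 1) * w + - ((y - 2 * w)\<^sup>2) / (2 * w)"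
      using w by (simp add: field_simps power2_eq_square)
    then have "exp (- (y\<^sup>2) / (2 * w)) * exp (2 * (y + \<nu> * w)) = exp (2 * (\<nu> + 1) * w) * exp (- ((y - 2 * w)\<^sup>2) / (2 * w))"
      by (simp add: exp_add[symmetric])
    then show ?thesis using w by (simp add: normal_density_def)
  qed
  interpret N: prob_space "density lborel (normal_density (2 * w) (sqrt w))"
    using w by (intro prob_space_normal_density) simp
  have "distributed Q lborel (post_incr B 0 w) (normal_density 0 (sqrt w))"
    using normal_increments[of 0 w] w by (simp add: post_incr_def[abs_def])
  then have "(\<integral>\<^sup>+\<omega>. ennreal (exp (2 * (post_incr B 0 w \<omega> + \<nu> * w))) \<partial>Q) =
      (\<integral>\<^sup>+y. ennreal (normal_density 0 (sqrt w) y) * ennreal (exp (2 * (y + \<nu> * w))) \<partial>lborel)"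
    by (rule distributed_nn_integral[symmetric]) measurable
  also have "\<dots> = (\<integral>\<^sup>+y. ennreal (exp (2 * (\<nu> + 1) * w)) * ennreal (normal_density (2 * w) (sqrt w) y) \<partial>lborel)"
    unfolding ennreal_mult'[symmetric, OF normal_density_nonneg] eq by (simp add: ennreal_mult)
  also have "\<dots> = ennreal (exp (2 * (\<nu> + 1) * w)) * emeasure (density lborel (normal_density (2 * w) (sqrt w))) UNIV"
    by (subst nn_integral_cmult) (auto simp: emeasure_density)
  also have "emeasure (density lborel (normal_density (2 * w) (sqrt w))) UNIV = 1"
    using N.emeasure_space_1 by simp
  finally show ?thesis by simp
qed

lemma ennreal_yor_A:
  assumes \<omega>: "\<omega> \<in> space Q"
  shows "ennreal (yor_A (post_incr B 0) \<nu> x \<omega>) = (\<integral>\<^sup>+w. ennreal (exp (2 * (post_incr B 0 w \<omega> + \<nu> * w))) * indicator {0..x} w \<partial>lborel)"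
proof -
  have "continuous_on {0..x} (\<lambda>w. exp (2 * (post_incr B 0 w \<omega> + \<nu> * w)))"
    by (intro continuous_intros continuous_post_incr \<omega>) auto
  then have int: "integrable lborel (\<lambda>w. indicator {0..x} w *\<^sub>R exp (2 * (post_incr B 0 w \<omega> + \<nu> * w)))"
    using borel_integrable_atLeastAtMost' unfolding set_integrable_def by blast
  have "(\<integral>\<^sup>+w. ennreal (exp (2 * (post_incr B 0 w \<omega> + \<nu> * w))) * indicator {0..x} w \<partial>lborel) =
      (\<integral>\<^sup>+w. ennreal (indicator {0..x} w *\<^sub>R exp (2 * (post_incr B 0 w \<omega> + \<nu> * w))) \<partial>lborel)"
    by (intro nn_integral_cong) (auto simp: indicator_def)
  also have "\<dots> = ennreal (\<integral>w. indicator {0..x} w *\<^sub>R exp (2 * (post_incr B 0 w \<omega> + \<nu> * w)) \<partial>lborel)"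
    by (intro nn_integral_eq_integral int) auto
  finally show ?thesis by (simp add: yor_A_def set_lebesgue_integral_def)
qed

lemma nn_integral_yor_A:
  "(\<integral>\<^sup>+\<omega>. ennreal (yor_A (post_incr B 0) \<nu> x \<omega>) \<partial>Q) = (\<integral>\<^sup>+w. ennreal (exp (2 * (\<nu> + 1) * w)) * indicator {0..x} w \<partial>lborel)"
proof -
  interpret P: pair_sigma_finite Q lborel ..
  have [measurable]: "post_incr B 0 w \<in> borel_measurable Q" for w by (rule measurable_post_incr) simp
  have "(\<integral>\<^sup>+\<omega>. ennreal (yor_A (post_incr B 0) \<nu> x \<omega>) \<partial>Q) =
      (\<integral>\<^sup>+\<omega>. (\<integral>\<^sup>+w. ennreal (exp (2 * (post_incr B 0 w \<omega> + \<nu> * w))) * indicator {0..x} w \<partial>lborel) \<partial>Q)"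
    by (intro nn_integral_cong ennreal_yor_A)
  also have "\<dots> = (\<integral>\<^sup>+w. (\<integral>\<^sup>+\<omega>. ennreal (exp (2 * (post_incr B 0 w \<omega> + \<nu> * w))) * indicator {0..x} w \<partial>Q) \<partial>lborel)"
    by (rule P.Fubini'[symmetric]) (unfold case_prod_beta, measurable)
  also have "\<dots> = (\<integral>\<^sup>+w. ennreal (exp (2 * (\<nu> + 1) * w)) * indicator {0..x} w \<partial>lborel)"
  proof (intro nn_integral_cong)
    fix w
    have "(\<integral>\<^sup>+\<omega>. ennreal (exp (2 * (post_incr B 0 w \<omega> + \<nu> * w))) * indicator {0..x} w \<partial>Q) =
        (\<integral>\<^sup>+\<omega>. ennreal (exp (2 * (post_incr B 0 w \<omega> + \<nu> * w))) \<partial>Q) * indicator {0..x} w"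
      by (rule nn_integral_multc) measurable
    then show "(\<integral>\<^sup>+\<omega>. ennreal (exp (2 * (post_incr B 0 w \<omega> + \<nu> * w))) * indicator {0..x} w \<partial>Q) =
        ennreal (exp (2 * (\<nu> + 1) * w)) * indicator {0..x} w"
      using nn_integral_exp_increment[of w \<nu>] by (cases "0 \<le> w") auto
  qed
  finally show ?thesis .
qed

text \<open>At strike 0 the payoff is \<open>A x\<close>, whose mean is the integral of
  \<open>exp (2 * (\<nu> + 1) * w)\<close> over \<open>{0..x}\<close>. Integrating in
  \<open>x\<close> first gives the factor \<open>1 / z\<close>, then \<open>w\<close> gives the
  other one. This is the origin of the denominator in the theorem.\<close>

lemma yor_call_laplace_0:
  assumes z: "0 < z" "2 * (\<nu> + 1) < z"
  shows "yor_call_laplace \<nu> z 0 = ennreal (1 / (z * (z - 2 * (\<nu> + 1))))"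
proof -
  let ?g = "\<lambda>x w. indicator {0<..} x * ennreal (exp (- z * x)) * (ennreal (exp (2 * (\<nu> + 1) * w)) * indicator {0..x} w)"
  have "yor_call_mean \<nu> 0 x = (\<integral>\<^sup>+w. ennreal (exp (2 * (\<nu> + 1) * w)) * indicator {0..x} w \<partial>lborel)" for x
    unfolding yor_call_mean_def nn_integral_yor_A[symmetric]
    by (intro nn_integral_cong) (simp add: yor_A_nonneg)
  then have "yor_call_laplace \<nu> z 0 = (\<integral>\<^sup>+x. (\<integral>\<^sup>+w. ?g x w \<partial>lborel) \<partial>lborel)"
    unfolding yor_call_laplace_def by (simp add: nn_integral_cmult)
  also have "\<dots> = (\<integral>\<^sup>+w. (\<integral>\<^sup>+x. ?g x w \<partial>lborel) \<partial>lborel)"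
  proof (rule lborel_pair.Fubini'[symmetric])
    have "(\<lambda>p. indicator {0<..} (fst p) * ennreal (exp (- z * fst p)) * (ennreal (exp (2 * (\<nu> + 1) * snd p)) * (if 0 \<le> snd p \<and> snd p \<le> fst p then 1 else 0))) \<in> borel_measurable (lborel \<Otimes>\<^sub>M lborel)"
      by measurable
    then show "(\<lambda>(x, w). ?g x w) \<in> borel_measurable (lborel \<Otimes>\<^sub>M lborel)"
      by (simp add: case_prod_beta indicator_def of_bool_def)
  qed
  also have "\<dots> = (\<integral>\<^sup>+w. ennreal (1 / z) * (ennreal (exp (- (z - 2 * (\<nu> + 1)) * w)) * indicator {0..} w) \<partial>lborel)"
  proof (intro nn_integral_cong)
    fix w :: real
    show "(\<integral>\<^sup>+x. ?g x w \<partial>lborel) =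
        ennreal (1 / z) * (ennreal (exp (- (z - 2 * (\<nu> + 1)) * w)) * indicator {0..} w)"
    proof (cases "0 \<le> w")
      case True
      have "(\<integral>\<^sup>+x. ?g x w \<partial>lborel) =
          (\<integral>\<^sup>+x. ennreal (exp (2 * (\<nu> + 1) * w)) * (ennreal (exp (- z * x)) * indicator {w..} x) \<partial>lborel)"
      proof (rule nn_integral_cong_AE)
        show "AE x in lborel. ?g x w =
            ennreal (exp (2 * (\<nu> + 1) * w)) * (ennreal (exp (- z * x)) * indicator {w..} x)"
          using AE_lborel_singleton[of 0] by eventually_elim (use True in \<open>auto simp: indicator_def mult_ac\<close>)
      qed
      also have "\<dots> = ennreal (exp (2 * (\<nu> + 1) * w)) * ennreal (exp (- z * w) / z)"
        unfolding nn_integral_exp_atLeast[OF z(1), symmetric] by (rule nn_integral_cmult) measurable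
      also have "\<dots> = ennreal (exp (2 * (\<nu> + 1) * w) * (exp (- z * w) / z))"
        by (rule ennreal_mult'[symmetric]) simp
      also have "exp (2 * (\<nu> + 1) * w) * (exp (- z * w) / z) = 1 / z * exp (- (z - 2 * (\<nu> + 1)) * w)"
        by (simp add: exp_add[symmetric] algebra_simps)
      also have "ennreal (1 / z * exp (- (z - 2 * (\<nu> + 1)) * w)) = ennreal (1 / z) * ennreal (exp (- (z - 2 * (\<nu> + 1)) * w))"
        using z by (intro ennreal_mult) auto
      finally show ?thesis using True by simp
    next
      case False
      then show ?thesis by simp
    qed
  qed
  also have "\<dots> = ennreal (1 / z) * ennreal (1 / (z - 2 * (\<nu> + 1)))"
    using z nn_integral_exp_atLeast[of "z - 2 * (\<nu> + 1)" 0] by (simp add: nn_integral_cmult)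
  also have "\<dots> = ennreal (1 / (z * (z - 2 * (\<nu> + 1))))"
    using z by (subst ennreal_mult[symmetric]) auto
  finally show ?thesis .
qed

lemma yor_call_mean_eq_tail:
  "yor_call_mean \<nu> a x = (\<integral>\<^sup>+q. indicator {a<..} q * yor_tail \<nu> (x, q) \<partial>lborel)"
proof -
  interpret P: pair_sigma_finite Q lborel ..
  have A[measurable]: "yor_A (post_incr B 0) \<nu> x \<in> borel_measurable Q" by (rule measurable_yor) simp
  have "yor_call_mean \<nu> a x = (\<integral>\<^sup>+\<omega>. (\<integral>\<^sup>+q. indicator {a<..} q * (if q < yor_A (post_incr B 0) \<nu> x \<omega> then 1 else 0) \<partial>lborel) \<partial>Q)"
    unfolding yor_call_mean_def
  proof (intro nn_integral_cong)
    fix \<omega>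
    let ?A = "yor_A (post_incr B 0) \<nu> x \<omega>"
    have "(\<integral>\<^sup>+q. indicator {a<..} q * (if q < ?A then 1 else 0) \<partial>lborel) = (\<integral>\<^sup>+q. indicator {a<..<?A} q \<partial>lborel)"
      by (intro nn_integral_cong) (auto simp: indicator_def)
    also have "\<dots> = ennreal (max 0 (?A - a))"
      by (cases "a \<le> ?A") (auto simp: max_def ennreal_neg)
    finally show "ennreal (max 0 (?A - a)) = (\<integral>\<^sup>+q. indicator {a<..} q * (if q < ?A then 1 else 0) \<partial>lborel)" by simp
  qed
  also have "\<dots> = (\<integral>\<^sup>+q. (\<integral>\<^sup>+\<omega>. indicator {a<..} q * (if q < yor_A (post_incr B 0) \<nu> x \<omega> then 1 else 0) \<partial>Q) \<partial>lborel)"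
    by (rule P.Fubini'[symmetric]) (unfold case_prod_beta, measurable)
  also have "\<dots> = (\<integral>\<^sup>+q. indicator {a<..} q * yor_tail \<nu> (x, q) \<partial>lborel)"
  proof (intro nn_integral_cong)
    fix q
    have "(\<integral>\<^sup>+\<omega>. indicator {a<..} q * (if q < yor_A (post_incr B 0) \<nu> x \<omega> then 1 else 0) \<partial>Q) =
        (\<integral>\<^sup>+\<omega>. indicator {a<..} q * indicator {\<omega> \<in> space Q. q < yor_A (post_incr B 0) \<nu> x \<omega>} \<omega> \<partial>Q)"
      by (intro nn_integral_cong) (auto simp: indicator_def)
    then show "(\<integral>\<^sup>+\<omega>. indicator {a<..} q * (if q < yor_A (post_incr B 0) \<nu> x \<omega> then 1 else 0) \<partial>Q) = indicator {a<..} q * yor_tail \<nu> (x, q)"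
      by (simp add: nn_integral_cmult yor_tail_def)
  qed
  finally show ?thesis .
qed

text \<open>Exhibits the call transform as a tail integral in the strike, so that its strike
  derivative is minus the tail transform wherever the latter is continuous.\<close>

lemma yor_call_laplace_eq_tail:
  "yor_call_laplace \<nu> z a = (\<integral>\<^sup>+q. indicator {a<..} q * yor_tail_laplace \<nu> z q \<partial>lborel)"
proof -
  have "yor_call_laplace \<nu> z a = (\<integral>\<^sup>+x. (\<integral>\<^sup>+q. indicator {0<..} x * ennreal (exp (- z * x)) * (indicator {a<..} q * yor_tail \<nu> (x, q)) \<partial>lborel) \<partial>lborel)"
    unfolding yor_call_laplace_def yor_call_mean_eq_tail by (intro nn_integral_cong nn_integral_cmult[symmetric]) measurable
  also have "\<dots> = (\<integral>\<^sup>+q. (\<integral>\<^sup>+x. indicator {0<..} x * ennreal (exp (- z * x)) * (indicator {a<..} q * yor_tail \<nu> (x, q)) \<partial>lborel) \<partial>lborel)"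
    by (rule lborel_pair.Fubini'[symmetric]) (unfold case_prod_beta, measurable)
  also have "\<dots> = (\<integral>\<^sup>+q. indicator {a<..} q * yor_tail_laplace \<nu> z q \<partial>lborel)"
    unfolding yor_tail_laplace_def by (intro nn_integral_cong, subst nn_integral_cmult[symmetric]) (auto simp: mult_ac)
  finally show ?thesis .
qed

lemma yor_tail_laplace_le:
  assumes z: "0 < z"
  shows "yor_tail_laplace \<nu> z q \<le> ennreal (1 / z)"
proof -
  have "yor_tail_laplace \<nu> z q \<le> (\<integral>\<^sup>+x. ennreal (exp (- z * x)) * indicator {0..} x \<partial>lborel)"
    unfolding yor_tail_laplace_def
    by (intro nn_integral_mono) (auto simp: indicator_def yor_tail_def emeasure_le_1 intro!: mult_left_le)
  also have "\<dots> = ennreal (1 / z)" using nn_integral_exp_atLeast[OF z, of 0] by simp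
  finally show ?thesis .
qed

text \<open>
  The tail is that of the law of \<open>A\<close> at an exponential time, which has no atoms because
  \<open>A\<close> is strictly increasing.
\<close>

lemma continuous_yor_tail_laplace:
  assumes z: "0 < z"
  shows "isCont (\<lambda>q. enn2real (yor_tail_laplace \<nu> z q)) q"
proof -
  \<comment> \<open>\<open>E\<close> is \<open>1 / z\<close> times the exponential law of rate
    \<open>z\<close>. Below, \<open>L\<close> is the image of its product with \<open>Q\<close>
    under the accumulation at that time.\<close>
  define E where "E = density lborel (\<lambda>x. indicator {0<..} x * ennreal (exp (- z * x)))"
  have E_sets[measurable_cong]: "sets E = sets borel" by (simp add: E_def)
  have "emeasure E UNIV \<le> ennreal (1 / z)"
  proof -
    have "emeasure E UNIV \<le> (\<integral>\<^sup>+x. ennreal (exp (- z * x)) * indicator {0..} x \<partial>lborel)"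
      by (auto simp: E_def emeasure_density indicator_def intro!: nn_integral_mono)
    then show ?thesis using nn_integral_exp_atLeast[OF z, of 0] by simp
  qed
  then have "emeasure E (space E) \<noteq> \<infinity>" using neq_top_trans by (force simp: E_def)
  then interpret E: finite_measure E by (rule finite_measureI)
  interpret P: pair_sigma_finite E Q ..
  have A[measurable]: "(\<lambda>p. yor_A (post_incr B 0) \<nu> (fst p) (snd p)) \<in> borel_measurable (E \<Otimes>\<^sub>M Q)"
    using measurable_yor_pair[of 0 \<nu>] by (simp cong: measurable_cong_sets sets_pair_measure_cong add: E_sets)
  have Ax[measurable]: "yor_A (post_incr B 0) \<nu> x \<in> borel_measurable Q" for x by (rule measurable_yor) simp
  define L where "L = distr (E \<Otimes>\<^sub>M Q) borel (\<lambda>p. yor_A (post_incr B 0) \<nu> (fst p) (snd p))"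
  have em: "emeasure L {q<..} = yor_tail_laplace \<nu> z q" for q
  proof -
    have "emeasure L {q<..} = emeasure (E \<Otimes>\<^sub>M Q) {p \<in> space (E \<Otimes>\<^sub>M Q). q < yor_A (post_incr B 0) \<nu> (fst p) (snd p)}"
      unfolding L_def by (subst emeasure_distr) (auto intro!: arg_cong2[where f=emeasure])
    also have "\<dots> = (\<integral>\<^sup>+x. emeasure Q (Pair x -` {p \<in> space (E \<Otimes>\<^sub>M Q). q < yor_A (post_incr B 0) \<nu> (fst p) (snd p)}) \<partial>E)"
      by (subst emeasure_pair_measure_alt) auto
    also have "\<dots> = (\<integral>\<^sup>+x. yor_tail \<nu> (x, q) \<partial>E)"
      by (intro nn_integral_cong) (auto simp: yor_tail_def space_pair_measure E_def intro!: arg_cong2[where f=emeasure])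
    also have "\<dots> = yor_tail_laplace \<nu> z q"
      unfolding E_def yor_tail_laplace_def by (subst nn_integral_density) auto
    finally show ?thesis .
  qed
  have fin: "emeasure L UNIV \<noteq> \<infinity>"
  proof -
    have "emeasure (E \<Otimes>\<^sub>M Q) (space E \<times> space Q) = emeasure E (space E) * emeasure Q (space Q)"
      by (rule emeasure_pair_measure_Times) auto
    then show ?thesis using \<open>emeasure E (space E) \<noteq> \<infinity>\<close>
      by (auto simp: L_def emeasure_distr emeasure_space_1 space_pair_measure[symmetric])
  qed
  interpret L: finite_borel_measure L
    using fin by (auto simp: finite_borel_measure_def finite_borel_measure_axioms_def L_def intro!: finite_measureI)
  have "measure L {q} = 0"
  proof -
    have "emeasure L {q} = emeasure (E \<Otimes>\<^sub>M Q) {p \<in> space (E \<Otimes>\<^sub>M Q). yor_A (post_incr B 0) \<nu> (fst p) (snd p) = q}"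
      unfolding L_def by (subst emeasure_distr) (auto intro!: arg_cong2[where f=emeasure])
    also have "\<dots> = (\<integral>\<^sup>+\<omega>. emeasure E ((\<lambda>x. (x, \<omega>)) -` {p \<in> space (E \<Otimes>\<^sub>M Q). yor_A (post_incr B 0) \<nu> (fst p) (snd p) = q}) \<partial>Q)"
      by (subst P.emeasure_pair_measure_alt2) auto
    also have "\<dots> = (\<integral>\<^sup>+\<omega>. 0 \<partial>Q)"
    proof (intro nn_integral_cong)
      fix \<omega> assume \<omega>: "\<omega> \<in> space Q"
      let ?S = "{x. yor_A (post_incr B 0) \<nu> x \<omega> = q}"
      have sub: "?S \<inter> {0<..} \<subseteq> {x0}" if "x0 \<in> ?S \<inter> {0<..}" for x0
        using yor_A_strict_mono[of _ _ \<omega> \<nu>] \<omega> that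
        by (auto, metis linorder_neqE_linordered_idom less_irrefl less_imp_le)
      have S: "(\<lambda>x. (x, \<omega>)) -` {p \<in> space (E \<Otimes>\<^sub>M Q). yor_A (post_incr B 0) \<nu> (fst p) (snd p) = q} = ?S"
        using \<omega> by (auto simp: space_pair_measure E_def)
      have Sm: "?S \<in> sets borel"
      proof -
        have "(\<lambda>x. yor_A (post_incr B 0) \<nu> x \<omega>) \<in> borel_measurable borel"
          using measurable_compose[OF measurable_Pair2'[OF \<omega>] measurable_yor_pair[of 0 \<nu>]] by simp
        then show ?thesis by measurable
      qed
      have "emeasure E ?S = (\<integral>\<^sup>+x. ennreal (exp (- z * x)) * indicator (?S \<inter> {0<..}) x \<partial>lborel)"
        unfolding E_def using Sm by (subst emeasure_density) (auto simp: indicator_def intro!: nn_integral_cong)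
      also have "\<dots> = (\<integral>\<^sup>+(x::real). 0 \<partial>lborel)"
      proof (rule nn_integral_cong_AE)
        obtain x0 where x0: "?S \<inter> {0<..} \<subseteq> {x0}" using sub by blast
        show "AE x in lborel. ennreal (exp (- z * x)) * indicator (?S \<inter> {0<..}) x = 0"
          using AE_lborel_singleton[of x0] by eventually_elim (use x0 in \<open>auto simp: indicator_def\<close>)
      qed
      finally show "emeasure E ((\<lambda>x. (x, \<omega>)) -` {p \<in> space (E \<Otimes>\<^sub>M Q). yor_A (post_incr B 0) \<nu> (fst p) (snd p) = q}) = 0"
        unfolding S by simp
    qed
    finally show ?thesis by (simp add: measure_def)
  qed
  then have "isCont (cdf L) q" by (simp add: L.isCont_cdf)
  \<comment> \<open>The tail transform is the total mass of \<open>L\<close> minus its distribution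
    function, so its continuity at \<open>q\<close> amounts to the absence of an atom at
    \<open>q\<close>.\<close>
  moreover have "enn2real (yor_tail_laplace \<nu> z q) = measure L UNIV - cdf L q" for q
  proof -
    have "measure L {q<..} = measure L UNIV - measure L {..q}"
      using L.finite_measure_compl[of "{..q}"] by (simp add: Compl_eq_Diff_UNIV[symmetric] L_def)
    then show ?thesis by (simp add: em[symmetric] measure_def[symmetric] cdf_def)
  qed
  ultimately show ?thesis by (auto intro!: continuous_intros)
qed

end

section \<open>Laplace transform in time of the heat kernel with drift\<close>

lemma DERIV_integral_continuous:
  fixes f :: "real \<Rightarrow> real"
  assumes c: "continuous_on UNIV f" and u: "a < u"
  shows "((\<lambda>w. integral {a..w} f) has_real_derivative f u) (at u)"
proof -
  have "((\<lambda>w. integral {a..w} f) has_real_derivative f u) (at u within {a..u + 1})"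
    using u by (intro integral_has_real_derivative continuous_on_subset[OF c]) auto
  then show ?thesis using u by (simp add: at_within_Icc_at)
qed

lemma LBINT_Ioc_eq_integral:
  fixes f :: "real \<Rightarrow> real"
  assumes c: "continuous_on UNIV f"
  shows "(LBINT v:{a<..w}. f v) = integral {a..w} f"
proof -
  have [measurable]: "f \<in> borel_measurable borel" using c by (rule borel_measurable_continuous_onI)
  have "(LBINT v:{a<..w}. f v) = (LBINT v:{a..w}. f v)"
    unfolding set_lebesgue_integral_def
    by (intro integral_cong_AE) (auto intro!: AE_I[where N="{a}"] simp: indicator_def)
  also have "\<dots> = integral {a..w} f"
    by (intro set_borel_integral_eq_integral borel_integrable_atLeastAtMost' continuous_on_subset[OF c]) auto
  finally show ?thesis .
qed

text \<open>The distribution function is split at \<open>x - 1\<close>: up to a constant it is then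
  an integral over a compact interval, to which the fundamental theorem of calculus applies near
  \<open>x\<close>.\<close>

lemma std_normal_cdf_derivative:
  "(cdf std_normal_distribution has_real_derivative std_normal_density x) (at x)"
proof -
  interpret real_distribution std_normal_distribution by (rule real_dist_normal_dist)
  have c: "continuous_on S std_normal_density" for S
    unfolding normal_density_def by (intro continuous_intros) auto
  have eq: "cdf std_normal_distribution u = cdf std_normal_distribution (x - 1) + integral {x - 1..u} std_normal_density"
    if "x - 1 \<le> u" for u
  proof -
    have "cdf std_normal_distribution u - cdf std_normal_distribution (x - 1) = measure std_normal_distribution {x - 1<..u}" if "x - 1 < u"
      using that by (rule cdf_diff_eq)
    moreover have "measure std_normal_distribution {x - 1<..u} = (LBINT v:{x - 1<..u}. std_normal_density v)"
    proof -
      have "emeasure std_normal_distribution {x - 1<..u} = (\<integral>\<^sup>+v. ennreal (indicator {x - 1<..u} v *\<^sub>R std_normal_density v) \<partial>lborel)"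
        by (subst emeasure_density) (auto intro!: nn_integral_cong simp: indicator_def)
      also have "\<dots> = ennreal (LBINT v:{x - 1<..u}. std_normal_density v)"
        unfolding set_lebesgue_integral_def
        by (intro nn_integral_eq_integral integrable_mult_indicator) auto
      finally show ?thesis
        by (simp add: measure_def set_lebesgue_integral_def)
    qed
    moreover have "(LBINT v:{x - 1<..u}. std_normal_density v) = integral {x - 1..u} std_normal_density"
      by (rule LBINT_Ioc_eq_integral[OF c])
    ultimately show ?thesis using that by (cases "x - 1 = u") auto
  qed
  have "((\<lambda>u. integral {x - 1..u} std_normal_density) has_real_derivative std_normal_density x) (at x)"
    by (rule DERIV_integral_continuous[OF c]) simp
  then have d: "((\<lambda>u. cdf std_normal_distribution (x - 1) + integral {x - 1..u} std_normal_density) has_real_derivative std_normal_density x) (at x)"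
    by (auto intro!: derivative_eq_intros)
  show ?thesis
  proof (rule has_field_derivative_transform_within_open[OF d, of "{x - 1<..}"])
    fix u assume "u \<in> {x - 1<..}"
    then have "x - 1 \<le> u" by simp
    from eq[OF this, symmetric]
    show "cdf std_normal_distribution (x - 1) + integral {x - 1..u} std_normal_density = cdf std_normal_distribution u" .
  qed auto
qed

text \<open>
  The integrand is the derivative of
  \<open>(\<Phi> ((m r - Y) / sqrt r) - e\<^bsup>2 m Y\<^esup> \<Phi> (- (m r + Y) / sqrt r)) / m\<close>,
  with \<open>\<Phi>\<close> the standard normal distribution function.
\<close>

lemma heat_kernel_laplace_aux:
  assumes m: "0 < m" and Y: "0 < (Y :: real)"
  shows "(\<integral>\<^sup>+r. ennreal (indicator {0<..} r * (1 / sqrt r * std_normal_density ((m * r - Y) / sqrt r))) \<partial>lborel) = ennreal (1 / m)"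
proof -
  interpret real_distribution std_normal_distribution by (rule real_dist_normal_dist)
  let ?\<Phi> = "cdf std_normal_distribution"
  define v where "v r = (m * r - Y) / sqrt r" for r
  define u where "u r = - (m * r + Y) / sqrt r" for r
  define G where "G r = (?\<Phi> (v r) - exp (2 * m * Y) * ?\<Phi> (u r)) / m" for r
  define g where "g r = 1 / sqrt r * std_normal_density (v r)" for r
  have dv: "(v has_real_derivative (m / (2 * sqrt r) + Y / (2 * r * sqrt r))) (at r)" if "0 < r" for r
    unfolding v_def using that
    by (auto intro!: derivative_eq_intros simp: field_simps power2_eq_square)
  have du: "(u has_real_derivative (- m / (2 * sqrt r) + Y / (2 * r * sqrt r))) (at r)" if "0 < r" for r
    unfolding u_def using that
    by (auto intro!: derivative_eq_intros simp: field_simps power2_eq_square)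
  \<comment> \<open>The factor \<open>exp (2 * m * Y)\<close> converts the density at
    \<open>u r\<close> into the density at \<open>v r\<close>. In the derivative of \<open>G\<close>
    the terms with \<open>Y\<close> then cancel, while those with \<open>m\<close> add up to
    \<open>m / sqrt r\<close>.\<close>
  have uv: "exp (2 * m * Y) * std_normal_density (u r) = std_normal_density (v r)" if "0 < r" for r
  proof -
    have "2 * m * Y - (u r)\<^sup>2 / 2 = - (v r)\<^sup>2 / 2"
      using that by (simp add: u_def v_def power_divide field_simps power2_eq_square)
    then have "exp (2 * m * Y) * exp (- (u r)\<^sup>2 / 2) = exp (- (v r)\<^sup>2 / 2)"
      by (simp add: exp_add[symmetric])
    then show ?thesis by (simp add: std_normal_density_def field_simps)
  qed
  have dG: "(G has_real_derivative g r) (at r)" if "0 < r" for r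
  proof -
    have "(G has_real_derivative (std_normal_density (v r) * (m / (2 * sqrt r) + Y / (2 * r * sqrt r)) -
        exp (2 * m * Y) * (std_normal_density (u r) * (- m / (2 * sqrt r) + Y / (2 * r * sqrt r)))) / m) (at r)"
      unfolding G_def
      by (intro DERIV_cdivide DERIV_diff DERIV_cmult DERIV_chain2[OF std_normal_cdf_derivative] dv du that)
    also have "exp (2 * m * Y) * (std_normal_density (u r) * (- m / (2 * sqrt r) + Y / (2 * r * sqrt r))) =
        std_normal_density (v r) * (- m / (2 * sqrt r) + Y / (2 * r * sqrt r))"
      using uv[OF that] by (simp add: mult.assoc[symmetric])
    also have "(std_normal_density (v r) * (m / (2 * sqrt r) + Y / (2 * r * sqrt r)) -
        std_normal_density (v r) * (- m / (2 * sqrt r) + Y / (2 * r * sqrt r))) / m = g r"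
      using m that by (simp add: g_def field_simps)
    finally show ?thesis .
  qed
  have lim0: "(G \<longlongrightarrow> 0) (at_right 0)"
  proof -
    have "filterlim v at_bot (at_right 0)" unfolding v_def using m Y by real_asymp
    moreover have "filterlim u at_bot (at_right 0)" unfolding u_def using m Y by real_asymp
    ultimately have "(G \<longlongrightarrow> (0 - exp (2 * m * Y) * 0) / m) (at_right 0)"
      unfolding G_def using m
      by (intro tendsto_divide tendsto_diff tendsto_mult tendsto_const filterlim_compose[OF cdf_lim_at_bot]) auto
    then show ?thesis by simp
  qed
  have limtop: "(G \<longlongrightarrow> 1 / m) at_top"
  proof -
    have "filterlim v at_top at_top" unfolding v_def using m Y by real_asymp
    moreover have "filterlim u at_bot at_top" unfolding u_def using m Y by real_asymp
    ultimately have "(G \<longlongrightarrow> (1 - exp (2 * m * Y) * 0) / m) at_top"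
      unfolding G_def using m
      by (intro tendsto_divide tendsto_diff tendsto_mult tendsto_const filterlim_compose[OF cdf_lim_at_bot] filterlim_compose[OF cdf_lim_at_top_prob]) auto
    then show ?thesis by simp
  qed
  have cg: "isCont g r" if "0 < r" for r
    unfolding g_def v_def std_normal_density_def using that by (intro continuous_intros) auto
  have FTC: "set_integrable lborel (einterval 0 \<infinity>) g" "(LBINT r=0..\<infinity>. g r) = 1 / m - 0"
    using interval_integral_FTC_nonneg[of 0 \<infinity> G g 0 "1 / m"] dG cg lim0 limtop
    by (auto simp: ereal_tendsto_simps zero_ereal_def g_def less_imp_le)
  have e: "einterval 0 \<infinity> = {0<..}" by (auto simp: einterval_def zero_ereal_def)
  have "(\<integral>\<^sup>+r. ennreal (indicator {0<..} r * g r) \<partial>lborel) = ennreal (LBINT r:{0<..}. g r)"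
    using FTC(1) unfolding e set_integrable_def set_lebesgue_integral_def
    by (subst nn_integral_eq_integral) (auto simp: g_def indicator_def)
  also have "(LBINT r:{0<..}. g r) = 1 / m"
    using FTC(2) unfolding interval_lebesgue_integral_def e by simp
  finally show ?thesis by (simp add: g_def v_def)
qed

text \<open>Completing the square with \<open>m\<close> squared equal to
  \<open>2 * z + \<nu>\<close> squared isolates \<open>exp (\<nu> * y - m * \<bar>y\<bar>)\<close>
  and leaves the integrand of \<open>heat_kernel_laplace_aux\<close> with
  \<open>Y = \<bar>y\<bar>\<close>, which is why \<open>y\<close> must not vanish.\<close>

lemma heat_kernel_laplace:
  fixes z \<nu> y :: real
  assumes z: "0 < 2 * z + \<nu>\<^sup>2" and y: "y \<noteq> 0"
  defines "m \<equiv> sqrt (2 * z + \<nu>\<^sup>2)"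
  shows "(\<integral>\<^sup>+r. indicator {0<..} r * (ennreal (exp (- z * r)) * ennreal (normal_density 0 (sqrt r) (y - \<nu> * r))) \<partial>lborel) =
    ennreal (exp (\<nu> * y - m * \<bar>y\<bar>) / m)"
proof -
  have m: "0 < m" "m\<^sup>2 = 2 * z + \<nu>\<^sup>2" using z by (simp_all add: m_def)
  have "indicator {0<..} r * (ennreal (exp (- z * r)) * ennreal (normal_density 0 (sqrt r) (y - \<nu> * r))) =
      ennreal (exp (\<nu> * y - m * \<bar>y\<bar>)) * ennreal (indicator {0<..} r * (1 / sqrt r * std_normal_density ((m * r - \<bar>y\<bar>) / sqrt r)))" for r
  proof (cases "0 < r")
    case True
    have "- z * r - (y - \<nu> * r)\<^sup>2 / (2 * r) = (\<nu> * y - m * \<bar>y\<bar>) - ((m * r - \<bar>y\<bar>) / sqrt r)\<^sup>2 / 2"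
    proof -
      have zz: "z = (m\<^sup>2 - \<nu>\<^sup>2) / 2" using m by simp
      show ?thesis using True unfolding zz
        by (simp add: power_divide field_simps power2_eq_square)
    qed
    then have "exp (- z * r) * exp (- (y - \<nu> * r)\<^sup>2 / (2 * r)) = exp (\<nu> * y - m * \<bar>y\<bar>) * exp (- ((m * r - \<bar>y\<bar>) / sqrt r)\<^sup>2 / 2)"
      by (simp add: exp_add[symmetric])
    then have "exp (- z * r) * normal_density 0 (sqrt r) (y - \<nu> * r) = exp (\<nu> * y - m * \<bar>y\<bar>) * (1 / sqrt r * std_normal_density ((m * r - \<bar>y\<bar>) / sqrt r))"
      using True by (simp add: normal_density_def std_normal_density_def real_sqrt_mult field_simps)
    then show ?thesis using True by (simp add: ennreal_mult[symmetric] del: ennreal_mult)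
  qed auto
  then have "(\<integral>\<^sup>+r. indicator {0<..} r * (ennreal (exp (- z * r)) * ennreal (normal_density 0 (sqrt r) (y - \<nu> * r))) \<partial>lborel) =
     ennreal (exp (\<nu> * y - m * \<bar>y\<bar>)) * (\<integral>\<^sup>+r. ennreal (indicator {0<..} r * (1 / sqrt r * std_normal_density ((m * r - \<bar>y\<bar>) / sqrt r))) \<partial>lborel)"
    unfolding std_normal_density_def by (simp add: nn_integral_cmult)
  also have "\<dots> = ennreal (exp (\<nu> * y - m * \<bar>y\<bar>) / m)"
    using m y by (subst heat_kernel_laplace_aux) (auto simp: ennreal_mult[symmetric])
  finally show ?thesis .
qed

section \<open>The differential equation in the logarithmic strike\<close>

lemma DERIV_set_integral_atMost:
  fixes f :: "real \<Rightarrow> real"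
  assumes int: "\<And>u. set_integrable lborel {..u} f" and c: "continuous_on UNIV f"
  shows "((\<lambda>u. LBINT v:{..u}. f v) has_real_derivative f u) (at u)"
proof -
  have eq: "(LBINT v:{..w}. f v) = (LBINT v:{..u - 1}. f v) + integral {u - 1..w} f" if "u - 1 \<le> w" for w
  proof -
    have "{..w} = {..u - 1} \<union> {u - 1<..w}" using that by auto
    then have "(LBINT v:{..w}. f v) = (LBINT v:{..u - 1}. f v) + (LBINT v:{u - 1<..w}. f v)"
      using int[of w] int[of "u - 1"] that
      by (simp, intro set_integral_Un) (auto intro: set_integrable_subset)
    also have "(LBINT v:{u - 1<..w}. f v) = integral {u - 1..w} f" by (rule LBINT_Ioc_eq_integral[OF c])
    finally show ?thesis .
  qed
  have "((\<lambda>w. integral {u - 1..w} f) has_real_derivative f u) (at u)"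
    by (rule DERIV_integral_continuous[OF c]) simp
  then have d: "((\<lambda>w. (LBINT v:{..u - 1}. f v) + integral {u - 1..w} f) has_real_derivative f u) (at u)"
    by (auto intro!: derivative_eq_intros)
  show ?thesis
  proof (rule has_field_derivative_transform_within_open[OF d, of "{u - 1<..}"])
    fix w assume "w \<in> {u - 1<..}"
    then have "u - 1 \<le> w" by simp
    from eq[OF this, symmetric] show "(LBINT v:{..u - 1}. f v) + integral {u - 1..w} f = (LBINT v:{..w}. f v)" .
  qed auto
qed

lemma DERIV_set_integral_greaterThan:
  fixes f :: "real \<Rightarrow> real"
  assumes int: "\<And>u. set_integrable lborel {u<..} f" and c: "continuous_on UNIV f"
  shows "((\<lambda>u. LBINT v:{u<..}. f v) has_real_derivative - f u) (at u)"
proof -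
  have eq: "(LBINT v:{w<..}. f v) = (LBINT v:{u - 1<..}. f v) - integral {u - 1..w} f" if "u - 1 \<le> w" for w
  proof -
    have "(LBINT v:{u - 1<..w} \<union> {w<..}. f v) = (LBINT v:{u - 1<..w}. f v) + (LBINT v:{w<..}. f v)"
      by (intro set_integral_Un int set_integrable_subset[OF int[of "u - 1"]]) auto
    moreover have "{u - 1<..w} \<union> {w<..} = {u - 1<..}" using that by auto
    ultimately have "(LBINT v:{u - 1<..}. f v) = (LBINT v:{u - 1<..w}. f v) + (LBINT v:{w<..}. f v)"
      by simp
    also have "(LBINT v:{u - 1<..w}. f v) = integral {u - 1..w} f" by (rule LBINT_Ioc_eq_integral[OF c])
    finally show ?thesis by simp
  qed
  have "((\<lambda>w. integral {u - 1..w} f) has_real_derivative f u) (at u)"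
    by (rule DERIV_integral_continuous[OF c]) simp
  then have d: "((\<lambda>w. (LBINT v:{u - 1<..}. f v) - integral {u - 1..w} f) has_real_derivative - f u) (at u)"
    by (auto intro!: derivative_eq_intros)
  show ?thesis
  proof (rule has_field_derivative_transform_within_open[OF d, of "{u - 1<..}"])
    fix w assume "w \<in> {u - 1<..}"
    then have "u - 1 \<le> w" by simp
    from eq[OF this, symmetric] show "(LBINT v:{u - 1<..}. f v) - integral {u - 1..w} f = (LBINT v:{w<..}. f v)" .
  qed auto
qed

lemma set_integrable_exp_atMost:
  fixes p :: real
  assumes "0 < p"
  shows "set_integrable lborel {..u} (\<lambda>v. exp (p * v))"
proof -
  have "(\<lambda>v. exp (- p * v)) absolutely_integrable_on {- u..}"
    by (rule nonnegative_absolutely_integrable_1[OF has_integral_integrable[OF has_integral_exp_minus_to_infinity[OF assms]]]) simp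
  then have "integrable lborel (\<lambda>v. indicator {- u..} v *\<^sub>R exp (- p * v))"
    by (auto simp: set_integrable_def integrable_completion)
  then have "integrable lborel (\<lambda>v. indicator {- u..} (0 + (- 1) * v) *\<^sub>R exp (- p * (0 + (- 1) * v)))"
    by (rule lborel_integrable_real_affine) simp
  moreover have "indicator {- u..} (0 + (- 1) * v) *\<^sub>R exp (- p * (0 + (- 1) * v)) = indicator {..u} v *\<^sub>R exp (p * v)" for v
    by (simp add: indicator_def)
  ultimately show ?thesis by (simp add: set_integrable_def)
qed

text \<open>The kernel is a Green function. For fixed \<open>v\<close> it is
  \<open>exp (- p * u)\<close> to the right of \<open>v\<close> and \<open>exp (b * u)\<close> to
  the left, up to constants; both are annihilated by the operator with characteristic polynomial
  \<open>(x + p) * (x - b)\<close>. The slope of \<open>K\<close> times the kernel jumps by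
  \<open>- K * (p + b)\<close> at \<open>u = v\<close>, which produces the right-hand side. The two
  derivatives of \<open>g\<close> need no smoothness of \<open>G\<close> beyond continuity.\<close>

lemma exponential_convolution_ode:
  fixes G :: "real \<Rightarrow> real"
  assumes p: "0 < p" and b: "0 < b" and c: "continuous_on UNIV G" and bd: "\<And>v. \<bar>G v\<bar> \<le> C"
    and g: "\<And>u. g u = K * (\<integral>v. (if v \<le> u then exp (p * (v - u)) else exp (- b * (v - u))) * G v \<partial>lborel)"
  shows "\<exists>g1 g2. (\<forall>u. (g has_real_derivative g1 u) (at u)) \<and> (\<forall>u. (g1 has_real_derivative g2 u) (at u)) \<and>
    (\<forall>u. g2 u + (p - b) * g1 u - p * b * g u = - K * (p + b) * G u)"
proof -
  have [measurable]: "G \<in> borel_measurable borel" using c by (rule borel_measurable_continuous_onI)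
  have C: "0 \<le> C" using bd[of 0] by linarith
  have i1: "set_integrable lborel {..u} (\<lambda>v. exp (p * v) * G v)" for u
  proof (rule set_integrable_bound)
    show "set_integrable lborel {..u} (\<lambda>v. C * exp (p * v))"
      using set_integrable_exp_atMost[OF p] by (rule set_integrable_mult_right)
    show "AE v in lborel. v \<in> {..u} \<longrightarrow> norm (exp (p * v) * G v) \<le> norm (C * exp (p * v))"
      using bd C by (auto simp: abs_mult mult.commute)
  qed (auto simp: set_borel_measurable_def)
  have i2: "set_integrable lborel {u<..} (\<lambda>v. exp (- b * v) * G v)" for u
  proof (rule set_integrable_bound)
    have "(\<lambda>v. exp (- b * v)) absolutely_integrable_on {u..}"
      by (rule nonnegative_absolutely_integrable_1[OF has_integral_integrable[OF has_integral_exp_minus_to_infinity[OF b]]]) simp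
    then have "set_integrable lborel {u..} (\<lambda>v. exp (- b * v))"
      by (auto simp: set_integrable_def integrable_completion)
    then have "set_integrable lborel {u<..} (\<lambda>v. exp (- b * v))"
      by (rule set_integrable_subset) auto
    then show "set_integrable lborel {u<..} (\<lambda>v. C * exp (- b * v))"
      by (rule set_integrable_mult_right)
    show "AE v in lborel. v \<in> {u<..} \<longrightarrow> norm (exp (- b * v) * G v) \<le> norm (C * exp (- b * v))"
      using bd C by (auto simp: abs_mult mult.commute)
  qed (auto simp: set_borel_measurable_def)
  define P where "P u = (LBINT v:{..u}. exp (p * v) * G v)" for u
  define R where "R u = (LBINT v:{u<..}. exp (- b * v) * G v)" for u
  have dP: "(P has_real_derivative exp (p * u) * G u) (at u)" for u
    unfolding P_def by (intro DERIV_set_integral_atMost i1 continuous_intros c)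
  have dR: "(R has_real_derivative - (exp (- b * u) * G u)) (at u)" for u
    unfolding R_def by (intro DERIV_set_integral_greaterThan i2 continuous_intros c)
  have geq: "g u = K * (exp (- p * u) * P u + exp (b * u) * R u)" for u
  proof -
    have "(\<integral>v. (if v \<le> u then exp (p * (v - u)) else exp (- b * (v - u))) * G v \<partial>lborel) =
       (\<integral>v. exp (- p * u) * (indicator {..u} v *\<^sub>R (exp (p * v) * G v)) + exp (b * u) * (indicator {u<..} v *\<^sub>R (exp (- b * v) * G v)) \<partial>lborel)"
    proof (intro Bochner_Integration.integral_cong refl)
      fix v
      have "exp (p * (v - u)) = exp (- p * u) * exp (p * v)" "exp (- b * (v - u)) = exp (b * u) * exp (- b * v)"
        by (simp_all add: exp_add[symmetric] algebra_simps)
      then show "(if v \<le> u then exp (p * (v - u)) else exp (- b * (v - u))) * G v =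
          exp (- p * u) * (indicator {..u} v *\<^sub>R (exp (p * v) * G v)) + exp (b * u) * (indicator {u<..} v *\<^sub>R (exp (- b * v) * G v))"
        by (simp add: indicator_def)
    qed
    also have "\<dots> = exp (- p * u) * P u + exp (b * u) * R u"
      using i1[of u] i2[of u] unfolding P_def R_def set_integrable_def set_lebesgue_integral_def
      by (subst Bochner_Integration.integral_add) auto
    finally show ?thesis by (simp add: g)
  qed
  define g1 where "g1 u = K * (- p * exp (- p * u) * P u + b * exp (b * u) * R u)" for u
  define g2 where "g2 u = K * (p\<^sup>2 * exp (- p * u) * P u + b\<^sup>2 * exp (b * u) * R u - (p + b) * G u)" for u
  \<comment> \<open>The contributions of the moving endpoint: they cancel in \<open>g1\<close>, so
    \<open>g1\<close> contains no \<open>G\<close> and can be differentiated again; in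
    \<open>g2\<close> they add up to \<open>- (p + b) * G u\<close>.\<close>
  have e1: "(exp (p * u) * G u) * exp (- p * u) = G u" "(- (exp (- b * u) * G u)) * exp (b * u) = - G u" for u
    by (simp_all add: exp_minus field_simps)
  have "(g has_real_derivative g1 u) (at u)" for u
  proof -
    have "((\<lambda>u. K * (exp (- p * u) * P u + exp (b * u) * R u)) has_real_derivative
       K * ((exp (- p * u) * (- p)) * P u + (exp (p * u) * G u) * exp (- p * u) + ((exp (b * u) * b) * R u + (- (exp (- b * u) * G u)) * exp (b * u)))) (at u)"
      by (intro DERIV_cmult DERIV_add DERIV_mult dP dR) (auto intro!: derivative_eq_intros)
    also have "K * ((exp (- p * u) * (- p)) * P u + (exp (p * u) * G u) * exp (- p * u) + ((exp (b * u) * b) * R u + (- (exp (- b * u) * G u)) * exp (b * u))) = g1 u"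
      unfolding e1 g1_def by (simp add: algebra_simps)
    finally show ?thesis by (simp add: geq[abs_def])
  qed
  moreover have "(g1 has_real_derivative g2 u) (at u)" for u
  proof -
    have "((\<lambda>u. K * (- p * (exp (- p * u) * P u) + b * (exp (b * u) * R u))) has_real_derivative
       K * (- p * ((exp (- p * u) * (- p)) * P u + (exp (p * u) * G u) * exp (- p * u)) + b * ((exp (b * u) * b) * R u + (- (exp (- b * u) * G u)) * exp (b * u)))) (at u)"
      by (intro DERIV_cmult DERIV_add DERIV_mult dP dR) (auto intro!: derivative_eq_intros)
    also have "K * (- p * ((exp (- p * u) * (- p)) * P u + (exp (p * u) * G u) * exp (- p * u)) + b * ((exp (b * u) * b) * R u + (- (exp (- b * u) * G u)) * exp (b * u)))
       = K * (- p * ((exp (- p * u) * (- p)) * P u + G u) + b * ((exp (b * u) * b) * R u + (- G u)))"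
      unfolding e1 ..
    also have "\<dots> = g2 u" unfolding g2_def by (simp add: algebra_simps power2_eq_square)
    finally show ?thesis by (simp add: g1_def[abs_def] mult.assoc)
  qed
  moreover have "g2 u + (p - b) * g1 u - p * b * g u = - K * (p + b) * G u" for u
    unfolding g2_def g1_def geq by (simp add: algebra_simps power2_eq_square)
  ultimately show ?thesis by (intro exI[of _ g1] exI[of _ g2] conjI allI)
qed

text \<open>At a positive maximum \<open>w' = 0\<close> would force \<open>w'' = \<kappa> * w > 0\<close>.\<close>

lemma maximum_principle_le:
  fixes w w1 w2 \<beta> :: "real \<Rightarrow> real"
  assumes d1: "\<And>u. (w has_real_derivative w1 u) (at u)" and d2: "\<And>u. (w1 has_real_derivative w2 u) (at u)"
    and ode: "\<And>u. w2 u + \<beta> u * w1 u = \<kappa> * w u" and \<kappa>: "0 < \<kappa>"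
    and top: "(w \<longlongrightarrow> 0) at_top" and bot: "(w \<longlongrightarrow> 0) at_bot"
  shows "w u \<le> 0"
proof (rule ccontr)
  assume "\<not> w u \<le> 0"
  then have u: "0 < w u" by simp
  \<comment> \<open>The limits 0 at both ends keep \<open>w\<close> below the positive value
    \<open>w u\<close> outside a compact interval, so a positive supremum is attained.\<close>
  obtain N where N: "\<And>x. N \<le> x \<Longrightarrow> w x < w u"
    using order_tendstoD(2)[OF top u] unfolding eventually_at_top_linorder by blast
  obtain N' where N': "\<And>x. x \<le> N' \<Longrightarrow> w x < w u"
    using order_tendstoD(2)[OF bot u] unfolding eventually_at_bot_linorder by blast
  have "N' < u" "u < N" using N[of u] N'[of u] by force+
  have cont: "continuous_on S w" for S
    using d1 DERIV_isCont by (blast intro: continuous_at_imp_continuous_on)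
  obtain x where x: "x \<in> {N'..N}" and mx: "\<And>y. y \<in> {N'..N} \<Longrightarrow> w y \<le> w x"
    using continuous_attains_sup[OF compact_Icc _ cont, of N' N] \<open>N' < u\<close> \<open>u < N\<close> by fastforce
  have wu: "w u \<le> w x" using mx[of u] \<open>N' < u\<close> \<open>u < N\<close> by auto
  have mx': "w y \<le> w x" for y
  proof (cases "y \<in> {N'..N}")
    case True then show ?thesis by (rule mx)
  next
    case False
    then have "w y < w u" using N[of y] N'[of y] by auto
    then show ?thesis using wu by linarith
  qed
  have "w1 x = 0" by (rule DERIV_local_max[OF d1, of 1]) (auto intro: mx')
  then have "0 < w2 x" using ode[of x] \<kappa> u wu by (simp add: mult_pos_pos)
  \<comment> \<open>\<open>w1\<close> vanishes at \<open>x\<close> and increases there, so it is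
    positive just to the right and \<open>w\<close> rises above its maximum.\<close>
  then obtain d where d: "0 < d" and pos: "\<And>h. 0 < h \<Longrightarrow> h < d \<Longrightarrow> w1 x < w1 (x + h)"
    using DERIV_pos_inc_right[OF d2] by blast
  have "w x < w (x + d / 2)"
  proof (rule DERIV_pos_imp_increasing_open[where f=w])
    show "\<exists>l. DERIV w y :> l \<and> 0 < l" if y: "x < y" "y < x + d / 2" for y
    proof -
    have "0 < w1 y" using pos[of "y - x"] d y \<open>w1 x = 0\<close> by simp
    then show ?thesis using d1 by blast
    qed
    show "x < x + d / 2" using d by simp
    show "continuous_on {x..x + d / 2} w" by (rule cont)
  qed
  then show False using mx'[of "x + d / 2"] by linarith
qed

text \<open>The coefficient \<open>\<beta>\<close> is arbitrary because the first derivative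
  vanishes at an extremum; the unbounded coefficient \<open>2 + \<nu> + exp u\<close> is therefore
  admissible. The equation is linear, so the one-sided bound applies to \<open>w\<close> and to
  \<open>- w\<close>.\<close>

lemma maximum_principle:
  fixes w w1 w2 \<beta> :: "real \<Rightarrow> real"
  assumes d1: "\<And>u. (w has_real_derivative w1 u) (at u)" and d2: "\<And>u. (w1 has_real_derivative w2 u) (at u)"
    and ode: "\<And>u. w2 u + \<beta> u * w1 u = \<kappa> * w u" and \<kappa>: "0 < \<kappa>"
    and top: "(w \<longlongrightarrow> 0) at_top" and bot: "(w \<longlongrightarrow> 0) at_bot"
  shows "w u = 0"
proof -
  have "w u \<le> 0" by (rule maximum_principle_le[OF d1 d2 ode \<kappa> top bot])
  moreover have "- w u \<le> 0"
  proof (rule maximum_principle_le[of "\<lambda>u. - w u" "\<lambda>u. - w1 u" "\<lambda>u. - w2 u" \<beta> \<kappa>])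
    show "((\<lambda>u. - w u) has_real_derivative - w1 u) (at u)" "((\<lambda>u. - w1 u) has_real_derivative - w2 u) (at u)" for u
      by (intro DERIV_minus d1 d2)+
    show "- w2 u + \<beta> u * - w1 u = \<kappa> * - w u" for u using ode[of u] by simp
    show "((\<lambda>u. - w u) \<longlongrightarrow> 0) at_top" "((\<lambda>u. - w u) \<longlongrightarrow> 0) at_bot"
      using tendsto_minus[OF top] tendsto_minus[OF bot] by simp_all
  qed (rule \<kappa>)
  ultimately show ?thesis by simp
qed

context std_brownian_motion
begin

text \<open>With \<open>a = exp (- u) / 2\<close> the scaled strike \<open>a * exp (- 2 * y)\<close>
  belongs to the point \<open>u + 2 * y\<close>. The identity of \<open>yor_call_laplace_eq\<close>
  thus becomes a convolution over \<open>v = u + 2 * y\<close>, and the unknown tail transform is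
  eliminated because it is minus the strike derivative of the same function.\<close>

theorem yor_call_laplace_ode:
  assumes z: "0 < z" "2 * (\<nu> + 1) < z"
  defines "g \<equiv> \<lambda>u. enn2real (yor_call_laplace \<nu> z (exp (- u) / 2))"
  shows "\<exists>g1 g2. (\<forall>u. (g has_real_derivative g1 u) (at u)) \<and> (\<forall>u. (g1 has_real_derivative g2 u) (at u)) \<and>
    (\<forall>u. g2 u + (2 + \<nu> + exp u) * g1 u = (z / 2 - \<nu> - 1) * g u)"
    and "(g \<longlongrightarrow> 1 / (z * (z - 2 * (\<nu> + 1)))) at_top" and "(g \<longlongrightarrow> 0) at_bot"
proof -
  define H where "H q = enn2real (yor_tail_laplace \<nu> z q)" for q
  define f where "f a = (LBINT q:{a<..}. H q)" for a
  define G where "G u = H (exp (- u) / 2)" for u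
  define m where "m = sqrt (2 * z + \<nu>\<^sup>2)"
  \<comment> \<open>In terms of \<open>y = (v - u) / 2\<close>, the weight
    \<open>exp (\<nu> * y - m * \<bar>y\<bar>) * exp (2 * y)\<close> is
    \<open>exp (p * (v - u))\<close> for \<open>v \<le> u\<close> and
    \<open>exp (- b * (v - u))\<close> beyond. The prefactor \<open>1 / (2 * m)\<close> in
    \<open>conv\<close> is \<open>1 / m\<close> from the kernel times \<open>1 / 2\<close> from the
    substitution.\<close>
  define p where "p = 1 + \<nu> / 2 + m / 2"
  define b where "b = m / 2 - 1 - \<nu> / 2"
  have m2: "m\<^sup>2 = 2 * z + \<nu>\<^sup>2" using z by (simp add: m_def)
  have m0: "0 < m" using z by (simp add: m_def add_pos_nonneg)
  \<comment> \<open>After squaring this is exactly \<open>2 * (\<nu> + 1) < z\<close>; it makes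
    \<open>p\<close> and \<open>b\<close> positive.\<close>
  have "\<bar>\<nu> + 2\<bar> < m"
    unfolding m_def by (rule real_less_rsqrt) (use z in \<open>simp add: power2_eq_square algebra_simps\<close>)
  then have p0: "0 < p" and b0: "0 < b" by (auto simp: p_def b_def field_simps)
  have tail: "yor_tail_laplace \<nu> z q = ennreal (H q)" for q
    using yor_tail_laplace_le[OF z(1), of \<nu> q] by (simp add: H_def top.not_eq_extremum order_le_less_trans[OF _ ennreal_less_top])
  have H0: "0 \<le> H q" for q by (simp add: H_def)
  have H1: "H q \<le> 1 / z" for q
    using yor_tail_laplace_le[OF z(1), of \<nu> q] z by (simp add: tail ennreal_le_iff)
  have Hc: "continuous_on S H" for S
    using continuous_yor_tail_laplace[OF z(1)] unfolding H_def by (blast intro: continuous_at_imp_continuous_on)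
  have [measurable]: "H \<in> borel_measurable borel" by (intro borel_measurable_continuous_onI Hc)
  have call: "yor_call_laplace \<nu> z a = (\<integral>\<^sup>+q. ennreal (indicator {a<..} q *\<^sub>R H q) \<partial>lborel)" for a
    unfolding yor_call_laplace_eq_tail tail by (intro nn_integral_cong) (auto simp: indicator_def)
  have int0: "set_integrable lborel {0<..} H"
    unfolding set_integrable_def
  proof (rule integrableI_nonneg)
    show "(\<integral>\<^sup>+q. ennreal (indicator {0<..} q *\<^sub>R H q) \<partial>lborel) < \<infinity>"
      unfolding call[symmetric] using yor_call_laplace_0[OF z] by simp
  qed (use H0 in auto)
  \<comment> \<open>Negative \<open>a\<close> is included, so that \<open>f\<close> is
    differentiable, hence continuous, at strike 0; the limit of \<open>g\<close> at
    \<open>at_top\<close> is then the explicit value \<open>f 0\<close>.\<close>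
  have int: "set_integrable lborel {a<..} H" for a
  proof -
    have "set_integrable lborel {min a 0..0} H" by (intro borel_integrable_atLeastAtMost' Hc)
    then have "set_integrable lborel ({min a 0..0} \<union> {0<..}) H" using int0 by (intro set_integrable_Un) auto
    then show ?thesis by (rule set_integrable_subset) auto
  qed
  have fcall: "enn2real (yor_call_laplace \<nu> z a) = f a" for a
    unfolding call f_def set_lebesgue_integral_def using H0 by (intro integral_eq_nn_integral[symmetric]) auto
  have df: "(f has_real_derivative - H a) (at a)" for a
    unfolding f_def by (intro DERIV_set_integral_greaterThan int Hc)
  have gf: "g u = f (exp (- u) / 2)" for u by (simp add: g_def fcall)
  have dg: "(g has_real_derivative G u * exp (- u) / 2) (at u)" for u
  proof -
    have "((\<lambda>u. f (exp (- u) / 2)) has_real_derivative - H (exp (- u) / 2) * (- exp (- u) / 2)) (at u)"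
      by (intro DERIV_chain2[OF df]) (auto intro!: derivative_eq_intros)
    then show ?thesis by (simp add: gf[abs_def] G_def)
  qed
  have conv: "g u = 1 / (2 * m) * (\<integral>v. (if v \<le> u then exp (p * (v - u)) else exp (- b * (v - u))) * G v \<partial>lborel)" for u
  proof -
    let ?k = "\<lambda>y. \<integral>\<^sup>+r. indicator {0<..} r * (ennreal (exp (- (z * r))) * ennreal (normal_density 0 (sqrt r) (y - \<nu> * r))) \<partial>lborel"
    let ?r = "\<lambda>y. ennreal (exp (2 * y)) * yor_tail_laplace \<nu> z (exp (- u) * exp (- (2 * y)) / 2)"
    let ?\<psi> = "\<lambda>v. (if v \<le> u then exp (p * (v - u)) else exp (- b * (v - u))) * G v"
    have [measurable]: "G \<in> borel_measurable borel" unfolding G_def[abs_def] by measurable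
    have G0: "0 \<le> G v" for v by (simp add: G_def H0)
    have "yor_call_laplace \<nu> z (exp (- u) / 2) = (\<integral>\<^sup>+y. ennreal (1 / m) * ennreal (?\<psi> (u + 2 * y)) \<partial>lborel)"
      unfolding yor_call_laplace_eq[of "exp (- u) / 2", simplified]
    proof (rule nn_integral_cong_AE)
      have "?k y *
          ?r y = ennreal (1 / m) * ennreal (?\<psi> (u + 2 * y))"
        if y: "y \<noteq> 0" for y
      proof -
        have k: "?k y = ennreal (exp (\<nu> * y - m * \<bar>y\<bar>) / m)"
          using heat_kernel_laplace[of z \<nu> y] y z by (simp add: m_def add_pos_nonneg)
        have G: "yor_tail_laplace \<nu> z (exp (- u) * exp (- (2 * y)) / 2) = ennreal (G (u + 2 * y))"
          by (simp add: tail G_def exp_add[symmetric])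
        have e: "exp (\<nu> * y - m * \<bar>y\<bar>) * exp (2 * y) = (if u + 2 * y \<le> u then exp (p * (u + 2 * y - u)) else exp (- b * (u + 2 * y - u)))"
          by (auto simp: exp_add[symmetric] p_def b_def algebra_simps)
        have "ennreal (exp (\<nu> * y - m * \<bar>y\<bar>) / m) * (ennreal (exp (2 * y)) * ennreal (G (u + 2 * y))) =
            ennreal (1 / m * (exp (\<nu> * y - m * \<bar>y\<bar>) * exp (2 * y) * G (u + 2 * y)))"
          using m0 G0 by (simp add: ennreal_mult[symmetric] mult_ac)
        also have "\<dots> = ennreal (1 / m) * ennreal (exp (\<nu> * y - m * \<bar>y\<bar>) * exp (2 * y) * G (u + 2 * y))"
          using m0 G0 by (intro ennreal_mult) auto
        finally show ?thesis unfolding k G e .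
      qed
      then show "AE y in lborel. ?k y *
          ?r y = ennreal (1 / m) * ennreal (?\<psi> (u + 2 * y))"
        using AE_lborel_singleton[of 0] by (auto elim: eventually_mono)
    qed
    also have "\<dots> = ennreal (1 / m) * (\<integral>\<^sup>+y. ennreal (?\<psi> (u + 2 * y)) \<partial>lborel)"
      by (intro nn_integral_cmult) measurable
    also have "(\<integral>\<^sup>+y. ennreal (?\<psi> (u + 2 * y)) \<partial>lborel) = ennreal (1 / 2) * (\<integral>\<^sup>+v. ennreal (?\<psi> v) \<partial>lborel)"
    proof -
      have "(\<integral>\<^sup>+v. ennreal (?\<psi> v) \<partial>lborel) = ennreal 2 * (\<integral>\<^sup>+y. ennreal (?\<psi> (u + 2 * y)) \<partial>lborel)"
        by (subst nn_integral_real_affine[where c=2 and t=u]) auto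
      moreover have "ennreal (1 / 2) * (ennreal 2 * X) = X" for X
        unfolding mult.assoc[symmetric] ennreal_mult'[symmetric, OF zero_le_numeral]
        by (subst ennreal_mult'[symmetric]) auto
      ultimately show ?thesis by simp
    qed
    finally have "g u = enn2real (ennreal (1 / m)) * (enn2real (ennreal (1 / 2)) * enn2real (\<integral>\<^sup>+v. ennreal (?\<psi> v) \<partial>lborel))"
      unfolding g_def by (simp only: enn2real_mult)
    also have "enn2real (ennreal (1 / m)) = 1 / m" by (rule enn2real_ennreal) (use m0 in simp)
    also have "enn2real (ennreal (1 / 2)) = 1 / 2" by (rule enn2real_ennreal) simp
    also have "enn2real (\<integral>\<^sup>+v. ennreal (?\<psi> v) \<partial>lborel) = (\<integral>v. ?\<psi> v \<partial>lborel)"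
      using G0 by (intro integral_eq_nn_integral[symmetric]) auto
    finally show ?thesis by simp
  qed
  have Gc: "continuous_on UNIV G"
    unfolding G_def by (intro continuous_on_compose2[OF Hc[of UNIV]] continuous_intros) auto
  have Gb: "\<bar>G v\<bar> \<le> 1 / z" for v using H0 H1 by (simp add: G_def)
  obtain g1 g2 where d1: "\<forall>u. (g has_real_derivative g1 u) (at u)" and d2: "\<forall>u. (g1 has_real_derivative g2 u) (at u)"
    and ode: "\<forall>u. g2 u + (p - b) * g1 u - p * b * g u = - (1 / (2 * m)) * (p + b) * G u"
    using exponential_convolution_ode[OF p0 b0 Gc Gb conv] by blast
  have "g2 u + (2 + \<nu> + exp u) * g1 u = (z / 2 - \<nu> - 1) * g u" for u
  proof -
    \<comment> \<open>The chain rule through the strike gives a second formula for the derivative.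
      It turns the source term into \<open>- exp u * g1 u\<close>, since \<open>p + b = m\<close>
      reduces its constant to \<open>- 1 / 2\<close>.\<close>
    have "g1 u = G u * exp (- u) / 2" by (rule DERIV_unique[OF d1[THEN spec] dg])
    then have G: "G u = 2 * exp u * g1 u" by (simp add: exp_minus field_simps)
    have K: "- (1 / (2 * m)) * (p + b) = - 1 / 2" using m0 by (simp add: p_def b_def)
    have pb: "p - b = 2 + \<nu>" "p * b = z / 2 - \<nu> - 1"
      using m2 by (simp_all add: p_def b_def field_simps power2_eq_square)
    show ?thesis using ode[THEN spec, of u] unfolding K pb G by (simp add: algebra_simps)
  qed
  then show "\<exists>g1 g2. (\<forall>u. (g has_real_derivative g1 u) (at u)) \<and> (\<forall>u. (g1 has_real_derivative g2 u) (at u)) \<and>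
    (\<forall>u. g2 u + (2 + \<nu> + exp u) * g1 u = (z / 2 - \<nu> - 1) * g u)"
    using d1 d2 by (intro exI[of _ g1] exI[of _ g2] conjI allI) auto
  show "(g \<longlongrightarrow> 1 / (z * (z - 2 * (\<nu> + 1)))) at_top"
  proof -
    have "f 0 = 1 / (z * (z - 2 * (\<nu> + 1)))"
      using yor_call_laplace_0[OF z] z by (simp add: fcall[symmetric])
    moreover have "isCont f 0" using df by (rule DERIV_isCont)
    moreover have "((\<lambda>u :: real. exp (- u) / 2) \<longlongrightarrow> 0) at_top" by real_asymp
    ultimately show ?thesis unfolding gf[abs_def] using isCont_tendsto_compose by fastforce
  qed
  show "(g \<longlongrightarrow> 0) at_bot"
  proof -
    have "(f \<longlongrightarrow> (\<integral>q. (0 :: real) \<partial>(lborel :: real measure))) at_top"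
      unfolding f_def set_lebesgue_integral_def
    proof (rule integral_dominated_convergence_at_top)
      show "integrable lborel (\<lambda>q. indicator {0<..} q *\<^sub>R H q)" using int0 by (simp add: set_integrable_def)
      show "\<forall>\<^sub>F a in at_top. AE q in lborel. norm (indicator {a<..} q *\<^sub>R H q) \<le> indicator {0<..} q *\<^sub>R H q"
        using eventually_ge_at_top[of 0] by eventually_elim (auto simp: indicator_def H0)
      have "((\<lambda>a. indicator {a<..} q *\<^sub>R H q) \<longlongrightarrow> 0) at_top" for q
        by (rule tendsto_eventually) (use eventually_ge_at_top[of q] in \<open>eventually_elim, auto simp: indicator_def\<close>)
      then show "AE q in lborel. ((\<lambda>a. indicator {a<..} q *\<^sub>R H q) \<longlongrightarrow> 0) at_top" by simp
    qed auto
    then have "(f \<longlongrightarrow> 0) at_top" by simp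
    moreover have "filterlim (\<lambda>u :: real. exp (- u) / 2) at_top at_bot" by real_asymp
    ultimately show ?thesis unfolding gf[abs_def] by (rule filterlim_compose)
  qed
qed

end

section \<open>The Kummer function\<close>

text \<open>Taylor coefficients of the confluent hypergeometric function 1F1(c; d; t). The type is
  generic because the differential equation is used over the reals and the continuation in
  \<open>z\<close> over the complex numbers.\<close>

definition kummer_coeff :: "'a :: {real_normed_field, banach} \<Rightarrow> 'a \<Rightarrow> nat \<Rightarrow> 'a" where
  "kummer_coeff c d n = pochhammer c n / (fact n * pochhammer d n)"

definition kummer :: "'a :: {real_normed_field, banach} \<Rightarrow> 'a \<Rightarrow> 'a \<Rightarrow> 'a" where
  "kummer c d t = (\<Sum>n. kummer_coeff c d n * t ^ n)"

lemma kummer_coeff_Suc: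
  "d + of_nat n \<noteq> 0 \<Longrightarrow> of_nat (Suc n) * (d + of_nat n) * kummer_coeff c d (Suc n) = (c + of_nat n) * kummer_coeff c d n"
proof -
  assume nz: "d + of_nat n \<noteq> 0"
  have "kummer_coeff c d (Suc n) = ((c + of_nat n) * kummer_coeff c d n) / (of_nat (Suc n) * (d + of_nat n))"
    by (simp add: kummer_coeff_def pochhammer_Suc fact_Suc mult_ac del: of_nat_Suc)
  then show ?thesis using nz by (simp del: of_nat_Suc)
qed

text \<open>The hypothesis on \<open>d\<close> gives
  \<open>norm (c + of_nat n) \<le> R * norm (d + of_nat n)\<close>, so consecutive coefficients have
  ratio at most \<open>R / (n + 1)\<close>. The bound depends on \<open>c\<close> only through
  \<open>R\<close>, as locally uniform convergence will require.\<close>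

lemma norm_kummer_coeff_le:
  assumes c: "norm c \<le> R" "1 \<le> R" and d: "\<And>j :: nat. 1 + real j \<le> norm (d + of_nat j)"
  shows "norm (kummer_coeff c d n) \<le> R ^ n / fact n"
proof (induction n)
  case 0
  show ?case by (simp add: kummer_coeff_def)
next
  case (Suc n)
  have pos: "0 < norm (d + of_nat n)" using d[of n] by linarith
  then have nz: "d + of_nat n \<noteq> 0" by auto
  have "norm (c + of_nat n) \<le> R + n" using c norm_triangle_ineq[of c "of_nat n"] by simp
  also have "\<dots> \<le> R * (1 + real n)" using c by (simp add: algebra_simps mult_le_cancel_right1)
  also have "\<dots> \<le> R * norm (d + of_nat n)" using c d[of n] by (intro mult_left_mono) auto
  finally have le: "norm (c + of_nat n) \<le> R * norm (d + of_nat n)" .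
  have "real (Suc n) * norm (d + of_nat n) * norm (kummer_coeff c d (Suc n)) = norm (c + of_nat n) * norm (kummer_coeff c d n)"
    using arg_cong[OF kummer_coeff_Suc[OF nz, of c], of norm] by (simp add: norm_mult del: of_nat_Suc)
  also have "\<dots> \<le> (R * norm (d + of_nat n)) * (R ^ n / fact n)"
    using le Suc.IH c by (intro mult_mono) auto
  finally have "norm (d + of_nat n) * (real (Suc n) * norm (kummer_coeff c d (Suc n))) \<le> norm (d + of_nat n) * (R * (R ^ n / fact n))"
    by (simp add: mult_ac)
  then have "real (Suc n) * norm (kummer_coeff c d (Suc n)) \<le> R * (R ^ n / fact n)"
    using pos by (rule mult_left_le_imp_le)
  then show ?case by (simp add: field_simps fact_Suc del: of_nat_Suc)
qed

lemma summable_norm_kummer: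
  assumes d: "\<And>j :: nat. 1 + real j \<le> norm (d + of_nat j)"
  shows "summable (\<lambda>n. norm (kummer_coeff c d n * t ^ n))"
proof (rule summable_comparison_test')
  define R where "R = max 1 (norm c)"
  show "summable (\<lambda>n. inverse (fact n) * (R * norm t) ^ n)" by (rule summable_exp)
  fix n
  have "norm (kummer_coeff c d n) * norm t ^ n \<le> R ^ n / fact n * norm t ^ n"
    using d by (intro mult_right_mono norm_kummer_coeff_le) (auto simp: R_def)
  then show "norm (norm (kummer_coeff c d n * t ^ n)) \<le> inverse (fact n) * (R * norm t) ^ n"
    by (simp add: norm_mult norm_power power_mult_distrib field_simps)
qed

lemma kummer_derivatives:
  fixes c d :: real
  assumes d: "1 \<le> d"
  shows "\<exists>k1 k2. (\<forall>t. (kummer c d has_real_derivative k1 t) (at t)) \<and> (\<forall>t. (k1 has_real_derivative k2 t) (at t)) \<and>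
    (\<forall>t. t * k2 t + (d - t) * k1 t = c * kummer c d t)"
proof -
  let ?k = "kummer_coeff c d"
  have s0: "summable (\<lambda>n. ?k n * t ^ n)" for t
    using d by (intro summable_norm_cancel[OF summable_norm_kummer]) auto
  have s1: "summable (\<lambda>n. diffs ?k n * t ^ n)" for t by (rule termdiff_converges_all[OF s0])
  have s2: "summable (\<lambda>n. diffs (diffs ?k) n * t ^ n)" for t by (rule termdiff_converges_all[OF s1])
  define k1 where "k1 t = (\<Sum>n. diffs ?k n * t ^ n)" for t
  define k2 where "k2 t = (\<Sum>n. diffs (diffs ?k) n * t ^ n)" for t
  \<comment> \<open>Multiplication by \<open>t\<close> undoes the index shift of
    \<open>diffs\<close>, and all terms of the equation become series in the same power of
    \<open>t\<close>. The equation then reduces to the recurrence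
    \<open>kummer_coeff_Suc\<close>.\<close>
  have shift: "(\<lambda>n. of_nat n * h n * t ^ n) sums (t * (\<Sum>n. diffs h n * t ^ n))"
    if "summable (\<lambda>n. diffs h n * t ^ n)" for h :: "nat \<Rightarrow> real" and t
  proof -
    have "(\<lambda>n. t * (diffs h n * t ^ n)) sums (t * (\<Sum>n. diffs h n * t ^ n))"
      by (intro sums_mult summable_sums that)
    then have "(\<lambda>n. of_nat (Suc n) * h (Suc n) * t ^ Suc n) sums (t * (\<Sum>n. diffs h n * t ^ n))"
      by (simp add: diffs_def mult_ac)
    then show ?thesis by (subst (asm) sums_Suc_iff) simp
  qed
  have "(kummer c d has_real_derivative k1 t) (at t)" for t
    unfolding kummer_def[abs_def] k1_def by (rule termdiffs_strong_converges_everywhere[OF s0])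
  moreover have "(k1 has_real_derivative k2 t) (at t)" for t
    unfolding k1_def[abs_def] k2_def by (rule termdiffs_strong_converges_everywhere[OF s1])
  moreover have "t * k2 t + (d - t) * k1 t = c * kummer c d t" for t
  proof -
    have "(\<lambda>n. of_nat n * diffs ?k n * t ^ n + d * (diffs ?k n * t ^ n) - of_nat n * ?k n * t ^ n - c * (?k n * t ^ n)) sums
       (t * k2 t + d * k1 t - t * k1 t - c * kummer c d t)"
      unfolding k1_def k2_def kummer_def
      by (intro sums_diff sums_add sums_mult shift s1 s2 summable_sums s0)
    moreover have "of_nat n * diffs ?k n * t ^ n + d * (diffs ?k n * t ^ n) - of_nat n * ?k n * t ^ n - c * (?k n * t ^ n) = 0" for n
    proof -
      have "real (Suc n) * (d + real n) * ?k (Suc n) = (c + real n) * ?k n"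
        using d by (intro kummer_coeff_Suc) auto
      then have "of_nat n * diffs ?k n + d * diffs ?k n - of_nat n * ?k n - c * ?k n = 0"
        by (simp add: diffs_def algebra_simps del: of_nat_Suc)
      then have "(of_nat n * diffs ?k n + d * diffs ?k n - of_nat n * ?k n - c * ?k n) * t ^ n = 0" by simp
      then show ?thesis by (simp add: algebra_simps)
    qed
    ultimately have "t * k2 t + d * k1 t - t * k1 t - c * kummer c d t = 0"
      by (simp add: sums_iff)
    then show ?thesis by (simp add: algebra_simps)
  qed
  ultimately show ?thesis by (intro exI[of _ k1] exI[of _ k2] conjI allI)
qed

text \<open>Conjugating Kummer's equation by \<open>t powr b * exp (- t)\<close> with
  \<open>t = exp u\<close> yields the equation of the call transform precisely when the second
  parameter is \<open>b + c\<close> and \<open>c = b + \<nu> + 3\<close>. The exponent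
  \<open>b\<close> is a characteristic root of the equation that remains as \<open>u\<close> tends
  to minus infinity, where \<open>exp u\<close> is negligible.\<close>

lemma kummer_log_ode:
  fixes b c \<nu> :: real
  assumes d: "1 \<le> b + c" and c: "c = b + \<nu> + 3"
  defines "D \<equiv> \<lambda>u. exp (b * u - exp u) * kummer c (b + c) (exp u)"
  shows "\<exists>D1 D2. (\<forall>u. (D has_real_derivative D1 u) (at u)) \<and> (\<forall>u. (D1 has_real_derivative D2 u) (at u)) \<and>
    (\<forall>u. D2 u + (2 + \<nu> + exp u) * D1 u = b * (b + 2 + \<nu>) * D u)"
proof -
  obtain k1 k2 where k': "\<forall>t. (kummer c (b + c) has_real_derivative k1 t) (at t)" "\<forall>t. (k1 has_real_derivative k2 t) (at t)"
    and ode: "\<forall>t. t * k2 t + (b + c - t) * k1 t = c * kummer c (b + c) t"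
    using kummer_derivatives[where c=c, OF d] by blast
  note k = k'[THEN spec]
  define E where "E u = exp (b * u - exp u)" for u
  define D1 where "D1 u = E u * (exp u * k1 (exp u) + (b - exp u) * kummer c (b + c) (exp u))" for u
  define D2 where "D2 u = E u * ((b - exp u) * (exp u * k1 (exp u) + (b - exp u) * kummer c (b + c) (exp u)) +
     (exp u * k1 (exp u) + exp u * (exp u * k2 (exp u)) + (- exp u * kummer c (b + c) (exp u) + (b - exp u) * (exp u * k1 (exp u)))))" for u
  have dE: "(E has_real_derivative E u * (b - exp u)) (at u)" for u
    unfolding E_def by (auto intro!: derivative_eq_intros simp: algebra_simps)
  have dk: "((\<lambda>u. kummer c (b + c) (exp u)) has_real_derivative k1 (exp u) * exp u) (at u)" for u
    by (rule DERIV_chain2[OF k(1)]) (auto intro!: derivative_eq_intros)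
  have dk1: "((\<lambda>u. k1 (exp u)) has_real_derivative k2 (exp u) * exp u) (at u)" for u
    by (rule DERIV_chain2[OF k(2)]) (auto intro!: derivative_eq_intros)
  have "(D has_real_derivative D1 u) (at u)" for u
    unfolding D_def E_def[symmetric] D1_def
    by (rule DERIV_cong[OF DERIV_mult[OF dE dk]]) (simp add: algebra_simps)
  moreover have "(D1 has_real_derivative D2 u) (at u)" for u
  proof -
    have "((\<lambda>u. exp u * k1 (exp u) + (b - exp u) * kummer c (b + c) (exp u)) has_real_derivative
      (exp u * k1 (exp u) + (k2 (exp u) * exp u) * exp u) + ((- exp u) * kummer c (b + c) (exp u) + (k1 (exp u) * exp u) * (b - exp u))) (at u)"
      by (intro DERIV_add DERIV_mult dk dk1) (auto intro!: derivative_eq_intros)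
    from DERIV_mult[OF dE this] show ?thesis
      unfolding D1_def[abs_def] D2_def by (rule DERIV_cong) (simp add: algebra_simps)
  qed
  moreover have "D2 u + (2 + \<nu> + exp u) * D1 u = b * (b + 2 + \<nu>) * D u" for u
  proof -
    define t where "t = exp u"
    \<comment> \<open>Substituting this for \<open>t * k2 t\<close> removes \<open>k1\<close>
      altogether, because \<open>b + c = 2 * b + \<nu> + 3\<close>.\<close>
    have o: "t * k2 t = c * kummer c (b + c) t - (b + c - t) * k1 t" using ode[THEN spec, of t] by linarith
    have "D2 u + (2 + \<nu> + exp u) * D1 u = E u * (t * (t * k2 t) + (2 * b + 3 + \<nu> - t) * (t * k1 t) +
        ((b - t)\<^sup>2 - t + (2 + \<nu> + t) * (b - t)) * kummer c (b + c) t)"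
      unfolding D1_def D2_def t_def[symmetric] by (simp add: algebra_simps power2_eq_square)
    also have "\<dots> = E u * (b * (b + 2 + \<nu>) * kummer c (b + c) t)"
      unfolding o c by (simp add: algebra_simps power2_eq_square)
    finally show ?thesis by (simp add: D_def E_def t_def)
  qed
  ultimately show ?thesis by (intro exI[of _ D1] exI[of _ D2] conjI allI)
qed

lemma kummer_log_at_bot:
  fixes b c d :: real
  assumes b: "0 < b" and d: "1 \<le> d"
  shows "((\<lambda>u. exp (b * u - exp u) * kummer c d (exp u)) \<longlongrightarrow> 0) at_bot"
proof -
  have "isCont (kummer c d) 0" using kummer_derivatives[where c=c, OF d] DERIV_isCont by blast
  moreover have "((\<lambda>u :: real. exp u) \<longlongrightarrow> 0) at_bot" by (rule exp_at_bot)
  ultimately have "((\<lambda>u. kummer c d (exp u)) \<longlongrightarrow> kummer c d 0) at_bot" by (rule isCont_tendsto_compose)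
  moreover have "((\<lambda>u. exp (b * u - exp u)) \<longlongrightarrow> 0) at_bot" using b by real_asymp
  ultimately have "((\<lambda>u. exp (b * u - exp u) * kummer c d (exp u)) \<longlongrightarrow> 0 * kummer c d 0) at_bot"
    by (intro tendsto_mult)
  then show ?thesis by simp
qed

lemma kummer_coeff_Beta:
  fixes b c :: real
  assumes "0 < b" "0 < c"
  shows "Beta (c + real n) b = Beta c b * (fact n * kummer_coeff c (b + c) n)"
proof -
  have "c \<notin> \<int>\<^sub>\<le>\<^sub>0" "b + c \<notin> \<int>\<^sub>\<le>\<^sub>0" using assms by (auto elim!: nonpos_Ints_cases)
  moreover have "Gamma c \<noteq> 0" "Gamma (b + c) \<noteq> 0" "Gamma (b + c + real n) \<noteq> 0"
    using assms by (intro less_imp_neq[symmetric] Gamma_real_pos; simp)+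
  ultimately show ?thesis
    by (simp add: Beta_def kummer_coeff_def pochhammer_Gamma field_simps)
qed

lemma nn_integral_Beta_real:
  assumes "0 < a" "0 < b"
  shows "(\<integral>\<^sup>+s. ennreal (s powr (a - 1) * (1 - s) powr (b - 1)) * indicator {0..1} s \<partial>lborel) = ennreal (Beta a b)"
proof -
  have "(\<integral>\<^sup>+s. ennreal (s powr (a - 1) * (1 - s) powr (b - 1)) * indicator {0..1} s \<partial>lborel) =
      (\<integral>\<^sup>+s. ennreal (indicator {0..1} s * (s powr (a - 1) * (1 - s) powr (b - 1))) \<partial>lborel)"
    by (intro nn_integral_cong) (auto simp: indicator_def)
  then show ?thesis
    using nn_integral_has_integral_lebesgue[OF _ has_integral_Beta_real[OF assms]] by simp
qed

text \<open>Euler's Beta integral, after substituting \<open>w = t * (1 - s)\<close>.\<close>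

lemma kummer_integral:
  fixes b c t :: real
  assumes b: "0 < b" and c: "0 < c" "1 \<le> b + c" and t: "0 < t"
  shows "ennreal (Beta c b * (exp (- t) * t powr b * kummer c (b + c) t)) =
    (\<integral>\<^sup>+w. ennreal (indicator {0..t} w * (w powr (b - 1) / exp w * (1 - w / t) powr (c - 1))) \<partial>lborel)"
proof -
  \<comment> \<open>The terms of \<open>exp (t * s)\<close> against the Beta weight: each integrates
    to one term of the Kummer series through \<open>kummer_coeff_Beta\<close>.\<close>
  let ?g = "\<lambda>(n :: nat) s. ennreal (t ^ n / fact n) * (ennreal (s powr (c + n - 1) * (1 - s) powr (b - 1)) * indicator {0..1} s)"
  let ?p = "\<lambda>s. exp (t * s) * (s powr (c - 1) * (1 - s) powr (b - 1))"
  let ?k = "kummer_coeff c (b + c)"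
  have k0: "0 \<le> ?k n" for n
    using b c by (auto simp: kummer_coeff_def pochhammer_nonneg intro!: divide_nonneg_nonneg mult_nonneg_nonneg)
  have B0: "0 < Beta c b" using b c by (simp add: Beta_def)
  have sm: "summable (\<lambda>n. ?k n * t ^ n)"
    using c by (intro summable_norm_cancel[OF summable_norm_kummer]) auto
  have "ennreal (Beta c b * kummer c (b + c) t) = (\<Sum>n. ennreal (Beta c b * (?k n * t ^ n)))"
    unfolding kummer_def using sm k0 B0 t by (subst suminf_mult[symmetric]) (auto intro!: suminf_ennreal2[symmetric])
  also have "\<dots> = (\<Sum>n. \<integral>\<^sup>+s. ?g n s \<partial>lborel)"
  proof (intro suminf_cong)
    fix n
    have "Beta c b * (?k n * t ^ n) = t ^ n / fact n * Beta (c + n) b"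
      unfolding kummer_coeff_Beta[OF b c(1)] by simp
    then show "ennreal (Beta c b * (?k n * t ^ n)) = (\<integral>\<^sup>+s. ?g n s \<partial>lborel)"
      using b c t nn_integral_Beta_real[of "c + n" b] by (subst nn_integral_cmult) (auto simp: ennreal_mult'[symmetric])
  qed
  also have "\<dots> = (\<integral>\<^sup>+s. (\<Sum>n. ?g n s) \<partial>lborel)"
    by (intro nn_integral_suminf[symmetric]) measurable
  also have "\<dots> = (\<integral>\<^sup>+s. ennreal (indicator {0..1} s * ?p s) \<partial>lborel)"
  proof (rule nn_integral_cong_AE)
    have "(\<Sum>n. ?g n s) =
        ennreal (indicator {0..1} s * ?p s)" if "s \<noteq> 0" for s
    proof (cases "0 < s \<and> s \<le> 1")
      case True
      then have s: "0 < s" "s \<le> 1" by auto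
      have "(\<lambda>n. (t * s) ^ n /\<^sub>R fact n) sums exp (t * s)" by (rule exp_converges)
      then have "(\<lambda>n. (t * s) ^ n /\<^sub>R fact n * (s powr (c - 1) * (1 - s) powr (b - 1))) sums ?p s"
        by (rule sums_mult2)
      moreover have "(t * s) ^ n /\<^sub>R fact n * (s powr (c - 1) * (1 - s) powr (b - 1)) = t ^ n / fact n * (s powr (c + n - 1) * (1 - s) powr (b - 1))" for n
      proof -
        have "s powr (c + n - 1) = s powr (c - 1) * s ^ n"
          using s by (simp add: powr_add[symmetric] powr_realpow[symmetric] algebra_simps)
        then show ?thesis by (simp add: power_mult_distrib field_simps)
      qed
      ultimately have "(\<lambda>n. t ^ n / fact n * (s powr (c + n - 1) * (1 - s) powr (b - 1))) sums ?p s"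
        by simp
      then have "(\<Sum>n. ennreal (t ^ n / fact n * (s powr (c + n - 1) * (1 - s) powr (b - 1)))) = ennreal (?p s)"
        using t by (intro suminf_ennreal_eq) auto
      moreover have "?g n s =
          ennreal (t ^ n / fact n * (s powr (c + n - 1) * (1 - s) powr (b - 1)))" for n
        using s t by (subst ennreal_mult') auto
      ultimately show ?thesis using s by simp
    next
      case False
      then show ?thesis using that by (auto simp: indicator_def)
    qed
    then show "AE s in lborel. (\<Sum>n. ?g n s) =
        ennreal (indicator {0..1} s * ?p s)"
      using AE_lborel_singleton[of 0] by (auto elim: eventually_mono)
  qed
  also have "\<dots> = ennreal (1 / t) * (\<integral>\<^sup>+w. ennreal (indicator {0..1} (1 + (- 1 / t) * w) * ?p (1 + (- 1 / t) * w)) \<partial>lborel)"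
    using t by (subst nn_integral_real_affine[where c="- 1 / t" and t=1]) auto
  finally have eq: "ennreal (Beta c b * kummer c (b + c) t) = \<dots>" .
  have "ennreal (Beta c b * (exp (- t) * t powr b * kummer c (b + c) t)) = ennreal (exp (- t) * t powr b) * ennreal (Beta c b * kummer c (b + c) t)"
    by (subst ennreal_mult'[symmetric]) (auto simp: mult_ac)
  also have "\<dots> = ennreal (exp (- t) * t powr b * (1 / t)) * (\<integral>\<^sup>+w. ennreal (indicator {0..1} (1 + (- 1 / t) * w) * ?p (1 + (- 1 / t) * w)) \<partial>lborel)"
  proof -
    have "ennreal (exp (- t) * t powr b * (1 / t)) = ennreal (exp (- t) * t powr b) * ennreal (1 / t)"
      using t by (intro ennreal_mult'') simp
    then show ?thesis unfolding eq by (simp only: mult.assoc)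
  qed
  also have "\<dots> = (\<integral>\<^sup>+w. ennreal (exp (- t) * t powr b * (1 / t)) * ennreal (indicator {0..1} (1 + (- 1 / t) * w) * ?p (1 + (- 1 / t) * w)) \<partial>lborel)"
    by (rule nn_integral_cmult[symmetric]) measurable
  also have "\<dots> = (\<integral>\<^sup>+w. ennreal (indicator {0..t} w * (w powr (b - 1) / exp w * (1 - w / t) powr (c - 1))) \<partial>lborel)"
  proof (intro nn_integral_cong)
    fix w
    have i: "indicator {0..1} (1 + (- 1 / t) * w) = (indicator {0..t} w :: real)"
      using t by (auto simp: indicator_def field_simps)
    show "ennreal (exp (- t) * t powr b * (1 / t)) * ennreal (indicator {0..1} (1 + (- 1 / t) * w) * ?p (1 + (- 1 / t) * w)) =
       ennreal (indicator {0..t} w * (w powr (b - 1) / exp w * (1 - w / t) powr (c - 1)))"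
    proof (cases "w \<in> {0..t}")
      case True
      have e: "exp (- t) * exp (t * (1 + (- 1 / t) * w)) = 1 / exp w"
        using t by (simp add: exp_add[symmetric] algebra_simps exp_minus[symmetric] inverse_eq_divide[symmetric])
      have w: "t powr b * (1 / t) * (1 - (1 + (- 1 / t) * w)) powr (b - 1) = w powr (b - 1)"
        using t True by (simp add: powr_divide powr_diff field_simps)
      have "exp (- t) * t powr b * (1 / t) * ?p (1 + (- 1 / t) * w) =
          (exp (- t) * exp (t * (1 + (- 1 / t) * w))) * (t powr b * (1 / t) * (1 - (1 + (- 1 / t) * w)) powr (b - 1)) * (1 - w / t) powr (c - 1)"
        by (simp add: mult_ac)
      also have "\<dots> = w powr (b - 1) / exp w * (1 - w / t) powr (c - 1)" unfolding e w by simp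
      finally show ?thesis using True t unfolding i by (subst ennreal_mult'[symmetric]) auto
    next
      case False
      then show ?thesis unfolding i by simp
    qed
  qed
  finally show ?thesis .
qed

text \<open>In \<open>kummer_integral\<close> the factor \<open>(1 - w / t) powr (c - 1)\<close> is
  at most 1 because \<open>1 \<le> c\<close>, and it tends to 1. Dominated convergence leaves the
  Gamma integral of \<open>b\<close>, and division by \<open>Beta c b\<close> gives the
  constant.\<close>

lemma kummer_asymptotics:
  fixes b c :: real
  assumes b: "0 < b" and c: "1 \<le> c"
  shows "((\<lambda>t. exp (- t) * t powr b * kummer c (b + c) t) \<longlongrightarrow> Gamma (b + c) / Gamma c) at_top"
proof -
  have B0: "0 < Beta c b" using b c by (simp add: Beta_def)
  let ?f = "\<lambda>t w. indicator {0..t} w * (w powr (b - 1) / exp w * (1 - w / t) powr (c - 1))"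
  have eq: "Beta c b * (exp (- t) * t powr b * kummer c (b + c) t) = (\<integral>w. ?f t w \<partial>lborel)" if t: "0 < t" for t
  proof -
    have "0 \<le> kummer c (b + c) t"
      unfolding kummer_def using b c t
      by (intro suminf_nonneg summable_norm_cancel[OF summable_norm_kummer])
         (auto simp: kummer_coeff_def pochhammer_nonneg intro!: divide_nonneg_nonneg mult_nonneg_nonneg)
    then have "Beta c b * (exp (- t) * t powr b * kummer c (b + c) t) = enn2real (ennreal (Beta c b * (exp (- t) * t powr b * kummer c (b + c) t)))"
      using B0 by simp
    also have "\<dots> = (\<integral>w. ?f t w \<partial>lborel)"
      using b c t by (subst kummer_integral) (auto intro!: integral_eq_nn_integral[symmetric])
    finally show ?thesis .
  qed
  have "((\<lambda>t. \<integral>w. ?f t w \<partial>lborel) \<longlongrightarrow> (\<integral>w. indicator {0..} w * (w powr (b - 1) / exp w) \<partial>lborel)) at_top"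
  proof (rule integral_dominated_convergence_at_top)
    have "(\<lambda>w. w powr (b - 1) / exp w) absolutely_integrable_on {0..}"
      using Gamma_integral_real[OF b] by (intro nonnegative_absolutely_integrable_1) auto
    then show "integrable lborel (\<lambda>w. indicator {0..} w * (w powr (b - 1) / exp w))"
      by (auto simp: set_integrable_def integrable_completion)
    show "\<forall>\<^sub>F t in at_top. AE w in lborel. norm (?f t w) \<le> indicator {0..} w * (w powr (b - 1) / exp w)"
      using eventually_gt_at_top[of 0]
    proof eventually_elim
      case (elim t)
      show ?case
      proof (rule AE_I2)
        fix w
        show "norm (?f t w) \<le> indicator {0..} w * (w powr (b - 1) / exp w)"
        proof (cases "w \<in> {0..t}")
          case True
          then have "(1 - w / t) powr (c - 1) \<le> 1" using elim c by (intro powr_le1) auto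
          then have "w powr (b - 1) / exp w * (1 - w / t) powr (c - 1) \<le> w powr (b - 1) / exp w * 1"
            by (intro mult_left_mono) auto
          then show ?thesis using True by simp
        qed auto
      qed
    qed
    have "((\<lambda>t. ?f t w) \<longlongrightarrow> indicator {0..} w * (w powr (b - 1) / exp w)) at_top" for w
    proof (cases "0 \<le> w")
      case True
      have "((\<lambda>t. w powr (b - 1) / exp w * (1 - w / t) powr (c - 1)) \<longlongrightarrow> w powr (b - 1) / exp w * (1 - 0) powr (c - 1)) at_top"
        by (intro tendsto_mult tendsto_powr tendsto_diff tendsto_const real_tendsto_divide_at_top filterlim_ident) auto
      moreover have "\<forall>\<^sub>F t in at_top. w powr (b - 1) / exp w * (1 - w / t) powr (c - 1) = ?f t w"
        using eventually_ge_at_top[of w] by eventually_elim (use True in auto)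
      ultimately have "((\<lambda>t. ?f t w) \<longlongrightarrow> w powr (b - 1) / exp w * (1 - 0) powr (c - 1)) at_top"
        by (rule Lim_transform_eventually)
      then show ?thesis using True by simp
    qed auto
    then show "AE w in lborel. ((\<lambda>t. ?f t w) \<longlongrightarrow> indicator {0..} w * (w powr (b - 1) / exp w)) at_top" by simp
  qed auto
  also have "(\<integral>w. indicator {0..} w * (w powr (b - 1) / exp w) \<partial>lborel) = enn2real (\<integral>\<^sup>+w. ennreal (indicator {0..} w * (w powr (b - 1) / exp w)) \<partial>lborel)"
    by (rule integral_eq_nn_integral) auto
  also have "\<dots> = Gamma b"
    using Gamma_conv_nn_integral_real[OF b] Gamma_real_pos[OF b] by (simp add: indicator_def)
  finally have "((\<lambda>t. (\<integral>w. ?f t w \<partial>lborel) / Beta c b) \<longlongrightarrow> Gamma b / Beta c b) at_top"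
    using B0 by (intro tendsto_divide) auto
  moreover have "\<forall>\<^sub>F t in at_top. (\<integral>w. ?f t w \<partial>lborel) / Beta c b = exp (- t) * t powr b * kummer c (b + c) t"
    using eventually_gt_at_top[of 0] by eventually_elim (subst eq[symmetric], use B0 in auto)
  ultimately have "((\<lambda>t. exp (- t) * t powr b * kummer c (b + c) t) \<longlongrightarrow> Gamma b / Beta c b) at_top"
    by (rule Lim_transform_eventually)
  moreover have "Gamma b / Beta c b = Gamma (b + c) / Gamma c"
    using less_imp_neq[OF Gamma_real_pos[OF b]] by (simp add: Beta_def add.commute)
  ultimately show ?thesis by simp
qed

section \<open>The Bessel integral as a Kummer function\<close>

lemma Gamma_integral_lborel:
  assumes s: "0 < Re s"
  shows "set_integrable lborel {0<..} (\<lambda>y. of_real (exp (- y)) * of_real y powr (s - 1))"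
    and "(LBINT y:{0<..}. of_real (exp (- y)) * of_real y powr (s - 1)) = Gamma s"
proof -
  let ?f = "\<lambda>y. of_real (exp (- y)) * of_real y powr (s - 1) :: complex"
  have eq: "of_real y powr (s - 1) / of_real (exp y) = ?f y" for y
    by (simp add: exp_minus exp_of_real[symmetric] divide_inverse)
  have m: "(\<lambda>y. indicator {0<..} y *\<^sub>R ?f y) \<in> borel_measurable borel"
    by (rule borel_measurable_continuous_on_indicator) (auto intro!: continuous_intros)
  have A: "set_integrable lebesgue {0<..} ?f"
    using absolutely_integrable_Gamma_integral'[OF s] by (simp add: eq)
  then show "set_integrable lborel {0<..} ?f"
    using m unfolding set_integrable_def by (simp add: integrable_completion)
  have "(LBINT y:{0<..}. ?f y) = (LINT y:{0<..}|lebesgue. ?f y)"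
    using m unfolding set_lebesgue_integral_def by (simp add: integral_completion)
  also have "\<dots> = integral {0<..} ?f" by (rule set_lebesgue_integral_eq_integral(2)[OF A])
  also have "\<dots> = Gamma s" using Gamma_integral_complex'[OF s] by (simp add: eq integral_unique)
  finally show "(LBINT y:{0<..}. ?f y) = Gamma s" .
qed

text \<open>The substitution \<open>x = sqrt (y / t)\<close> turns the Gaussian into
  \<open>exp (- y)\<close> and the moment into the Gamma integral at \<open>s / 2\<close>.\<close>

lemma gaussian_moment:
  fixes t :: real and s :: complex
  assumes t: "0 < t" and s: "0 < Re s"
  shows "set_integrable lborel {0<..} (\<lambda>x. of_real (exp (- (t * x\<^sup>2))) * of_real x powr (s - 1))" (is "set_integrable _ _ ?f")
    and "(LBINT x:{0<..}. of_real (exp (- (t * x\<^sup>2))) * of_real x powr (s - 1)) = of_real t powr (- s / 2) * Gamma (s / 2) / 2"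
proof -
  define g where "g y = sqrt (y / t)" for y
  define g' where "g' y = 1 / (2 * sqrt (t * y))" for y
  have e: "einterval 0 \<infinity> = {0<..}" by (auto simp: einterval_def zero_ereal_def)
  have dg: "(g has_real_derivative g' y) (at y)" if "0 < y" for y
    unfolding g_def g'_def using t that
    by (auto intro!: derivative_eq_intros simp: real_sqrt_divide real_sqrt_mult field_simps)
  have g0: "((ereal \<circ> g \<circ> real_of_ereal) \<longlongrightarrow> 0) (at_right 0)"
  proof -
    have "(g \<longlongrightarrow> 0) (at_right 0)" unfolding g_def using t by real_asymp
    then have "((ereal \<circ> g) \<longlongrightarrow> ereal 0) (at_right 0)" by (simp add: comp_def)
    then show ?thesis unfolding zero_ereal_def ereal_tendsto_simps1 .
  qed
  have gtop: "((ereal \<circ> g \<circ> real_of_ereal) \<longlongrightarrow> \<infinity>) (at_left \<infinity>)"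
  proof -
    have "filterlim g at_top at_top" unfolding g_def using t by real_asymp
    then have "((ereal \<circ> g) \<longlongrightarrow> \<infinity>) at_top" by (simp add: comp_def tendsto_PInfty_eq_at_top)
    then show ?thesis unfolding ereal_tendsto_simps1 .
  qed
  have cg': "isCont g' y" if "0 < y" for y
    unfolding g'_def using that t by (intro continuous_intros) auto
  have gpos: "0 < g y" if "0 < y" for y using that t by (simp add: g_def)
  have cf: "isCont ?f x" if "0 < x" for x
    using that by (intro continuous_intros) auto
  have fg: "g' y *\<^sub>R ?f (g y) = of_real t powr (- s / 2) / 2 * (of_real (exp (- y)) * of_real y powr (s / 2 - 1))" if y: "0 < y" for y
  proof -
    have ln: "ln (g y) = (ln y - ln t) / 2" using y t by (simp add: g_def ln_sqrt ln_div)
    have "g' y = exp (- (ln t + ln y) / 2) / 2"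
    proof -
      have l: "ln (sqrt (t * y)) = (ln t + ln y) / 2" using y t by (simp add: ln_sqrt ln_mult)
      have "exp (ln (sqrt (t * y))) = sqrt (t * y)" using y t by simp
      then have "sqrt (t * y) = exp ((ln t + ln y) / 2)" unfolding l by (rule sym)
      then show ?thesis unfolding g'_def minus_divide_left[symmetric] exp_minus by (simp add: inverse_eq_divide)
    qed
    then have "complex_of_real (g' y) = of_real (exp (- (ln t + ln y) / 2) / 2)" by (rule arg_cong)
    also have "\<dots> = exp (- (of_real (ln t) + of_real (ln y)) / 2) / 2"
      by (simp add: exp_of_real[symmetric])
    finally have g'e: "complex_of_real (g' y) = exp (- (of_real (ln t) + of_real (ln y)) / 2) / 2" .
    have "complex_of_real (g y) powr (s - 1) = exp ((s - 1) * of_real (ln (g y)))"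
      using gpos[OF y] by (simp add: powr_def Ln_of_real)
    then have 1: "complex_of_real (g y) powr (s - 1) = exp ((s - 1) * ((of_real (ln y) - of_real (ln t)) / 2))"
      by (simp add: ln)
    have 2: "complex_of_real t powr (- s / 2) = exp (- s / 2 * of_real (ln t))"
      using t by (simp add: powr_def Ln_of_real)
    have 3: "complex_of_real y powr (s / 2 - 1) = exp ((s / 2 - 1) * of_real (ln y))"
      using y by (simp add: powr_def Ln_of_real)
    have 4: "t * (g y)\<^sup>2 = y" using y t by (simp add: g_def)
    have "exp (- (of_real (ln t) + of_real (ln y)) / 2) * exp ((s - 1) * ((of_real (ln y) - of_real (ln t)) / 2)) =
        exp (- s / 2 * of_real (ln t)) * (exp ((s / 2 - 1) * of_real (ln y)) :: complex)"
      unfolding exp_add[symmetric] by (rule arg_cong[of _ _ exp]) (simp add: field_simps)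
    then show ?thesis unfolding scaleR_conv_of_real g'e 1 2 3 4 by (simp add: mult_ac)
  qed
  have s2: "0 < Re (s / 2)" using s by simp
  note G = Gamma_integral_lborel[OF s2]
  have i1: "set_integrable lborel (einterval 0 \<infinity>) (\<lambda>y. g' y *\<^sub>R ?f (g y))"
  proof -
    have "set_integrable lborel {0<..} (\<lambda>y. of_real t powr (- s / 2) / 2 * (of_real (exp (- y)) * of_real y powr (s / 2 - 1)))"
      using G(1) by (rule set_integrable_mult_right)
    then show ?thesis
      unfolding e by (rule set_integrable_cong[THEN iffD2, rotated 3]) (simp_all add: fg)
  qed
  have i: "set_integrable lborel (einterval 0 \<infinity>) (\<lambda>y. norm (?f (g y)) * g' y)"
  proof -
    have "set_integrable lborel {0<..} (\<lambda>y. norm (g' y *\<^sub>R ?f (g y)))"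
      using i1 unfolding e by (rule set_integrable_norm)
    moreover have "norm (g' y *\<^sub>R ?f (g y)) = norm (?f (g y)) * g' y" if "y \<in> {0<..}" for y
      using t that by (simp add: g'_def mult.commute)
    ultimately show ?thesis
      unfolding e using set_integrable_cong[of lborel lborel "{0<..}" "{0<..}" "\<lambda>y. norm (g' y *\<^sub>R ?f (g y))" "\<lambda>y. norm (?f (g y)) * g' y"] by blast
  qed
  \<comment> \<open>The substitution rule for complex integrands presupposes integrability on both
    sides. It is obtained first for the norm, where the rule for nonnegative functions yields
    integrability as a conclusion.\<close>
  have nn: "set_integrable lborel (einterval 0 \<infinity>) (\<lambda>x. norm (?f x))"
  proof (rule interval_integral_substitution_nonneg(1)[of 0 \<infinity> g g' "\<lambda>x. norm (?f x)" 0 \<infinity>])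
    show "0 \<le> g' y" if "0 \<le> ereal y" for y using t that by (simp add: g'_def zero_ereal_def)
    show "isCont (\<lambda>x. norm (?f x)) (g y)" if "0 < ereal y" for y
      using that by (intro continuous_norm cf gpos) (simp add: zero_ereal_def)
  qed (use dg cg' g0 gtop i in \<open>auto simp: zero_ereal_def\<close>)
  show int: "set_integrable lborel {0<..} ?f"
    unfolding set_integrable_def
  proof (rule integrable_norm_cancel)
    show "integrable lborel (\<lambda>x. norm (indicator {0<..} x *\<^sub>R ?f x))"
      using nn unfolding e set_integrable_def by (simp add: norm_mult)
    have "(\<lambda>x. indicator {0<..} x *\<^sub>R ?f x) \<in> borel_measurable borel"
      by (rule borel_measurable_continuous_on_indicator) (auto intro!: continuous_intros)
    then show "(\<lambda>x. indicator {0<..} x *\<^sub>R ?f x) \<in> borel_measurable lborel" by simp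
  qed
  have "(LBINT x=0..\<infinity>. ?f x) = (LBINT y=0..\<infinity>. g' y *\<^sub>R ?f (g y))"
  proof (rule interval_integral_substitution_integrable)
    show "0 \<le> g' y" if "0 \<le> ereal y" for y using t that by (simp add: g'_def zero_ereal_def)
    show "isCont ?f (g y)" if "0 < ereal y" for y
      using that by (intro cf gpos) (simp add: zero_ereal_def)
    show "set_integrable lborel (einterval 0 \<infinity>) ?f" using int unfolding e .
  qed (use dg cg' g0 gtop i1 in \<open>auto simp: zero_ereal_def\<close>)
  then have "(LBINT x:{0<..}. ?f x) = (LBINT y:{0<..}. g' y *\<^sub>R ?f (g y))"
    unfolding interval_lebesgue_integral_def e by simp
  also have "\<dots> = (LBINT y:{0<..}. of_real t powr (- s / 2) / 2 * (of_real (exp (- y)) * of_real y powr (s / 2 - 1)))"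
    by (intro set_lebesgue_integral_cong) (auto simp: fg)
  also have "\<dots> = of_real t powr (- s / 2) / 2 * Gamma (s / 2)"
    using G(2) by simp
  finally show "(LBINT x:{0<..}. ?f x) = of_real t powr (- s / 2) * Gamma (s / 2) / 2" by simp
qed

text \<open>The norm of a complex power of a positive number depends only on the real part of the
  exponent. The value is needed to justify integrating the Bessel series term by term.\<close>

lemma gaussian_moment_norm:
  fixes t :: real and s :: complex
  assumes t: "0 < t" and s: "0 < Re s"
  shows "(LBINT x:{0<..}. norm (of_real (exp (- (t * x\<^sup>2))) * of_real x powr (s - 1) :: complex)) = t powr (- Re s / 2) * Gamma (Re s / 2) / 2"
proof -
  have "complex_of_real (LBINT x:{0<..}. norm (of_real (exp (- (t * x\<^sup>2))) * of_real x powr (s - 1) :: complex)) =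
      (LBINT x:{0<..}. complex_of_real (norm (of_real (exp (- (t * x\<^sup>2))) * of_real x powr (s - 1) :: complex)))"
    by (rule set_integral_complex_of_real[symmetric])
  also have "\<dots> = (LBINT x:{0<..}. of_real (exp (- (t * x\<^sup>2))) * of_real x powr (of_real (Re s) - 1))"
  proof (intro set_lebesgue_integral_cong allI impI)
    fix x :: real assume "x \<in> {0<..}"
    then have "complex_of_real x powr (of_real (Re s) - 1) = of_real (x powr (Re s - 1))"
      by (simp add: powr_of_real[symmetric])
    then show "complex_of_real (norm (of_real (exp (- (t * x\<^sup>2))) * of_real x powr (s - 1) :: complex)) = of_real (exp (- (t * x\<^sup>2))) * of_real x powr (of_real (Re s) - 1)"
      using \<open>x \<in> {0<..}\<close> by (simp add: norm_mult norm_powr_real_powr)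
  qed simp
  also have "\<dots> = of_real t powr (- of_real (Re s) / 2) * Gamma (of_real (Re s) / 2) / 2"
    using t s by (intro gaussian_moment) auto
  also have "\<dots> = of_real (t powr (- Re s / 2) * Gamma (Re s / 2) / 2)"
    using t by (simp add: powr_of_real[symmetric] Gamma_complex_of_real[symmetric])
  finally show ?thesis by (simp only: of_real_eq_iff)
qed

lemma pochhammer_Re_le_norm:
  fixes d :: complex
  assumes "0 < Re d"
  shows "pochhammer (Re d) n \<le> norm (pochhammer d n)"
proof (induction n)
  case (Suc n)
  have "Re d + n \<le> norm (d + of_nat n)" using complex_Re_le_cmod[of "d + of_nat n"] by simp
  from mult_mono[OF Suc.IH this] have "pochhammer (Re d) n * (Re d + n) \<le> norm (pochhammer d n) * norm (d + of_nat n)"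
    using assms by simp
  then show ?case by (simp add: pochhammer_Suc norm_mult)
qed simp

lemma Gamma_add_of_nat:
  fixes c :: "'a :: Gamma"
  assumes "c \<notin> \<int>\<^sub>\<le>\<^sub>0"
  shows "Gamma (c + of_nat n) = Gamma c * pochhammer c n"
  using assms by (simp add: pochhammer_Gamma Gamma_eq_zero_iff)

text \<open>Since \<open>\<nu> + 3 + \<mu> + 2 * n = 2 * (c + n) - 1\<close>, the n-th Bessel term
  contributes a Gaussian moment with value \<open>Gamma (c + n)\<close>. Divided by
  \<open>Gamma (\<mu> + 1 + n)\<close> from the Bessel series this gives the Pochhammer quotient of
  the Kummer series with parameters \<open>c\<close> and \<open>\<mu> + 1\<close>. The powers of
  \<open>t\<close> combine to \<open>t powr (\<mu> - c) * t ^ n\<close>, and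
  \<open>1 / a = 2 * t\<close> in front of the integral supplies one more.\<close>

lemma D_GY_eq_kummer:
  fixes z :: complex
  assumes a: "0 < a" and mu: "\<mu> = csqrt (2 * z + complex_of_real (\<nu>\<^sup>2))" "0 < Re \<mu>" and c: "c = (\<mu> + of_real \<nu>) / 2 + 2" "0 < Re c"
  defines "t \<equiv> 1 / (2 * a)"
  shows "set_integrable lborel {0<..} (D_integrand \<nu> a z)"
    and "D_GY \<nu> a z = of_real (exp (- t)) * of_real t powr (\<mu> + 1 - c) * (Gamma c / Gamma (\<mu> + 1)) * kummer c (\<mu> + 1) (of_real t)"
proof -
  have t: "0 < t" using a by (simp add: t_def)
  have ta: "1 / a = 2 * t" by (simp add: t_def)
  define \<tau> where "\<tau> n x = complex_of_real (exp (- (x\<^sup>2 / (2 * a))) * x powr (\<nu> + 3)) *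
     (complex_of_real (x / a / 2) powr (\<mu> + 2 * of_nat n) / (fact n * Gamma (\<mu> + of_nat n + 1)))" for n x
  define C where "C n = complex_of_real t powr (\<mu> + 2 * of_nat n) / (fact n * Gamma (\<mu> + of_nat n + 1))" for n
  define s where "s n = 2 * (c + of_nat n)" for n
  let ?f = "\<lambda>n x. complex_of_real (exp (- (t * x\<^sup>2))) * of_real x powr (s n - 1)"
  have s: "0 < Re (s n)" for n using c(2) by (simp add: s_def add_pos_nonneg)
  have \<tau>: "\<tau> n x = C n * ?f n x" if x: "0 < x" for n x
  proof -
    have "complex_of_real (x / a / 2) powr (\<mu> + 2 * of_nat n) = of_real x powr (\<mu> + 2 * of_nat n) * of_real t powr (\<mu> + 2 * of_nat n)"
    proof -
      have "complex_of_real (x / a / 2) = of_real x * of_real t" by (simp add: t_def)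
      then show ?thesis using x t by (simp add: powr_times_real)
    qed
    moreover have "complex_of_real (x powr (\<nu> + 3)) = of_real x powr (of_real \<nu> + 3)"
      using x powr_of_real[of x "\<nu> + 3"] by simp
    moreover have "of_real x powr (of_real \<nu> + 3) * of_real x powr (\<mu> + 2 * of_nat n) = (of_real x powr (s n - 1) :: complex)"
    proof -
      have "of_real \<nu> + 3 + (\<mu> + 2 * of_nat n) = s n - 1" by (simp add: s_def c(1) field_simps)
      then show ?thesis by (simp only: powr_add[symmetric])
    qed
    moreover have "x\<^sup>2 / (2 * a) = t * x\<^sup>2" by (simp add: t_def)
    ultimately show ?thesis by (simp add: \<tau>_def C_def mult_ac)
  qed
  have i1: "set_integrable lborel {0<..} (\<tau> n)" for n
  proof -
    have "set_integrable lborel {0<..} (\<lambda>x. C n * ?f n x)"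
      using gaussian_moment(1)[OF t s] by (rule set_integrable_mult_right)
    then show ?thesis
      by (rule set_integrable_cong[THEN iffD2, rotated 3]) (simp_all add: \<tau>)
  qed
  have "x \<notin> \<int>\<^sub>\<le>\<^sub>0" if "0 < Re x" for x using that by (auto elim!: nonpos_Ints_cases)
  then have d0: "\<mu> + 1 \<notin> \<int>\<^sub>\<le>\<^sub>0" "c \<notin> \<int>\<^sub>\<le>\<^sub>0" using mu(2) c(2) by simp_all
  have Gd: "Gamma (\<mu> + of_nat n + 1) = Gamma (\<mu> + 1) * pochhammer (\<mu> + 1) n" for n
    using Gamma_add_of_nat[OF d0(1), of n] by (simp add: add_ac)
  have "(LBINT x:{0<..}. \<tau> n x) = of_real t powr (\<mu> - c) / 2 * (Gamma c / Gamma (\<mu> + 1)) * (kummer_coeff c (\<mu> + 1) n * of_real t ^ n)" for n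
  proof -
    have "(LBINT x:{0<..}. \<tau> n x) = (LBINT x:{0<..}. C n * ?f n x)"
      by (intro set_lebesgue_integral_cong) (auto simp: \<tau>)
    also have "\<dots> = C n * (of_real t powr (- s n / 2) * Gamma (s n / 2) / 2)"
      using gaussian_moment(2)[OF t s] by simp
    also have "s n / 2 = c + of_nat n" by (simp add: s_def)
    also have "- s n / 2 = - c - of_nat n" by (simp add: s_def)
    also have "Gamma (c + of_nat n) = Gamma c * pochhammer c n" by (rule Gamma_add_of_nat[OF d0(2)])
    also have "C n * (of_real t powr (- c - of_nat n) * (Gamma c * pochhammer c n) / 2) =
       of_real t powr (\<mu> + 2 * of_nat n) * of_real t powr (- c - of_nat n) / 2 * (Gamma c / Gamma (\<mu> + 1)) * kummer_coeff c (\<mu> + 1) n"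
      by (simp add: C_def Gd kummer_coeff_def mult_ac)
    also have "of_real t powr (\<mu> + 2 * of_nat n) * of_real t powr (- c - of_nat n) = (of_real t powr (\<mu> - c) * of_real t powr of_nat n :: complex)"
      by (simp add: powr_add[symmetric] algebra_simps)
    also have "complex_of_real t powr of_nat n = of_real t ^ n" using t by (simp add: powr_nat')
    finally show ?thesis by simp
  qed
  note int_\<tau> = this
  \<comment> \<open>Taking norms replaces \<open>c\<close> by \<open>Re c\<close> in the numerator.
    The complex Pochhammer symbol left in the denominator is bounded below by the real one, so the
    Kummer series with parameters \<open>Re c\<close> and \<open>Re \<mu> + 1\<close> is a
    majorant.\<close>
  have norm_\<tau>: "(LBINT x:{0<..}. norm (\<tau> n x)) = t powr (Re \<mu> - Re c) / 2 * (Gamma (Re c) / norm (Gamma (\<mu> + 1))) * (pochhammer (Re c) n / (fact n * norm (pochhammer (\<mu> + 1) n)) * t ^ n)" for n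
  proof -
    have "(LBINT x:{0<..}. norm (\<tau> n x)) = (LBINT x:{0<..}. norm (C n) * norm (?f n x))"
      by (intro set_lebesgue_integral_cong) (auto simp: \<tau> norm_mult)
    also have "\<dots> = norm (C n) * (t powr (- Re (s n) / 2) * Gamma (Re (s n) / 2) / 2)"
      using gaussian_moment_norm[OF t s] by simp
    also have "Re (s n) / 2 = Re c + real n" by (simp add: s_def)
    also have "- Re (s n) / 2 = - Re c - real n" by (simp add: s_def)
    also have "Gamma (Re c + real n) = Gamma (Re c) * pochhammer (Re c) n"
      using c(2) by (intro Gamma_add_of_nat) (auto elim!: nonpos_Ints_cases)
    also have "norm (C n) = t powr (Re \<mu> + 2 * real n) / (fact n * (norm (Gamma (\<mu> + 1)) * norm (pochhammer (\<mu> + 1) n)))"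
      using t by (simp add: C_def Gd norm_divide norm_mult norm_powr_real_powr)
    also have "t powr (Re \<mu> + 2 * real n) / (fact n * (norm (Gamma (\<mu> + 1)) * norm (pochhammer (\<mu> + 1) n))) * (t powr (- Re c - real n) * (Gamma (Re c) * pochhammer (Re c) n) / 2)
       = (t powr (Re \<mu> + 2 * real n) * t powr (- Re c - real n)) / 2 * (Gamma (Re c) / norm (Gamma (\<mu> + 1))) * (pochhammer (Re c) n / (fact n * norm (pochhammer (\<mu> + 1) n)))"
      by (simp add: mult_ac)
    also have "t powr (Re \<mu> + 2 * real n) * t powr (- Re c - real n) = t powr (Re \<mu> - Re c) * t ^ n"
      using t by (simp add: powr_add[symmetric] powr_realpow[symmetric] algebra_simps)
    finally show ?thesis by simp
  qed
  have sum_int: "summable (\<lambda>n. LBINT x:{0<..}. norm (\<tau> n x))"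
    unfolding norm_\<tau>
  proof (rule summable_mult, rule summable_comparison_test')
    show "summable (\<lambda>n. norm (kummer_coeff (Re c) (Re \<mu> + 1) n * t ^ n))"
      using mu(2) by (intro summable_norm_kummer) auto
    show "norm (pochhammer (Re c) n / (fact n * norm (pochhammer (\<mu> + 1) n)) * t ^ n) \<le> norm (kummer_coeff (Re c) (Re \<mu> + 1) n * t ^ n)" for n
    proof -
      have "0 < pochhammer (Re \<mu> + 1) n" using mu(2) by (intro pochhammer_pos) simp
      then have "pochhammer (Re c) n / (fact n * norm (pochhammer (\<mu> + 1) n)) \<le> kummer_coeff (Re c) (Re \<mu> + 1) n"
        unfolding kummer_coeff_def using mu(2) c(2) pochhammer_Re_le_norm[of "\<mu> + 1" n]
        by (intro divide_left_mono mult_left_mono mult_pos_pos) (auto simp: pochhammer_nonneg)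
      then have le: "pochhammer (Re c) n / (fact n * norm (pochhammer (\<mu> + 1) n)) * t ^ n \<le> kummer_coeff (Re c) (Re \<mu> + 1) n * t ^ n"
        using t by (intro mult_right_mono) auto
      have "0 \<le> pochhammer (Re c) n / (fact n * norm (pochhammer (\<mu> + 1) n)) * t ^ n"
        using c(2) t by (intro mult_nonneg_nonneg divide_nonneg_nonneg pochhammer_nonneg) auto
      with le show ?thesis unfolding real_norm_def by (metis abs_ge_self abs_of_nonneg order_trans)
    qed
  qed
  have sum_pt: "summable (\<lambda>n. norm (\<tau> n x))" if x: "0 < x" for x
  proof (rule summable_comparison_test')
    define A where "A = norm (complex_of_real (exp (- (x\<^sup>2 / (2 * a))) * x powr (\<nu> + 3))) * (x * t) powr Re \<mu> / norm (Gamma (\<mu> + 1))"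
    have A: "0 \<le> A" by (simp add: A_def)
    show "summable (\<lambda>n. A * (inverse (fact n) * ((x * t)\<^sup>2) ^ n))" by (intro summable_mult summable_exp)
    fix n
    have "1 \<le> norm (pochhammer (\<mu> + 1) n)"
    proof -
      have "1 \<le> pochhammer (Re \<mu> + 1) n"
      proof (induction n)
        case (Suc n)
        have "1 * 1 \<le> pochhammer (Re \<mu> + 1) n * (Re \<mu> + 1 + real n)"
          using Suc mu(2) by (intro mult_mono) auto
        then show ?case by (simp add: pochhammer_Suc)
      qed simp
      then show ?thesis using pochhammer_Re_le_norm[of "\<mu> + 1" n] mu(2) by simp
    qed
    then have "A * (inverse (fact n) * ((x * t)\<^sup>2) ^ n) / norm (pochhammer (\<mu> + 1) n) \<le> A * (inverse (fact n) * ((x * t)\<^sup>2) ^ n) / 1"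
      using A by (intro divide_left_mono) auto
    moreover have "norm (\<tau> n x) = A * (inverse (fact n) * ((x * t)\<^sup>2) ^ n) / norm (pochhammer (\<mu> + 1) n)"
    proof -
      have "norm (complex_of_real (x / a / 2) powr (\<mu> + 2 * of_nat n)) = (x * t) powr (Re \<mu> + 2 * real n)"
        using x a by (simp add: norm_powr_real_powr t_def mult.commute)
      also have "\<dots> = (x * t) powr Re \<mu> * ((x * t)\<^sup>2) ^ n"
        using x t powr_realpow[of "x * t" "2 * n"] by (simp add: powr_add power_mult)
      finally show ?thesis unfolding \<tau>_def Gd A_def norm_mult norm_divide
        by (simp add: field_simps)
    qed
    ultimately have "norm (\<tau> n x) \<le> A * (inverse (fact n) * ((x * t)\<^sup>2) ^ n)" by (simp only: div_by_1)
    then show "norm (norm (\<tau> n x)) \<le> A * (inverse (fact n) * ((x * t)\<^sup>2) ^ n)"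
      unfolding real_norm_def abs_norm_cancel .
  qed
  \<comment> \<open>The nonzero weight \<open>e\<close> is divided out to obtain summability of the
    Bessel series itself, which is needed to move \<open>e\<close> inside the sum.\<close>
  have Dint: "D_integrand \<nu> a z x = (\<Sum>n. \<tau> n x)" if "0 < x" for x
  proof -
    define e where "e = complex_of_real (exp (- (x\<^sup>2 / (2 * a))) * x powr (\<nu> + 3))"
    define r where "r n = complex_of_real (x / a / 2) powr (\<mu> + 2 * of_nat n) / (fact n * Gamma (\<mu> + of_nat n + 1))" for n
    have "e \<noteq> 0" using that by (simp add: e_def)
    have \<tau>r: "\<tau> n x = e * r n" for n by (simp only: \<tau>_def e_def r_def)
    have "summable (\<lambda>n. inverse e * \<tau> n x)" by (intro summable_mult summable_norm_cancel[OF sum_pt[OF that]])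
    then have "summable r" unfolding \<tau>r mult.assoc[symmetric] using \<open>e \<noteq> 0\<close> by simp
    then have "(\<Sum>n. e * r n) = e * (\<Sum>n. r n)" by (rule suminf_mult)
    then show ?thesis
      unfolding D_integrand_def bessel_I_def mu(1)[symmetric] \<tau>r by (simp only: e_def r_def)
  qed
  have Dind: "indicator {0<..} x *\<^sub>R D_integrand \<nu> a z x = (\<Sum>n. indicator {0<..} x *\<^sub>R \<tau> n x)" for x
    using Dint[of x] by (cases "0 < x") auto
  have prem: "\<And>n. integrable lborel (\<lambda>x. indicator {0<..} x *\<^sub>R \<tau> n x)"
    "AE x in lborel. summable (\<lambda>n. norm (indicator {0<..} x *\<^sub>R \<tau> n x))"
    "summable (\<lambda>n. LINT x|lborel. norm (indicator {0<..} x *\<^sub>R \<tau> n x))"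
  proof -
    show "integrable lborel (\<lambda>x. indicator {0<..} x *\<^sub>R \<tau> n x)" for n
      using i1 by (simp add: set_integrable_def)
    have "summable (\<lambda>n. norm (indicator {0<..} x *\<^sub>R \<tau> n x))" for x
      using sum_pt[of x] by (cases "0 < x") auto
    then show "AE x in lborel. summable (\<lambda>n. norm (indicator {0<..} x *\<^sub>R \<tau> n x))" by simp
    show "summable (\<lambda>n. LINT x|lborel. norm (indicator {0<..} x *\<^sub>R \<tau> n x))"
      using sum_int by (simp add: set_lebesgue_integral_def norm_mult)
  qed
  show "set_integrable lborel {0<..} (D_integrand \<nu> a z)"
    unfolding set_integrable_def Dind by (rule integrable_suminf[OF prem])
  have "(LBINT x:{0<..}. D_integrand \<nu> a z x) = (\<Sum>n. LBINT x:{0<..}. \<tau> n x)"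
    unfolding set_lebesgue_integral_def Dind by (rule integral_suminf[OF prem])
  also have "\<dots> = of_real t powr (\<mu> - c) / 2 * (Gamma c / Gamma (\<mu> + 1)) * kummer c (\<mu> + 1) (of_real t)"
    unfolding int_\<tau> kummer_def
  proof (intro suminf_mult summable_norm_cancel[OF summable_norm_kummer])
    fix j :: nat
    show "1 + real j \<le> norm (\<mu> + 1 + of_nat j)"
      using complex_Re_le_cmod[of "\<mu> + 1 + of_nat j"] mu(2) by simp
  qed
  finally have I: "(LBINT x:{0<..}. D_integrand \<nu> a z x) = \<dots>" .
  have "complex_of_real (exp (- (1 / (2 * a))) / a) = of_real (exp (- t)) * (2 * of_real t)"
    using a by (simp add: t_def)
  moreover have "of_real t * of_real t powr (\<mu> - c) = (of_real t powr (\<mu> + 1 - c) :: complex)"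
    using t powr_add[of "complex_of_real t" 1 "\<mu> - c"] by (simp add: algebra_simps)
  ultimately show "D_GY \<nu> a z = of_real (exp (- t)) * of_real t powr (\<mu> + 1 - c) * (Gamma c / Gamma (\<mu> + 1)) * kummer c (\<mu> + 1) (of_real t)"
    unfolding D_GY_def I by (simp add: mult_ac)
qed

section \<open>Analytic continuation\<close>

text \<open>The difference quotient is compared directly with the candidate derivative: the Taylor
  remainder of \<open>exp (- s * x)\<close> is quadratic in \<open>s\<close>, with a factor that is
  integrable against \<open>h\<close> and does not depend on \<open>s\<close>.\<close>

lemma laplace_transform_holomorphic:
  fixes h :: "real \<Rightarrow> real"
  assumes h[measurable]: "h \<in> borel_measurable borel" and h0: "\<And>x. 0 \<le> h x"
    and int: "\<And>\<delta>. \<delta>0 < \<delta> \<Longrightarrow> set_integrable lborel {0..} (\<lambda>x. exp (- \<delta> * x) * h x)"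
  shows "(\<lambda>z. LBINT x:{0..}. exp (- z * complex_of_real x) * complex_of_real (h x)) holomorphic_on {z. \<delta>0 < Re z}"
proof -
  let ?e = "\<lambda>z x. exp (- z * complex_of_real x) * complex_of_real (h x)"
  let ?F = "\<lambda>z. LBINT x:{0..}. ?e z x"
  have cint: "set_integrable lborel {0..} (\<lambda>x. ?e z x)" if z: "\<delta>0 < Re z" for z
  proof (rule set_integrable_bound[OF int[OF z]])
    show "AE x in lborel. x \<in> {0..} \<longrightarrow> norm (?e z x) \<le> norm (exp (- Re z * x) * h x)"
      using h0 by (simp add: norm_mult)
  qed (auto simp: set_borel_measurable_def)
  have "(?F has_field_derivative (LBINT x:{0..}. - of_real x * ?e z x)) (at z)"
    if z: "\<delta>0 < Re z" for z
  proof -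
    \<comment> \<open>A third of the available room: one \<open>\<epsilon>\<close> is lost to the
      exponential in the Taylor remainder, a second one to absorbing the square of \<open>x\<close>,
      and the rate \<open>Re z - 2 * \<epsilon>\<close> still exceeds
      \<open>\<delta>0\<close>.\<close>
    define \<epsilon> where "\<epsilon> = (Re z - \<delta>0) / 3"
    have \<epsilon>: "0 < \<epsilon>" "\<delta>0 < Re z - 2 * \<epsilon>" using z by (simp_all add: \<epsilon>_def field_simps)
    define L where "L = (LBINT x:{0..}. - of_real x * ?e z x)"
    define C where "C = (LBINT x:{0..}. 2 / \<epsilon>\<^sup>2 * (exp (- (Re z - 2 * \<epsilon>) * x) * h x))"
    have iC: "set_integrable lborel {0..} (\<lambda>x. 2 / \<epsilon>\<^sup>2 * (exp (- (Re z - 2 * \<epsilon>) * x) * h x))"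
      using int[OF \<epsilon>(2)] by (rule set_integrable_mult_right)
    have sq: "x\<^sup>2 \<le> 2 / \<epsilon>\<^sup>2 * exp (\<epsilon> * x)" if x: "0 \<le> x" for x
    proof -
      have "1 + \<epsilon> * x + (\<epsilon> * x)\<^sup>2 / 2 \<le> exp (\<epsilon> * x)" using \<epsilon> x by (intro exp_lower_Taylor_quadratic) auto
      moreover have "0 \<le> \<epsilon> * x" using \<epsilon> x by simp
      ultimately have "(\<epsilon> * x)\<^sup>2 / 2 \<le> exp (\<epsilon> * x)" by linarith
      then show ?thesis using \<epsilon> by (simp add: field_simps power_mult_distrib)
    qed
    have pt: "norm (?e (z + s) x - ?e z x
          - s * (- of_real x * ?e z x))
        \<le> (norm s)\<^sup>2 * (2 / \<epsilon>\<^sup>2 * (exp (- (Re z - 2 * \<epsilon>) * x) * h x))" if s: "norm s < \<epsilon>" and x: "0 \<le> x" for s x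
    proof -
      have e: "exp (- (z + s) * complex_of_real x) = exp (- z * complex_of_real x) * exp (- s * complex_of_real x)"
        by (simp add: exp_add[symmetric] algebra_simps)
      have "?e (z + s) x - ?e z x
          - s * (- of_real x * ?e z x) =
          ?e z x * (exp (- s * complex_of_real x) - (1 + - s * complex_of_real x))"
        unfolding e by (simp add: algebra_simps)
      also have "norm \<dots> = exp (- Re z * x) * h x * norm (exp (- s * complex_of_real x) - (1 + - s * complex_of_real x))"
        using h0 by (simp add: norm_mult)
      also have "norm (exp (- s * complex_of_real x) - (1 + - s * complex_of_real x)) \<le> exp (\<epsilon> * x) * ((norm s)\<^sup>2 * x\<^sup>2)"
      proof -
        have "norm (exp (- s * complex_of_real x) - (\<Sum>k\<le>1. (- s * complex_of_real x) ^ k / fact k)) \<le> exp \<bar>Re (- s * complex_of_real x)\<bar> * norm (- s * complex_of_real x) ^ Suc 1 / fact 1"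
          by (rule Taylor_exp)
        then have "norm (exp (- s * complex_of_real x) - (1 + - s * complex_of_real x)) \<le> exp (\<bar>Re s\<bar> * x) * ((norm s)\<^sup>2 * x\<^sup>2)"
          using x by (simp add: norm_mult abs_mult power2_eq_square mult_ac)
        also have "\<dots> \<le> exp (\<epsilon> * x) * ((norm s)\<^sup>2 * x\<^sup>2)"
          using abs_Re_le_cmod[of s] s x by (intro mult_right_mono) (auto intro!: mult_right_mono)
        finally show ?thesis .
      qed
      also have "exp (- Re z * x) * h x * (exp (\<epsilon> * x) * ((norm s)\<^sup>2 * x\<^sup>2)) \<le> exp (- Re z * x) * h x * (exp (\<epsilon> * x) * ((norm s)\<^sup>2 * (2 / \<epsilon>\<^sup>2 * exp (\<epsilon> * x))))"
        using h0 by (intro mult_left_mono sq x) auto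
      also have "\<dots> = (norm s)\<^sup>2 * (2 / \<epsilon>\<^sup>2 * ((exp (- Re z * x) * exp (\<epsilon> * x) * exp (\<epsilon> * x)) * h x))"
        by (simp add: mult_ac)
      also have "exp (- Re z * x) * exp (\<epsilon> * x) * exp (\<epsilon> * x) = exp (- (Re z - 2 * \<epsilon>) * x)"
        by (simp add: exp_add[symmetric] algebra_simps)
      finally show ?thesis using h0 by (simp add: mult_left_mono)
    qed
    have iL: "set_integrable lborel {0..} (\<lambda>x. - of_real x * ?e z x)"
    proof (rule set_integrable_bound)
      have "\<delta>0 < Re z - \<epsilon>" using \<epsilon> by linarith
      from int[OF this] show "set_integrable lborel {0..} (\<lambda>x. 1 / \<epsilon> * (exp (- (Re z - \<epsilon>) * x) * h x))"
        by (rule set_integrable_mult_right)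
      have "norm (- of_real x * ?e z x) \<le> norm (1 / \<epsilon> * (exp (- (Re z - \<epsilon>) * x) * h x))"
        if x: "0 \<le> x" for x
      proof -
        have "\<epsilon> * x \<le> exp (\<epsilon> * x)" using exp_ge_add_one_self[of "\<epsilon> * x"] by linarith
        then have "x \<le> 1 / \<epsilon> * exp (\<epsilon> * x)" using \<epsilon> by (simp add: field_simps)
        then have "x * (exp (- Re z * x) * h x) \<le> 1 / \<epsilon> * exp (\<epsilon> * x) * (exp (- Re z * x) * h x)"
          using h0 by (intro mult_right_mono) auto
        also have "\<dots> = 1 / \<epsilon> * ((exp (\<epsilon> * x) * exp (- Re z * x)) * h x)" by (simp add: mult_ac)
        also have "exp (\<epsilon> * x) * exp (- Re z * x) = exp (- (Re z - \<epsilon>) * x)" by (simp add: exp_add[symmetric] algebra_simps)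
        finally show ?thesis using x h0 \<epsilon> by (simp add: norm_mult abs_mult)
      qed
      then show "AE x in lborel. x \<in> {0..} \<longrightarrow> norm (- of_real x * ?e z x) \<le> norm (1 / \<epsilon> * (exp (- (Re z - \<epsilon>) * x) * h x))"
        by simp
    qed (auto simp: set_borel_measurable_def)
    have main: "norm (?F (z + s) - ?F z - s * L) \<le> (norm s)\<^sup>2 * C" if s: "norm s < \<epsilon>" for s
    proof -
      have zs: "\<delta>0 < Re (z + s)" using abs_Re_le_cmod[of s] s \<epsilon> by simp
      let ?d = "\<lambda>x. ?e (z + s) x - ?e z x
          - s * (- of_real x * ?e z x)"
      have id: "set_integrable lborel {0..} ?d"
        by (intro set_integral_diff(1) cint z zs set_integrable_mult_right iL)
      have "?F (z + s) - ?F z - s * L = (LBINT x:{0..}. ?e (z + s) x - ?e z x)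
          - (LBINT x:{0..}. s * (- of_real x * ?e z x))"
        unfolding L_def set_integral_diff(2)[OF cint[OF zs] cint[OF z]] set_integral_mult_right ..
      also have "\<dots> = (LBINT x:{0..}. ?d x)"
        by (intro set_integral_diff(2)[symmetric] set_integral_diff(1) cint z zs set_integrable_mult_right iL)
      finally have "?F (z + s) - ?F z - s * L = (LBINT x:{0..}. ?d x)" .
      then have "norm (?F (z + s) - ?F z - s * L) = norm (LBINT x:{0..}. ?d x)" by (rule arg_cong)
      also have "\<dots> \<le> (LBINT x:{0..}. norm (?d x))" by (rule set_integral_norm_bound[OF id])
      also have "\<dots> \<le> (LBINT x:{0..}. (norm s)\<^sup>2 * (2 / \<epsilon>\<^sup>2 * (exp (- (Re z - 2 * \<epsilon>) * x) * h x)))"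
        using pt[OF s] by (intro set_integral_mono set_integrable_norm id set_integrable_mult_right iC) auto
      also have "\<dots> = (norm s)\<^sup>2 * C" unfolding C_def by (rule set_integral_mult_right)
      finally show ?thesis .
    qed
    have "((\<lambda>s. (?F (z + s) - ?F z) / s - L) \<longlongrightarrow> 0) (at 0)"
    proof (rule Lim_null_comparison)
      show "\<forall>\<^sub>F s in at 0. norm ((?F (z + s) - ?F z) / s - L) \<le> norm s * C"
        unfolding eventually_at
      proof (intro exI conjI ballI impI)
        fix s :: complex assume s: "s \<noteq> 0 \<and> dist s 0 < \<epsilon>"
        have "(?F (z + s) - ?F z) / s - L = (?F (z + s) - ?F z - s * L) / s" using s by (simp add: field_simps)
        then have "norm ((?F (z + s) - ?F z) / s - L) = norm (?F (z + s) - ?F z - s * L) / norm s"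
          by (simp only: norm_divide)
        also have "\<dots> \<le> (norm s)\<^sup>2 * C / norm s" using s by (intro divide_right_mono main) auto
        also have "\<dots> = norm s * C" using s by (simp add: power2_eq_square)
        finally show "norm ((?F (z + s) - ?F z) / s - L) \<le> norm s * C" .
      qed (rule \<epsilon>(1))
      have "((\<lambda>s :: complex. norm s * C) \<longlongrightarrow> norm (0 :: complex) * C) (at 0)" by (intro tendsto_intros)
      then show "((\<lambda>s :: complex. norm s * C) \<longlongrightarrow> 0) (at 0)" by simp
    qed
    then show ?thesis unfolding DERIV_def L_def[symmetric] by (simp add: LIM_zero_iff)
  qed
  then show ?thesis
    by (subst holomorphic_on_open) (auto simp: open_halfspace_Re_gt)
qed

text \<open>The partial sums are holomorphic because \<open>1 \<le> Re (d z)\<close> keeps the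
  denominators away from 0. On a closed ball \<open>c\<close> is bounded, so
  \<open>norm_kummer_coeff_le\<close> provides a majorant uniform in \<open>z\<close> for the
  Weierstrass test.\<close>

lemma kummer_holomorphic:
  fixes c d :: "complex \<Rightarrow> complex"
  assumes S: "open S" and c: "c holomorphic_on S" and d: "d holomorphic_on S" and d1: "\<And>z. z \<in> S \<Longrightarrow> 1 \<le> Re (d z)"
  shows "(\<lambda>z. kummer (c z) (d z) t) holomorphic_on S"
proof (rule holomorphic_uniform_sequence[OF S])
  have poch: "pochhammer (d z) n \<noteq> 0" if "z \<in> S" for z n
  proof -
    have "0 < pochhammer (Re (d z)) n" using d1[OF that] by (intro pochhammer_pos) simp
    also have "\<dots> \<le> norm (pochhammer (d z) n)" using d1[OF that] by (intro pochhammer_Re_le_norm) simp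
    finally show ?thesis by auto
  qed
  show "(\<lambda>z. \<Sum>i<n. kummer_coeff (c z) (d z) i * t ^ i) holomorphic_on S" for n
    unfolding kummer_coeff_def using poch unfolding pochhammer_prod
    by (intro holomorphic_intros c d) auto
  fix x assume "x \<in> S"
  then obtain e where e: "0 < e" "cball x e \<subseteq> S" using S open_contains_cball by blast
  have "compact (c ` cball x e)"
    using e c by (intro compact_continuous_image holomorphic_on_imp_continuous_on holomorphic_on_subset[OF c]) auto
  then obtain R where R: "\<And>z. z \<in> cball x e \<Longrightarrow> norm (c z) \<le> R"
    using compact_imp_bounded bounded_iff by (metis imageI)
  have "uniform_limit (cball x e) (\<lambda>n z. \<Sum>i<n. kummer_coeff (c z) (d z) i * t ^ i) (\<lambda>z. \<Sum>i. kummer_coeff (c z) (d z) i * t ^ i) sequentially"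
  proof (rule Weierstrass_m_test)
    show "summable (\<lambda>n. inverse (fact n) * (max 1 R * norm t) ^ n)" by (rule summable_exp)
    fix n z assume z: "z \<in> cball x e"
    have "1 + real j \<le> norm (d z + of_nat j)" for j
      using complex_Re_le_cmod[of "d z + of_nat j"] d1[of z] e z by auto
    then have "norm (kummer_coeff (c z) (d z) n) * norm t ^ n \<le> max 1 R ^ n / fact n * norm t ^ n"
      using R[OF z] by (intro mult_right_mono norm_kummer_coeff_le) auto
    then show "norm (kummer_coeff (c z) (d z) n * t ^ n) \<le> inverse (fact n) * (max 1 R * norm t) ^ n"
      by (simp add: norm_mult norm_power power_mult_distrib field_simps)
  qed
  then show "\<exists>d'>0. cball x d' \<subseteq> S \<and> uniform_limit (cball x d') (\<lambda>n z. \<Sum>i<n. kummer_coeff (c z) (d z) i * t ^ i) (\<lambda>z. kummer (c z) (d z) t) sequentially"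
    unfolding kummer_def using e by blast
qed

text \<open>The complex counterpart of the bound that makes both kernel exponents positive. The
  square of \<open>Re (csqrt w)\<close> is \<open>(cmod w + Re w) / 2\<close>, which is at least
  \<open>Re w\<close>, so the real computation carries over.\<close>

lemma Re_csqrt_gt:
  fixes z :: complex
  assumes "2 * (\<nu> + 1) < Re z"
  shows "\<bar>\<nu> + 2\<bar> < Re (csqrt (2 * z + complex_of_real (\<nu>\<^sup>2)))"
proof -
  let ?\<zeta> = "2 * z + complex_of_real (\<nu>\<^sup>2)"
  have "(\<nu> + 2)\<^sup>2 < Re ?\<zeta>" using assms by (simp add: power2_eq_square algebra_simps)
  also have "\<dots> \<le> (cmod ?\<zeta> + Re ?\<zeta>) / 2" using complex_Re_le_cmod[of ?\<zeta>] by simp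
  finally have "\<bar>\<nu> + 2\<bar> < sqrt ((cmod ?\<zeta> + Re ?\<zeta>) / 2)" by (intro real_less_rsqrt) simp
  then show ?thesis by simp
qed

lemma kummer_of_real:
  "kummer (of_real c) (of_real d) (of_real t) = (of_real (kummer c d t) :: complex)"
  if "1 \<le> d" for c d t :: real
proof -
  have "summable (\<lambda>n. kummer_coeff c d n * t ^ n)"
    using that by (intro summable_norm_cancel[OF summable_norm_kummer]) auto
  then show ?thesis
    unfolding kummer_def
    by (simp add: suminf_of_real kummer_coeff_def pochhammer_of_real)
qed

text \<open>The right-hand side of \<open>D_GY_eq_kummer\<close> as a function of \<open>z\<close>,
  with \<open>t = 1 / (2 * a)\<close>. Holomorphy is proved for this form, so the Bessel integral
  need not be differentiated in \<open>z\<close>.\<close>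

definition D_closed :: "real \<Rightarrow> real \<Rightarrow> complex \<Rightarrow> complex" where
  "D_closed \<nu> t z = (let \<mu> = csqrt (2 * z + complex_of_real (\<nu>\<^sup>2)); c = (\<mu> + of_real \<nu>) / 2 + 2 in
     of_real (exp (- t)) * of_real t powr (\<mu> + 1 - c) * (Gamma c / Gamma (\<mu> + 1)) * kummer c (\<mu> + 1) (of_real t))"

lemma D_closed_holomorphic:
  assumes t: "0 < t"
  shows "D_closed \<nu> t holomorphic_on {z. max 0 (2 * (\<nu> + 1)) < Re z}" (is "_ holomorphic_on ?S")
proof -
  define \<mu> where "\<mu> z = csqrt (2 * z + complex_of_real (\<nu>\<^sup>2))" for z
  define c where "c z = (\<mu> z + of_real \<nu>) / 2 + 2" for z
  have Re_mu: "\<bar>\<nu> + 2\<bar> < Re (\<mu> z)" if "z \<in> ?S" for z using that unfolding \<mu>_def by (intro Re_csqrt_gt) auto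
  have h\<mu>: "\<mu> holomorphic_on ?S"
    unfolding \<mu>_def
  proof (intro holomorphic_intros)
    fix z assume "z \<in> ?S"
    \<comment> \<open>The radicand stays in the open right half-plane, away from the branch cut of
      the principal square root.\<close>
    then have "0 < Re (2 * z + complex_of_real (\<nu>\<^sup>2))" by (simp add: add_pos_nonneg)
    then show "2 * z + complex_of_real (\<nu>\<^sup>2) \<notin> \<real>\<^sub>\<le>\<^sub>0" by (metis complex_nonpos_Reals_iff not_le)
  qed
  have hc: "c holomorphic_on ?S" unfolding c_def by (intro holomorphic_intros h\<mu>) auto
  have np: "x \<notin> \<int>\<^sub>\<le>\<^sub>0" if "0 < Re x" for x using that by (auto elim!: nonpos_Ints_cases)
  have cp: "c z \<notin> \<int>\<^sub>\<le>\<^sub>0" and mp: "\<mu> z + 1 \<notin> \<int>\<^sub>\<le>\<^sub>0" if "z \<in> ?S" for z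
    using Re_mu[OF that] by (intro np; simp add: c_def abs_less_iff field_simps)+
  have "(\<lambda>z. of_real (exp (- t)) * of_real t powr (\<mu> z + 1 - c z) * (Gamma (c z) / Gamma (\<mu> z + 1)) * kummer (c z) (\<mu> z + 1) (of_real t)) holomorphic_on ?S"
  proof (intro holomorphic_intros h\<mu> hc kummer_holomorphic)
    show "open ?S" by (rule open_halfspace_Re_gt)
    show "1 \<le> Re (\<mu> z + 1)" if "z \<in> ?S" for z using Re_mu[OF that] by simp
    show "Gamma (\<mu> z + 1) \<noteq> 0" if "z \<in> ?S" for z using mp[OF that] by (simp add: Gamma_eq_zero_iff)
  qed (use cp mp t in auto)
  then show ?thesis by (simp add: D_closed_def[abs_def] Let_def \<mu>_def c_def)
qed

section \<open>Identification of the call transform with the Bessel integral\<close>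

context std_brownian_motion
begin

text \<open>Holds on every path, also where \<open>B 0\<close> is not 0, and so yields measurability
  of the payoff without completeness of \<open>Q\<close>.\<close>

lemma yor_A_scale: "yor_A B \<nu> x \<omega> = exp (2 * B 0 \<omega>) * yor_A (post_incr B 0) \<nu> x \<omega>"
proof -
  have "yor_A B \<nu> x \<omega> = (LBINT w:{0..x}. exp (2 * B 0 \<omega>) * exp (2 * (post_incr B 0 w \<omega> + \<nu> * w)))"
    unfolding yor_A_def by (intro set_lebesgue_integral_cong) (auto simp: post_incr_def exp_add[symmetric] algebra_simps)
  then show ?thesis by (simp add: yor_A_def)
qed

lemma measurable_yor_call: "yor_call B \<nu> a x \<in> borel_measurable Q"
proof -
  have [measurable]: "B 0 \<in> borel_measurable Q" by (rule random_variable_B) simp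
  have [measurable]: "yor_A (post_incr B 0) \<nu> x \<in> borel_measurable Q" by (rule measurable_yor) simp
  show ?thesis unfolding yor_call_def[abs_def] yor_A_scale by measurable
qed

text \<open>Finiteness at every single \<open>x\<close> gives integrability of each payoff, and it
  ensures that \<open>enn2real\<close>, which sends infinity to 0, loses nothing.\<close>

lemma yor_call_mean_finite:
  assumes "0 \<le> a"
  shows "yor_call_mean \<nu> a x < \<infinity>"
proof -
  have "yor_call_mean \<nu> a x \<le> (\<integral>\<^sup>+\<omega>. ennreal (yor_A (post_incr B 0) \<nu> x \<omega>) \<partial>Q)"
    unfolding yor_call_mean_def using assms
    by (intro nn_integral_mono ennreal_leI) (auto simp: yor_A_nonneg)
  also have "\<dots> \<le> (\<integral>\<^sup>+w. ennreal (exp (2 * \<bar>\<nu> + 1\<bar> * \<bar>x\<bar>)) * indicator {0..x} w \<partial>lborel)"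
    unfolding nn_integral_yor_A
  proof (intro nn_integral_mono)
    fix w
    have "2 * (\<nu> + 1) * w \<le> 2 * \<bar>\<nu> + 1\<bar> * \<bar>x\<bar>" if "w \<in> {0..x}"
    proof -
      have "2 * (\<nu> + 1) * w \<le> 2 * \<bar>\<nu> + 1\<bar> * w"
        using that abs_ge_self[of "\<nu> + 1"] by (intro mult_right_mono) auto
      also have "\<dots> \<le> 2 * \<bar>\<nu> + 1\<bar> * \<bar>x\<bar>" using that by (intro mult_left_mono) auto
      finally show ?thesis .
    qed
    then show "ennreal (exp (2 * (\<nu> + 1) * w)) * indicator {0..x} w \<le> ennreal (exp (2 * \<bar>\<nu> + 1\<bar> * \<bar>x\<bar>)) * indicator {0..x} w"
      by (auto simp: indicator_def intro!: ennreal_leI)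
  qed
  also have "\<dots> < \<infinity>" by (simp add: nn_integral_cmult_indicator ennreal_mult_less_top emeasure_lborel_Icc_eq)
  finally show ?thesis .
qed

lemma nn_integral_yor_call: "(\<integral>\<^sup>+\<omega>. ennreal (yor_call B \<nu> a x \<omega>) \<partial>Q) = yor_call_mean \<nu> a x"
  unfolding yor_call_mean_def
proof (rule nn_integral_cong_AE)
  show "AE \<omega> in Q. ennreal (yor_call B \<nu> a x \<omega>) = ennreal (max 0 (yor_A (post_incr B 0) \<nu> x \<omega> - a))"
    using AE_yor_A[of \<nu>] by eventually_elim (simp add: yor_call_def)
qed

lemma integrable_yor_call: "0 \<le> a \<Longrightarrow> integrable Q (yor_call B \<nu> a x)"
  by (rule integrableI_nonneg[OF measurable_yor_call])
     (simp add: yor_call_def, simp add: nn_integral_yor_call yor_call_mean_finite[simplified])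

lemma integral_yor_call: "(\<integral>\<omega>. yor_call B \<nu> a x \<omega> \<partial>Q) = enn2real (yor_call_mean \<nu> a x)"
  unfolding nn_integral_yor_call[symmetric]
  by (intro integral_eq_nn_integral measurable_yor_call) (simp add: yor_call_def)

lemma measurable_yor_call_mean[measurable]: "yor_call_mean \<nu> a \<in> borel_measurable borel"
  unfolding yor_call_mean_eq_tail[abs_def] by measurable

lemma yor_call_laplace_finite:
  assumes "0 < z" "2 * (\<nu> + 1) < z" "0 \<le> a"
  shows "yor_call_laplace \<nu> z a < \<infinity>"
proof -
  have "yor_call_laplace \<nu> z a \<le> yor_call_laplace \<nu> z 0"
    unfolding yor_call_laplace_eq_tail using assms by (intro nn_integral_mono) (auto simp: indicator_def)
  then show ?thesis using yor_call_laplace_0[OF assms(1,2)] by (simp add: order_le_less_trans[OF _ ennreal_less_top])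
qed

lemma yor_call_laplace_real:
  assumes z: "max 0 (2 * (\<nu> + 1)) < z" and a: "0 \<le> a"
  shows "set_integrable lborel {0..} (\<lambda>x. exp (- z * x) * enn2real (yor_call_mean \<nu> a x))"
    and "(LBINT x:{0..}. exp (- z * x) * enn2real (yor_call_mean \<nu> a x)) = enn2real (yor_call_laplace \<nu> z a)"
proof -
  have eq: "(\<integral>\<^sup>+x. ennreal (indicator {0..} x *\<^sub>R (exp (- z * x) * enn2real (yor_call_mean \<nu> a x))) \<partial>lborel) = yor_call_laplace \<nu> z a"
    unfolding yor_call_laplace_def
  proof (rule nn_integral_cong_AE)
    have "ennreal (indicator {0..} x *\<^sub>R (exp (- z * x) * enn2real (yor_call_mean \<nu> a x))) = indicator {0<..} x * ennreal (exp (- z * x)) * yor_call_mean \<nu> a x"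
      if "x \<noteq> 0" for x
      using that yor_call_mean_finite[OF a, of \<nu> x] by (auto simp: indicator_def ennreal_mult)
    then show "AE x in lborel. ennreal (indicator {0..} x *\<^sub>R (exp (- z * x) * enn2real (yor_call_mean \<nu> a x))) = indicator {0<..} x * ennreal (exp (- z * x)) * yor_call_mean \<nu> a x"
      using AE_lborel_singleton[of 0] by (auto elim: eventually_mono)
  qed
  show "set_integrable lborel {0..} (\<lambda>x. exp (- z * x) * enn2real (yor_call_mean \<nu> a x))"
    unfolding set_integrable_def using z a
    by (intro integrableI_nonneg) (auto simp: eq[simplified] yor_call_laplace_finite[simplified])
  show "(LBINT x:{0..}. exp (- z * x) * enn2real (yor_call_mean \<nu> a x)) = enn2real (yor_call_laplace \<nu> z a)"
    unfolding set_lebesgue_integral_def eq[symmetric] by (intro integral_eq_nn_integral) auto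
qed

lemma set_integrable_GY_integrand:
  assumes z: "max 0 (2 * (\<nu> + 1)) < Re z" and a: "0 \<le> a"
  shows "set_integrable lborel {0..} (GY_integrand Q B \<nu> a z)"
proof (rule set_integrable_bound[OF yor_call_laplace_real(1)[OF z a]])
  show "set_borel_measurable lborel {0..} (GY_integrand Q B \<nu> a z)"
    unfolding set_borel_measurable_def GY_integrand_def integral_yor_call by measurable
  show "AE x in lborel. x \<in> {0..} \<longrightarrow> norm (GY_integrand Q B \<nu> a z x) \<le> norm (exp (- Re z * x) * enn2real (yor_call_mean \<nu> a x))"
    by (simp add: GY_integrand_def integral_yor_call norm_mult)
qed

text \<open>The call transform and the Kummer expression satisfy the same equation in
  \<open>u\<close> and both vanish at minus infinity. The constant \<open>L\<close> is chosen so
  that the limits at plus infinity agree as well: the Kummer side tends to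
  \<open>Gamma (b + c) / Gamma c\<close>, the transform to its value at strike 0. The maximum
  principle applied to the difference gives equality, which is read off at
  \<open>u = - ln (2 * a)\<close>.\<close>

lemma yor_call_laplace_closed:
  assumes z: "max 0 (2 * (\<nu> + 1)) < z" and a: "0 < a"
  defines "b \<equiv> sqrt (2 * z + \<nu>\<^sup>2) / 2 - 1 - \<nu> / 2"
  shows "enn2real (yor_call_laplace \<nu> z a) = 1 / (z * (z - 2 * (\<nu> + 1))) *
    (exp (- (1 / (2 * a))) * (1 / (2 * a)) powr b * (Gamma (b + \<nu> + 3) / Gamma (b + (b + \<nu> + 3))) *
      kummer (b + \<nu> + 3) (b + (b + \<nu> + 3)) (1 / (2 * a)))"
proof -
  define c where "c = b + \<nu> + 3"
  define L where "L = 1 / (z * (z - 2 * (\<nu> + 1))) * (Gamma c / Gamma (b + c))"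
  have z0: "0 < z" "2 * (\<nu> + 1) < z" using z by auto
  have m2: "(sqrt (2 * z + \<nu>\<^sup>2))\<^sup>2 = 2 * z + \<nu>\<^sup>2" using z0 by simp
  have "\<bar>\<nu> + 2\<bar> < sqrt (2 * z + \<nu>\<^sup>2)"
    by (rule real_less_rsqrt) (use z0 in \<open>simp add: power2_eq_square algebra_simps\<close>)
  then have b: "0 < b" "1 \<le> c" by (auto simp: b_def c_def abs_less_iff field_simps)
  \<comment> \<open>\<open>b\<close> solves the quadratic equation that matches the zeroth order
    coefficient of \<open>kummer_log_ode\<close> with that of
    \<open>yor_call_laplace_ode\<close>.\<close>
  have pb: "b * (b + 2 + \<nu>) = z / 2 - \<nu> - 1"
    using m2 unfolding b_def by (simp add: field_simps power2_eq_square)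
  define g where "g u = enn2real (yor_call_laplace \<nu> z (exp (- u) / 2))" for u
  define D where "D u = exp (b * u - exp u) * kummer c (b + c) (exp u)" for u
  note ode = yor_call_laplace_ode[OF z0, folded g_def]
  obtain g1 g2 where g': "(\<forall>u. (g has_real_derivative g1 u) (at u)) \<and> (\<forall>u. (g1 has_real_derivative g2 u) (at u)) \<and>
    (\<forall>u. g2 u + (2 + \<nu> + exp u) * g1 u = (z / 2 - \<nu> - 1) * g u)"
    using ode(1) by - (elim exE, rule that)
  note g = g'[THEN conjunct1] g'[THEN conjunct2, THEN conjunct1] g'[THEN conjunct2, THEN conjunct2]
  have d1: "1 \<le> b + c" using b by simp
  obtain D1 D2 where D': "(\<forall>u. (D has_real_derivative D1 u) (at u)) \<and> (\<forall>u. (D1 has_real_derivative D2 u) (at u)) \<and>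
    (\<forall>u. D2 u + (2 + \<nu> + exp u) * D1 u = b * (b + 2 + \<nu>) * D u)"
    using kummer_log_ode[OF d1 c_def, folded D_def] by - (elim exE, rule that)
  note D = D'[THEN conjunct1] D'[THEN conjunct2, THEN conjunct1] D'[THEN conjunct2, THEN conjunct2]
  have Dbot: "(D \<longlongrightarrow> 0) at_bot"
    unfolding D_def[abs_def] by (rule kummer_log_at_bot[OF b(1) d1])
  have Dtop: "(D \<longlongrightarrow> Gamma (b + c) / Gamma c) at_top"
  proof -
    have "((\<lambda>u. exp (- exp u) * exp u powr b * kummer c (b + c) (exp u)) \<longlongrightarrow> Gamma (b + c) / Gamma c) at_top"
      by (rule filterlim_compose[OF kummer_asymptotics[OF b] exp_at_top])
    moreover have "exp (- exp u) * exp u powr b * kummer c (b + c) (exp u) = D u" for u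
      by (simp add: D_def powr_def exp_add[symmetric] exp_diff exp_minus divide_inverse mult_ac)
    ultimately show ?thesis by simp
  qed
  have G0: "Gamma c \<noteq> 0" "Gamma (b + c) \<noteq> 0"
    using b by (intro less_imp_neq[symmetric] Gamma_real_pos; simp)+
  have "g u - L * D u = 0" for u
  proof (rule maximum_principle[of "\<lambda>u. g u - L * D u" "\<lambda>u. g1 u - L * D1 u" "\<lambda>u. g2 u - L * D2 u" "\<lambda>u. 2 + \<nu> + exp u" "z / 2 - \<nu> - 1"])
    show "((\<lambda>u. g u - L * D u) has_real_derivative g1 u - L * D1 u) (at u)"
      "((\<lambda>u. g1 u - L * D1 u) has_real_derivative g2 u - L * D2 u) (at u)" for u
      using g(1,2) D(1,2) by (auto intro!: DERIV_diff DERIV_cmult)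
    show "g2 u - L * D2 u + (2 + \<nu> + exp u) * (g1 u - L * D1 u) = (z / 2 - \<nu> - 1) * (g u - L * D u)" for u
    proof -
      have "g2 u - L * D2 u + (2 + \<nu> + exp u) * (g1 u - L * D1 u) =
          (g2 u + (2 + \<nu> + exp u) * g1 u) - L * (D2 u + (2 + \<nu> + exp u) * D1 u)"
        by (simp add: algebra_simps)
      also have "\<dots> = (z / 2 - \<nu> - 1) * (g u - L * D u)"
        unfolding g(3)[THEN spec] D(3)[THEN spec] pb by (simp add: algebra_simps)
      finally show ?thesis .
    qed
    show "0 < z / 2 - \<nu> - 1" using z0 by simp
    have "((\<lambda>u. g u - L * D u) \<longlongrightarrow> 1 / (z * (z - 2 * (\<nu> + 1))) - L * (Gamma (b + c) / Gamma c)) at_top"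
      by (intro tendsto_diff tendsto_mult tendsto_const ode(2) Dtop)
    then show "((\<lambda>u. g u - L * D u) \<longlongrightarrow> 0) at_top" using G0 by (simp add: L_def)
    have "((\<lambda>u. g u - L * D u) \<longlongrightarrow> 0 - L * 0) at_bot"
      by (intro tendsto_diff tendsto_mult tendsto_const ode(3) Dbot)
    then show "((\<lambda>u. g u - L * D u) \<longlongrightarrow> 0) at_bot" by simp
  qed
  then have eq: "g (- ln (2 * a)) = L * D (- ln (2 * a))" by simp
  have ea: "exp (- (- ln (2 * a))) / 2 = a" "exp (- ln (2 * a)) = 1 / (2 * a)"
    using a by (simp_all add: exp_minus inverse_eq_divide)
  have "exp (b * (- ln (2 * a)) - 1 / (2 * a)) = exp (- (1 / (2 * a))) * (1 / (2 * a)) powr b"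
  proof -
    have "ln (1 / (2 * a)) = - ln (2 * a)" using a by (simp add: ln_div)
    then have "(1 / (2 * a)) powr b = exp (b * (- ln (2 * a)))" using a by (simp add: powr_def)
    then show ?thesis unfolding exp_add[symmetric] by (simp only: exp_add[symmetric]) (rule arg_cong[of _ _ exp], simp)
  qed
  then have "D (- ln (2 * a)) = exp (- (1 / (2 * a))) * (1 / (2 * a)) powr b * kummer c (b + c) (1 / (2 * a))"
    unfolding D_def ea by simp
  moreover have "g (- ln (2 * a)) = enn2real (yor_call_laplace \<nu> z a)" unfolding g_def ea ..
  ultimately show ?thesis
    using eq unfolding L_def c_def[symmetric] by (simp only: mult_ac)
qed

text \<open>Multiplying by the denominator gives a difference that is visibly holomorphic on the
  half-plane. It vanishes on the real ray by \<open>yor_call_laplace_closed\<close>; the half-plane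
  is connected and the ray accumulates at an interior point, so it vanishes identically.\<close>

theorem F_GY_eq_D_closed:
  assumes z: "max 0 (2 * (\<nu> + 1)) < Re z" and a: "0 < a"
  shows "F_GY Q B \<nu> a z = D_closed \<nu> (1 / (2 * a)) z / (z * (z - 2 * (complex_of_real \<nu> + 1)))"
proof -
  define \<delta> where "\<delta> = max 0 (2 * (\<nu> + 1))"
  let ?S = "{z. \<delta> < Re z}"
  let ?f = "\<lambda>z. F_GY Q B \<nu> a z * (z * (z - 2 * (complex_of_real \<nu> + 1))) - D_closed \<nu> (1 / (2 * a)) z"
  have F: "F_GY Q B \<nu> a z = (LBINT x:{0..}. exp (- z * complex_of_real x) * complex_of_real (enn2real (yor_call_mean \<nu> a x)))" for z
    unfolding F_GY_def GY_integrand_def integral_yor_call ..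
  have "F_GY Q B \<nu> a holomorphic_on ?S"
    unfolding F[abs_def] using a
    by (intro laplace_transform_holomorphic yor_call_laplace_real) (auto simp: \<delta>_def)
  moreover have "D_closed \<nu> (1 / (2 * a)) holomorphic_on ?S"
    unfolding \<delta>_def using a by (intro D_closed_holomorphic) simp
  ultimately have hol: "?f holomorphic_on ?S" by (intro holomorphic_intros)
  have real: "?f (complex_of_real r) = 0" if r: "\<delta> < r" for r
  proof -
    define m where "m = sqrt (2 * r + \<nu>\<^sup>2)"
    define b where "b = m / 2 - 1 - \<nu> / 2"
    define t where "t = 1 / (2 * a)"
    have r0: "0 < r" "2 * (\<nu> + 1) < r" and r': "max 0 (2 * (\<nu> + 1)) < r" using r by (auto simp: \<delta>_def)
    have t: "0 < t" using a by (simp add: t_def)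
    have F_real: "F_GY Q B \<nu> a (complex_of_real r) = of_real (enn2real (yor_call_laplace \<nu> r a))"
    proof -
      have "F_GY Q B \<nu> a (complex_of_real r) = (LBINT x:{0..}. complex_of_real (exp (- r * x) * enn2real (yor_call_mean \<nu> a x)))"
        unfolding F by (intro set_lebesgue_integral_cong) (auto simp: exp_of_real[symmetric])
      also have "\<dots> = of_real (LBINT x:{0..}. exp (- r * x) * enn2real (yor_call_mean \<nu> a x))"
        by (rule set_integral_complex_of_real)
      finally show ?thesis using yor_call_laplace_real(2)[OF r', of a] a by simp
    qed
    have mu: "csqrt (2 * complex_of_real r + complex_of_real (\<nu>\<^sup>2)) = of_real m"
    proof -
      have "2 * complex_of_real r + complex_of_real (\<nu>\<^sup>2) = of_real (2 * r + \<nu>\<^sup>2)" by simp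
      then show ?thesis using r0 by (simp only: csqrt_of_real m_def add_nonneg_nonneg zero_le_power2 mult_nonneg_nonneg zero_le_numeral less_imp_le)
    qed
    \<comment> \<open>For real \<open>z\<close> the order \<open>\<mu>\<close> is
      \<open>m = 2 * b + \<nu> + 2\<close>; this and the next two facts rewrite \<open>c\<close>,
      \<open>\<mu> + 1\<close> and \<open>\<mu> + 1 - c\<close> in terms of the exponent
      \<open>b\<close> of the real closed form.\<close>
    have c: "(of_real m + of_real \<nu>) / 2 + 2 = complex_of_real (b + \<nu> + 3)"
      by (simp add: b_def field_simps)
    have d: "of_real m + 1 = complex_of_real (b + (b + \<nu> + 3))"
      by (simp add: b_def field_simps)
    have e: "of_real m + 1 - ((of_real m + of_real \<nu>) / 2 + 2) = complex_of_real b"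
      by (simp add: b_def field_simps)
    have "\<bar>\<nu> + 2\<bar> < m"
      unfolding m_def by (rule real_less_rsqrt) (use r0 in \<open>simp add: power2_eq_square algebra_simps\<close>)
    then have d1: "1 \<le> b + (b + \<nu> + 3)" by (auto simp: b_def abs_less_iff field_simps)
    have tb: "complex_of_real t powr complex_of_real b = of_real (t powr b)"
      using t by (simp add: powr_of_real)
    have D_real: "D_closed \<nu> t (complex_of_real r) = of_real (exp (- t) * t powr b * (Gamma (b + \<nu> + 3) / Gamma (b + (b + \<nu> + 3))) *
        kummer (b + \<nu> + 3) (b + (b + \<nu> + 3)) t)"
      unfolding D_closed_def Let_def mu e c d kummer_of_real[OF d1] Gamma_complex_of_real by (simp add: tb)
    have nz: "r * (r - 2 * (\<nu> + 1)) \<noteq> 0" using r0 by auto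
    have rr: "complex_of_real r * (complex_of_real r - 2 * (complex_of_real \<nu> + 1)) = of_real (r * (r - 2 * (\<nu> + 1)))" by simp
    have "enn2real (yor_call_laplace \<nu> r a) * (r * (r - 2 * (\<nu> + 1))) = exp (- t) * t powr b * (Gamma (b + \<nu> + 3) / Gamma (b + (b + \<nu> + 3))) *
        kummer (b + \<nu> + 3) (b + (b + \<nu> + 3)) t"
      unfolding yor_call_laplace_closed[OF r' a] m_def[symmetric] b_def[symmetric] t_def[symmetric] using nz by simp
    then show ?thesis
      unfolding F_real t_def[symmetric] D_real rr of_real_mult[symmetric] by simp
  qed
  have "?f z = 0"
  proof (rule analytic_continuation[OF hol])
    show "open ?S" by (rule open_halfspace_Re_gt)
    show "connected ?S" by (intro convex_connected convex_halfspace_Re_gt)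
    show "complex_of_real ` {\<delta><..} \<subseteq> ?S" by auto
    show "complex_of_real (\<delta> + 1) \<in> ?S" by simp
    show "complex_of_real (\<delta> + 1) islimpt complex_of_real ` {\<delta><..}"
      unfolding islimpt_approachable
    proof (intro allI impI)
      fix e :: real assume e: "0 < e"
      have "dist (complex_of_real (\<delta> + 1 + e / 2)) (complex_of_real (\<delta> + 1)) < e"
        unfolding dist_of_real using e by (simp add: dist_real_def)
      moreover have "complex_of_real (\<delta> + 1 + e / 2) \<noteq> complex_of_real (\<delta> + 1)"
        using e by (simp only: of_real_eq_iff)
      moreover have "complex_of_real (\<delta> + 1 + e / 2) \<in> complex_of_real ` {\<delta><..}"
        using e by (intro imageI) simp
      ultimately show "\<exists>x'\<in>complex_of_real ` {\<delta><..}. x' \<noteq> complex_of_real (\<delta> + 1) \<and> dist x' (complex_of_real (\<delta> + 1)) < e"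
        by blast
    qed
    show "?f w = 0" if "w \<in> complex_of_real ` {\<delta><..}" for w using that real by auto
    show "z \<in> ?S" using z by (simp add: \<delta>_def)
  qed
  moreover have "z \<noteq> 0" "z - 2 * (complex_of_real \<nu> + 1) \<noteq> 0"
    using z by (auto dest: arg_cong[of _ _ Re])
  ultimately show ?thesis by (subst nonzero_eq_divide_eq) auto
qed

end

theorem mainTheorem1:
  fixes Q :: "'a measure" and B :: "real \<Rightarrow> 'a \<Rightarrow> real" and \<sigma> varpi \<nu> a :: real
  assumes BM: "std_brownian_motion Q B"
    and sigma: "\<sigma> > 0"
    and nu: "\<nu> = 2 * varpi / \<sigma>\<^sup>2 - 1"
    and a: "a > 0"
  shows "(\<forall>z :: complex. Re z > max 0 (2 * (\<nu> + 1)) \<longrightarrow>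
            (\<forall>x\<ge>0. integrable Q (yor_call B \<nu> a x)) \<and>
            set_integrable lborel {0..} (GY_integrand Q B \<nu> a z)) \<and>
         (\<forall>z :: complex. Re z > 0 \<and> (\<nu> \<ge> 0 \<longrightarrow> Re z > 2 * (\<nu> + 1)) \<and> (\<nu> < 0 \<longrightarrow> Re z > 4) \<longrightarrow>
            set_integrable lborel {0<..} (D_integrand \<nu> a z) \<and>
            F_GY Q B \<nu> a z = D_GY \<nu> a z / (z * (z - 2 * (complex_of_real \<nu> + 1))))"
proof (intro conjI allI impI)
  interpret std_brownian_motion Q B by (rule BM)
  show "integrable Q (yor_call B \<nu> a x)" for x using a by (intro integrable_yor_call) simp
  show "set_integrable lborel {0..} (GY_integrand Q B \<nu> a z)" if "max 0 (2 * (\<nu> + 1)) < Re z" for z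
    using that a by (intro set_integrable_GY_integrand) auto
next
  interpret std_brownian_motion Q B by (rule BM)
  fix z :: complex
  assume z': "0 < Re z \<and> (0 \<le> \<nu> \<longrightarrow> 2 * (\<nu> + 1) < Re z) \<and> (\<nu> < 0 \<longrightarrow> 4 < Re z)"
  \<comment> \<open>For negative \<open>\<nu>\<close> the number \<open>2 * (\<nu> + 1)\<close> is
    below 2 and hence below 4, so both cases lie in the half-plane of
    \<open>F_GY_eq_D_closed\<close>.\<close>
  then have z: "max 0 (2 * (\<nu> + 1)) < Re z" by (cases "\<nu> < 0") auto
  define \<mu> where "\<mu> = csqrt (2 * z + complex_of_real (\<nu>\<^sup>2))"
  define c where "c = (\<mu> + of_real \<nu>) / 2 + 2"
  have "\<bar>\<nu> + 2\<bar> < Re \<mu>" unfolding \<mu>_def using z by (intro Re_csqrt_gt) auto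
  then have "0 < Re \<mu>" "0 < Re c" by (auto simp: c_def abs_less_iff field_simps)
  note D = D_GY_eq_kummer[OF a \<mu>_def this(1) c_def this(2)]
  show "set_integrable lborel {0<..} (D_integrand \<nu> a z)" by (rule D(1))
  have "D_GY \<nu> a z = D_closed \<nu> (1 / (2 * a)) z"
    unfolding D(2) D_closed_def Let_def \<mu>_def[symmetric] c_def[symmetric] ..
  then show "F_GY Q B \<nu> a z = D_GY \<nu> a z / (z * (z - 2 * (complex_of_real \<nu> + 1)))"
    using F_GY_eq_D_closed[OF z a] by simp
qed

end
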